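(* The category $\mathbf{Q}$ is enriched over the category $\mathbf{DOM}$ of continuous dcpos and Scott-continuous maps. That is, for all hereditarily atomic von Neumann algebras $A,B$, the homset $\mathbf{Q}(A,B)$, ordered by $\varphi\le\psi$ iff $\psi-\varphi$ is completely positive, is a continuous dcpo, and composition $\mathbf{Q}(A,B)\times\mathbf{Q}(B,C)\to\mathbf{Q}(A,C)$ is Scott-continuous.
   Context: A von Neumann algebra is a $*$-subalgebra $M\subseteq B(H)$ ($H$ a Hilbert space) with $M''=M$. A linear map $\varphi:M\to N$ between von Neumann algebras is an NCPSU map if it is normal (preserves suprema of bounded increasing nets of self-adjoint elements in the Löwner order), completely positive (each entrywise amplification $\varphi^{(n)}:\mathrm{M}_n(M)\to\mathrm{M}_n(N)$ is positive) and subunital ($\varphi(1)\le 1$). A von Neumann algebra is hereditarily atomic (an HA-algebra) if it is $*$-isomorphic to a product $\prod_{\alpha}M_\alpha=\{(x_\alpha)_\alpha:\sup_\alpha\|x_\alpha\|<\infty\}$ where each $M_\alpha$ is $*$-isomorphic to a full matrix algebra $\mathrm{M}_{n_\alpha}(\mathbb C)$. $\mathbf{HA}$ is the category of HA-algebras and NCPSU maps, and $\mathbf{Q}=\mathbf{HA}^{\mathrm{op}}$, so $\mathbf{Q}(A,B)=\mathbf{HA}(B,A)$. A dcpo $D$ is continuous if every element is the directed supremum of elements way-below it, where $x\ll y$ means: whenever $y\le\sup S$ for directed $S$, some $s\in S$ has $x\le s$. *)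

theory Defs
  imports
    "HOL-Analysis.Analysis"
    "HOL-Algebra.QuotRing"
    "Jordan_Normal_Form.Schur_Decomposition"
begin

section \<open>Directed completeness and continuity of ordered sets\<close>

definition directed_in :: "('a, 'm) gorder_scheme \<Rightarrow> 'a set \<Rightarrow> bool" where
  "directed_in L S \<longleftrightarrow> S \<subseteq> carrier L \<and> S \<noteq> {} \<and>
     (\<forall>x\<in>S. \<forall>y\<in>S. \<exists>z\<in>S. x \<sqsubseteq>\<^bsub>L\<^esub> z \<and> y \<sqsubseteq>\<^bsub>L\<^esub> z)"

definition dcpo :: "('a, 'm) gorder_scheme \<Rightarrow> bool" where
  "dcpo L \<longleftrightarrow> partial_order L \<and> (\<forall>S. directed_in L S \<longrightarrow> (\<exists>s. is_lub L s S))"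

definition way_below :: "('a, 'm) gorder_scheme \<Rightarrow> 'a \<Rightarrow> 'a \<Rightarrow> bool" where
  "way_below L x y \<longleftrightarrow>
     x \<in> carrier L \<and> y \<in> carrier L \<and>
     (\<forall>S s. directed_in L S \<longrightarrow> is_lub L s S \<longrightarrow> y \<sqsubseteq>\<^bsub>L\<^esub> s \<longrightarrow> (\<exists>z\<in>S. x \<sqsubseteq>\<^bsub>L\<^esub> z))"

definition continuous_dcpo :: "('a, 'm) gorder_scheme \<Rightarrow> bool" where
  "continuous_dcpo L \<longleftrightarrow> dcpo L \<and>
     (\<forall>y\<in>carrier L. directed_in L {x. way_below L x y} \<and> is_lub L y {x. way_below L x y})"

definition preserves_directed_sups ::
  "('a, 'm) gorder_scheme \<Rightarrow> ('b, 'n) gorder_scheme \<Rightarrow> ('a \<Rightarrow> 'b) \<Rightarrow> bool" where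
  "preserves_directed_sups L K f \<longleftrightarrow>
     (\<forall>S s. directed_in L S \<longrightarrow> is_lub L s S \<longrightarrow> is_lub K (f s) (f ` S))"

text \<open>Monotonicity is a consequence: if \<open>x \<sqsubseteq> y\<close> then \<open>{x, y}\<close> is directed with supremum \<open>y\<close>.\<close>

definition scott_continuous ::
  "('a, 'm) gorder_scheme \<Rightarrow> ('b, 'n) gorder_scheme \<Rightarrow> ('a \<Rightarrow> 'b) \<Rightarrow> bool" where
  "scott_continuous L K f \<longleftrightarrow> f \<in> carrier L \<rightarrow> carrier K \<and> preserves_directed_sups L K f"

definition prod_order :: "'a gorder \<Rightarrow> 'b gorder \<Rightarrow> ('a \<times> 'b) gorder" where
  "prod_order L K = \<lparr>carrier = carrier L \<times> carrier K, eq = (=),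
     le = (\<lambda>p q. fst p \<sqsubseteq>\<^bsub>L\<^esub> fst q \<and> snd p \<sqsubseteq>\<^bsub>K\<^esub> snd q)\<rparr>"


section \<open>Complex Hilbert spaces and their bounded operators\<close>

class complex_hilbert_space = banach +
  fixes scaleC :: "complex \<Rightarrow> 'a \<Rightarrow> 'a"  (infixr \<open>*\<^sub>C\<close> 75)
    and cinner :: "'a \<Rightarrow> 'a \<Rightarrow> complex"
  assumes scaleC_add_right: "c *\<^sub>C (x + y) = c *\<^sub>C x + c *\<^sub>C y"
    and scaleC_add_left: "(c + d) *\<^sub>C x = c *\<^sub>C x + d *\<^sub>C x"
    and scaleC_scaleC: "c *\<^sub>C (d *\<^sub>C x) = (c * d) *\<^sub>C x"
    and scaleC_of_real: "complex_of_real r *\<^sub>C x = r *\<^sub>R x"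
    and cinner_commute: "cinner x y = cnj (cinner y x)"
    and cinner_add_right: "cinner x (y + z) = cinner x y + cinner x z"
    and cinner_scaleC_right: "cinner x (c *\<^sub>C y) = c * cinner x y"
    and cinner_self: "cinner x x = complex_of_real ((norm x)\<^sup>2)"

lemma norm_scaleC: "norm (c *\<^sub>C x) = cmod c * norm x" for x :: "'h::complex_hilbert_space"
proof -
  have "cinner (c *\<^sub>C x) (c *\<^sub>C x) = c * cnj (c * cinner x x)"
    by (metis cinner_commute cinner_scaleC_right)
  also have "\<dots> = (c * cnj c) * complex_of_real ((norm x)\<^sup>2)"
    by (simp add: cinner_self)
  also have "\<dots> = complex_of_real ((cmod c * norm x)\<^sup>2)"
    by (simp only: complex_norm_square[symmetric] of_real_mult[symmetric] power_mult_distrib)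
  finally have "(norm (c *\<^sub>C x))\<^sup>2 = (cmod c * norm x)\<^sup>2"
    by (simp only: cinner_self of_real_eq_iff)
  then show ?thesis
    by simp
qed

lemma bounded_linear_scaleC: "bounded_linear ((*\<^sub>C) c :: 'h::complex_hilbert_space \<Rightarrow> 'h)"
proof (rule bounded_linear_intro[where K = "cmod c"])
  fix r and x :: 'h
  show "c *\<^sub>C (r *\<^sub>R x) = r *\<^sub>R (c *\<^sub>C x)"
    by (metis mult.commute scaleC_of_real scaleC_scaleC)
qed (simp_all add: scaleC_add_right norm_scaleC mult.commute)

text \<open>The library type \<open>'h \<Rightarrow>\<^sub>L 'h\<close> consists of the bounded \<^emph>\<open>real\<close>-linear operators; \<open>B(H)\<close> is the
  subset of the complex-linear ones.\<close>

definition bounded_operators :: "('h::complex_hilbert_space \<Rightarrow>\<^sub>L 'h) set" where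
  "bounded_operators = {T. \<forall>c x. blinfun_apply T (c *\<^sub>C x) = c *\<^sub>C blinfun_apply T x}"

lift_definition op_scale ::
  "complex \<Rightarrow> ('h::complex_hilbert_space \<Rightarrow>\<^sub>L 'h) \<Rightarrow> ('h \<Rightarrow>\<^sub>L 'h)" is "\<lambda>c T x. c *\<^sub>C T x"
  by (rule bounded_linear_compose[OF bounded_linear_scaleC])

text \<open>For \<open>T \<in> B(H)\<close> existence and uniqueness of the adjoint come from the Riesz representation theorem.\<close>

definition op_adjoint :: "('h::complex_hilbert_space \<Rightarrow>\<^sub>L 'h) \<Rightarrow> ('h \<Rightarrow>\<^sub>L 'h)" where
  "op_adjoint T = (THE S. S \<in> bounded_operators \<and>
     (\<forall>x y. cinner (blinfun_apply S x) y = cinner x (blinfun_apply T y)))"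

text \<open>The order \<open>0 \<le> z\<close> on \<^typ>\<open>complex\<close> is that of \<^theory>\<open>HOL-Library.Complex_Order\<close>:
  \<open>z\<close> is real and nonnegative.\<close>

definition op_positive :: "('h::complex_hilbert_space \<Rightarrow>\<^sub>L 'h) \<Rightarrow> bool" where
  "op_positive T \<longleftrightarrow> (\<forall>x. 0 \<le> cinner x (blinfun_apply T x))"


section \<open>Von Neumann algebras\<close>

definition star_subalgebra :: "('h::complex_hilbert_space \<Rightarrow>\<^sub>L 'h) set \<Rightarrow> bool" where
  "star_subalgebra M \<longleftrightarrow> M \<subseteq> bounded_operators \<and> 0 \<in> M \<and>
     (\<forall>x\<in>M. \<forall>y\<in>M. x + y \<in> M) \<and>
     (\<forall>c. \<forall>x\<in>M. op_scale c x \<in> M) \<and>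
     (\<forall>x\<in>M. \<forall>y\<in>M. x o\<^sub>L y \<in> M) \<and>
     (\<forall>x\<in>M. op_adjoint x \<in> M)"

definition commutant ::
  "('h::complex_hilbert_space \<Rightarrow>\<^sub>L 'h) set \<Rightarrow> ('h \<Rightarrow>\<^sub>L 'h) set" where
  "commutant M = {T \<in> bounded_operators. \<forall>x\<in>M. T o\<^sub>L x = x o\<^sub>L T}"

definition von_neumann_algebra :: "('h::complex_hilbert_space \<Rightarrow>\<^sub>L 'h) set \<Rightarrow> bool" where
  "von_neumann_algebra M \<longleftrightarrow> star_subalgebra M \<and> commutant (commutant M) = M"

text \<open>The self-adjoint part of \<open>M\<close> with the Loewner order.\<close>

definition loewner_order :: "('h::complex_hilbert_space \<Rightarrow>\<^sub>L 'h) set \<Rightarrow> ('h \<Rightarrow>\<^sub>L 'h) gorder" where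
  "loewner_order M = \<lparr>carrier = {x \<in> M. op_adjoint x = x}, eq = (=),
     le = (\<lambda>x y. op_positive (y - x))\<rparr>"


section \<open>Products of matrix algebras and hereditarily atomic algebras\<close>

record 'a normed_star_algebra = "(complex, 'a) module" +
  adj :: "'a \<Rightarrow> 'a"
  nrm :: "'a \<Rightarrow> real"

definition star_iso ::
  "('a, 'm) normed_star_algebra_scheme \<Rightarrow> ('b, 'n) normed_star_algebra_scheme \<Rightarrow> ('a \<Rightarrow> 'b) set" where
  "star_iso A B = {f \<in> ring_iso A B.
     (\<forall>c. \<forall>x\<in>carrier A. f (c \<odot>\<^bsub>A\<^esub> x) = c \<odot>\<^bsub>B\<^esub> f x) \<and>
     (\<forall>x\<in>carrier A. f (adj A x) = adj B (f x))}"

definition operator_algebra ::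
  "('h::complex_hilbert_space \<Rightarrow>\<^sub>L 'h) set \<Rightarrow> ('h \<Rightarrow>\<^sub>L 'h) normed_star_algebra" where
  "operator_algebra M = \<lparr>carrier = M, mult = (o\<^sub>L), one = id_blinfun, zero = 0, add = (+),
     smult = op_scale, adj = op_adjoint, nrm = norm\<rparr>"

definition vec_l2norm :: "complex vec \<Rightarrow> real" where
  "vec_l2norm v = L2_set (\<lambda>i. cmod (vec_index v i)) {..<dim_vec v}"

definition mat_opnorm :: "complex mat \<Rightarrow> real" where
  "mat_opnorm X = (SUP v\<in>{v \<in> carrier_vec (dim_col X). vec_l2norm v \<le> 1}. vec_l2norm (X *\<^sub>v v))"

definition matrix_algebra :: "nat \<Rightarrow> complex mat normed_star_algebra" where
  "matrix_algebra n = \<lparr>carrier = carrier_mat n n, mult = (*), one = 1\<^sub>m n, zero = 0\<^sub>m n n, add = (+),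
     smult = (\<cdot>\<^sub>m), adj = mat_adjoint, nrm = mat_opnorm\<rparr>"

definition product_algebra ::
  "'i set \<Rightarrow> ('i \<Rightarrow> 'a normed_star_algebra) \<Rightarrow> ('i \<Rightarrow> 'a) normed_star_algebra" where
  "product_algebra I \<A> = \<lparr>
     carrier = {x \<in> \<Pi>\<^sub>E \<alpha>\<in>I. carrier (\<A> \<alpha>). bdd_above ((\<lambda>\<alpha>. nrm (\<A> \<alpha>) (x \<alpha>)) ` I)},
     mult = (\<lambda>x y. \<lambda>\<alpha>\<in>I. x \<alpha> \<otimes>\<^bsub>\<A> \<alpha>\<^esub> y \<alpha>),
     one = (\<lambda>\<alpha>\<in>I. \<one>\<^bsub>\<A> \<alpha>\<^esub>),
     zero = (\<lambda>\<alpha>\<in>I. \<zero>\<^bsub>\<A> \<alpha>\<^esub>),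
     add = (\<lambda>x y. \<lambda>\<alpha>\<in>I. x \<alpha> \<oplus>\<^bsub>\<A> \<alpha>\<^esub> y \<alpha>),
     smult = (\<lambda>c x. \<lambda>\<alpha>\<in>I. c \<odot>\<^bsub>\<A> \<alpha>\<^esub> x \<alpha>),
     adj = (\<lambda>x. \<lambda>\<alpha>\<in>I. adj (\<A> \<alpha>) (x \<alpha>)),
     nrm = (\<lambda>x. SUP \<alpha>\<in>I. nrm (\<A> \<alpha>) (x \<alpha>))\<rparr>"

text \<open>HOL cannot quantify existentially over the type of the index \<open>\<alpha>\<close>, so that type is a parameter,
  to be universally quantified in theorems. The index set is an arbitrary subset of it.\<close>

definition hereditarily_atomic ::
  "'i itself \<Rightarrow> ('h::complex_hilbert_space \<Rightarrow>\<^sub>L 'h) set \<Rightarrow> bool" where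
  "hereditarily_atomic (ty :: 'i itself) M \<longleftrightarrow> von_neumann_algebra M \<and>
     (\<exists>(I :: 'i set) n. star_iso (operator_algebra M) (product_algebra I (\<lambda>\<alpha>. matrix_algebra (n \<alpha>))) \<noteq> {})"


section \<open>NCPSU maps\<close>

definition linear_map ::
  "('h::complex_hilbert_space \<Rightarrow>\<^sub>L 'h) set \<Rightarrow> ('k::complex_hilbert_space \<Rightarrow>\<^sub>L 'k) set \<Rightarrow>
     (('h \<Rightarrow>\<^sub>L 'h) \<Rightarrow> ('k \<Rightarrow>\<^sub>L 'k)) \<Rightarrow> bool" where
  "linear_map M N \<phi> \<longleftrightarrow> \<phi> \<in> M \<rightarrow> N \<and>
     (\<forall>x\<in>M. \<forall>y\<in>M. \<phi> (x + y) = \<phi> x + \<phi> y) \<and>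
     (\<forall>c. \<forall>x\<in>M. \<phi> (op_scale c x) = op_scale c (\<phi> x))"

text \<open>Positivity of the matrix \<open>(X\<^sub>i\<^sub>j)\<close>, \<open>i, j < n\<close>, of operators on \<open>H\<close> as an operator on \<open>H\<^sup>n\<close>.\<close>

definition op_matrix_positive ::
  "nat \<Rightarrow> (nat \<Rightarrow> nat \<Rightarrow> ('h::complex_hilbert_space \<Rightarrow>\<^sub>L 'h)) \<Rightarrow> bool" where
  "op_matrix_positive n X \<longleftrightarrow>
     (\<forall>v :: nat \<Rightarrow> 'h. 0 \<le> (\<Sum>i<n. cinner (v i) (\<Sum>j<n. blinfun_apply (X i j) (v j))))"

definition completely_positive ::
  "('h::complex_hilbert_space \<Rightarrow>\<^sub>L 'h) set \<Rightarrow> ('k::complex_hilbert_space \<Rightarrow>\<^sub>L 'k) set \<Rightarrow>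
     (('h \<Rightarrow>\<^sub>L 'h) \<Rightarrow> ('k \<Rightarrow>\<^sub>L 'k)) \<Rightarrow> bool" where
  "completely_positive M N \<phi> \<longleftrightarrow> linear_map M N \<phi> \<and>
     (\<forall>n X. (\<forall>i<n. \<forall>j<n. X i j \<in> M) \<longrightarrow> op_matrix_positive n X \<longrightarrow>
        op_matrix_positive n (\<lambda>i j. \<phi> (X i j)))"

text \<open>A bounded increasing net enters only through its range, a directed set that is bounded above;
  conversely a directed set is an increasing net indexed by itself.\<close>

definition normal_map ::
  "('h::complex_hilbert_space \<Rightarrow>\<^sub>L 'h) set \<Rightarrow> ('k::complex_hilbert_space \<Rightarrow>\<^sub>L 'k) set \<Rightarrow>
     (('h \<Rightarrow>\<^sub>L 'h) \<Rightarrow> ('k \<Rightarrow>\<^sub>L 'k)) \<Rightarrow> bool" where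
  "normal_map M N \<phi> \<longleftrightarrow> preserves_directed_sups (loewner_order M) (loewner_order N) \<phi>"

text \<open>Maps are taken extensional, so that equality of maps is equality on \<open>M\<close>.\<close>

definition ncpsu_maps ::
  "('h::complex_hilbert_space \<Rightarrow>\<^sub>L 'h) set \<Rightarrow> ('k::complex_hilbert_space \<Rightarrow>\<^sub>L 'k) set \<Rightarrow>
     (('h \<Rightarrow>\<^sub>L 'h) \<Rightarrow> ('k \<Rightarrow>\<^sub>L 'k)) set" where
  "ncpsu_maps M N = {\<phi> \<in> extensional M. linear_map M N \<phi> \<and> normal_map M N \<phi> \<and>
     completely_positive M N \<phi> \<and> op_positive (id_blinfun - \<phi> id_blinfun)}"

text \<open>The homset \<open>\<^bold>Q(A, B) = \<^bold>H\<^bold>A(B, A)\<close>: its elements are maps from \<open>B\<close> to \<open>A\<close>.\<close>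

definition Q_hom ::
  "('h::complex_hilbert_space \<Rightarrow>\<^sub>L 'h) set \<Rightarrow> ('k::complex_hilbert_space \<Rightarrow>\<^sub>L 'k) set \<Rightarrow>
     (('k \<Rightarrow>\<^sub>L 'k) \<Rightarrow> ('h \<Rightarrow>\<^sub>L 'h)) gorder" where
  "Q_hom A B = \<lparr>carrier = ncpsu_maps B A, eq = (=),
     le = (\<lambda>\<phi> \<psi>. completely_positive B A (\<lambda>x. \<psi> x - \<phi> x))\<rparr>"

text \<open>The composite in \<open>\<^bold>Q\<close> of \<open>\<phi> \<in> \<^bold>Q(A, B)\<close> and \<open>\<psi> \<in> \<^bold>Q(B, C)\<close> is the map \<open>\<phi> \<circ> \<psi>\<close> from \<open>C\<close> to \<open>A\<close>.\<close>

definition Q_comp ::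
  "('l::complex_hilbert_space \<Rightarrow>\<^sub>L 'l) set \<Rightarrow>
     (('k::complex_hilbert_space \<Rightarrow>\<^sub>L 'k) \<Rightarrow> ('h::complex_hilbert_space \<Rightarrow>\<^sub>L 'h)) \<times>
     (('l \<Rightarrow>\<^sub>L 'l) \<Rightarrow> ('k \<Rightarrow>\<^sub>L 'k)) \<Rightarrow> (('l \<Rightarrow>\<^sub>L 'l) \<Rightarrow> ('h \<Rightarrow>\<^sub>L 'h))" where
  "Q_comp C = (\<lambda>(\<phi>, \<psi>). compose C \<phi> \<psi>)"

end

theory Submission
  imports Defs
begin

text \<open>
  Positive forms satisfy the Cauchy--Schwarz inequality, so a bounded increasing net of self-adjoint
  operators converges weakly to its supremum, and a supremum in a von Neumann algebra is the same as a
  weak limit. Consequently directed suprema of NCPSU maps are computed pointwise, and complete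
  positivity, being closed under pointwise weak limits, passes to all the limits that occur.

  Hereditary atomicity enters only through central projections \<open>z\<close> that increase to \<open>1\<close> and have
  finite-dimensional corners \<open>z M\<close>. For such \<open>z \<in> A\<close>, \<open>w \<in> B\<close> and \<open>r < 1\<close> the map \<open>x \<mapsto> r z \<phi>(w x)\<close>
  is way below \<open>\<phi>\<close>: if \<open>s\<close> increases to \<open>\<Phi> \<ge> \<phi>\<close>, then the differences \<open>z (\<Phi> - s)(w \<cdot>)\<close> lie in the
  order ideal generated by \<open>\<Lambda> = z \<Phi>(w \<cdot>)\<close>. This ideal is finite-dimensional, so its elements are linear
  combinations of fixed ones whose coefficients are finitely many evaluations; these tend to \<open>0\<close>, and
  eventually the difference is at most \<open>(1 - r) \<Lambda>\<close>. The maps \<open>x \<mapsto> r z \<phi>(w x)\<close> are directed with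
  supremum \<open>\<phi>\<close> because \<open>\<phi>\<close> is normal.
\<close>

section \<open>Complex Hilbert spaces\<close>

text \<open>Suprema of maps are seen only pointwise and weakly, whereas \<open>way_below\<close>
  asks for one \<open>s\<close> that dominates in the completely positive order, for all arguments
  and matrix sizes at once. So finitely many scalar conditions must control that order. Cutting by
  \<open>w\<close> leaves finitely many arguments to watch, cutting by \<open>z\<close> finitely
  many directions for the values; hence the cut on both sides. The finite-dimensional space of all
  cuts is still too big: \<open>\<Lambda>\<close> may be degenerate, and then a small element of
  that space need not lie below any multiple of \<open>\<Lambda>\<close>. In the order ideal each
  element comes with such a multiple, and the differences do lie there, since
  \<open>\<Lambda>\<close> minus the difference is the cut of \<open>s\<close>. Evaluations serve as
  coefficients so that pointwise convergence is enough. The factor \<open>r < 1\<close> provides the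
  slack \<open>(1 - r) \<Lambda>\<close>; for \<open>r = 1\<close> the difference would have to
  vanish. Composition is treated one argument at a time; directedness turns a bound on the given
  pairs into a bound on all combinations of their components.\<close>

abbreviation form :: "('h::complex_hilbert_space \<Rightarrow>\<^sub>L 'h) \<Rightarrow> 'h \<Rightarrow> 'h \<Rightarrow> complex" where
  "form T x y \<equiv> cinner x (blinfun_apply T y)"

lemma cinner_add_left: "cinner (x + y) z = cinner x z + cinner y z"
  by (metis cinner_commute cinner_add_right complex_cnj_add)

lemma cinner_scaleC_left: "cinner (c *\<^sub>C x) y = cnj c * cinner x y"
  by (metis cinner_commute cinner_scaleC_right complex_cnj_mult)

lemma scaleC_zero_left [simp]: "0 *\<^sub>C x = (0 :: 'h::complex_hilbert_space)"
  by (metis of_real_0 scaleC_of_real scaleR_zero_left)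

lemma scaleC_one [simp]: "1 *\<^sub>C x = (x :: 'h::complex_hilbert_space)"
  by (metis of_real_1 scaleC_of_real scaleR_one)

lemma scaleC_minus_one: "(-1) *\<^sub>C x = - (x :: 'h::complex_hilbert_space)"
  by (metis of_real_1 of_real_minus scaleC_of_real scaleR_minus1_left)

lemma scaleC_zero_right [simp]: "c *\<^sub>C 0 = (0 :: 'h::complex_hilbert_space)"
  by (metis add_cancel_right_right scaleC_add_right)

lemma scaleC_minus_right: "c *\<^sub>C (- x) = - (c *\<^sub>C x :: 'h::complex_hilbert_space)"
  by (metis add.right_inverse neg_eq_iff_add_eq_0 scaleC_add_right scaleC_zero_right)

lemma scaleC_diff_right: "c *\<^sub>C (x - y) = c *\<^sub>C x - (c *\<^sub>C y :: 'h::complex_hilbert_space)"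
  by (metis diff_conv_add_uminus scaleC_add_right scaleC_minus_right)

lemma cinner_zero_right [simp]: "cinner x 0 = 0"
  by (metis add_cancel_right_right cinner_add_right)

lemma cinner_zero_left [simp]: "cinner 0 x = 0"
  by (metis cinner_commute cinner_zero_right complex_cnj_zero)

lemma cinner_minus_right: "cinner x (- y) = - cinner x y"
  by (metis cinner_scaleC_right mult_minus1 scaleC_minus_one)

lemma cinner_minus_left: "cinner (- x) y = - cinner x y"
  by (metis cinner_commute cinner_minus_right complex_cnj_minus)

lemma cinner_diff_right: "cinner x (y - z) = cinner x y - cinner x z"
  by (metis cinner_add_right cinner_minus_right diff_conv_add_uminus)

lemma cinner_diff_left: "cinner (x - y) z = cinner x z - cinner y z"
  by (metis cinner_add_left cinner_minus_left diff_conv_add_uminus)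

lemma cinner_sum_right: "cinner x (\<Sum>i\<in>I. f i) = (\<Sum>i\<in>I. cinner x (f i))"
  by (induct I rule: infinite_finite_induct) (simp_all add: cinner_add_right)

lemmas cinner_simps = cinner_add_left cinner_add_right cinner_diff_left cinner_diff_right
  cinner_scaleC_left cinner_scaleC_right cinner_minus_left cinner_minus_right

lemma cinner_eqI_right:
  assumes "\<And>x. cinner x y = cinner x z" shows "y = z"
proof -
  have "cinner (y - z) (y - z) = 0"
    using assms[of "y - z"] by (simp add: cinner_diff_right)
  then show ?thesis by (simp add: cinner_self)
qed

lemma cinner_eqI_left:
  assumes "\<And>x. cinner y x = cinner z x" shows "y = z"
  by (rule cinner_eqI_right) (metis assms cinner_commute)

lemma Re_cinner_eqI_right:
  assumes "\<And>x. Re (cinner x y) = Re (cinner x z)" shows "y = z"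
proof -
  have "Re (cinner (y - z) (y - z)) = 0"
    using assms[of "y - z"] by (simp add: cinner_diff_right)
  then show ?thesis by (simp add: cinner_self)
qed

lemma blinfun_eqI_form:
  assumes "\<And>x y. form S x y = form T x y" shows "S = T"
  by (rule blinfun_eqI, rule cinner_eqI_right) (rule assms)

lemma complex_ge_0_iff: "(0::complex) \<le> z \<longleftrightarrow> 0 \<le> Re z \<and> Im z = 0"
  by (auto simp: less_eq_complex_def)

lemma mem_bounded_operatorsD: "T \<in> bounded_operators \<Longrightarrow> T (c *\<^sub>C x) = c *\<^sub>C T x"
  by (simp add: bounded_operators_def)

lemma form_scaleC_right:
  "T \<in> bounded_operators \<Longrightarrow> form T x (c *\<^sub>C y) = c * form T x y"
  by (simp add: mem_bounded_operatorsD cinner_scaleC_right)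

lemmas blinfun_lin = blinfun.add_left blinfun.add_right blinfun.diff_left blinfun.diff_right

lemma op_scale_apply [simp]: "op_scale c T x = c *\<^sub>C T x"
  by (simp add: op_scale.rep_eq)

lemma bounded_operators_diff: "S \<in> bounded_operators \<Longrightarrow> T \<in> bounded_operators \<Longrightarrow> S - T \<in> bounded_operators"
  by (simp add: bounded_operators_def blinfun_lin scaleC_diff_right)

lemma bounded_operators_id: "id_blinfun \<in> bounded_operators"
  by (simp add: bounded_operators_def)

text \<open>The discriminant argument: \<open>t = 1/b\<close> minimises the quadratic, and for
  \<open>b = 0\<close> an affine function that is nonnegative everywhere has slope 0. The factor
  \<open>w\<close> in both coefficients fits the substitution in Cauchy-Schwarz, where
  \<open>w\<close> is the squared modulus of the form.\<close>

lemma real_quadratic_nonneg_imp: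
  fixes a b w :: real
  assumes "\<And>t. 0 \<le> a - 2 * t * w + t\<^sup>2 * w * b" "0 \<le> w" "0 \<le> b"
  shows "w \<le> a * b"
proof (cases "b = 0")
  case True
  show ?thesis
  proof (rule ccontr)
    assume "\<not> w \<le> a * b"
    then have "w > 0" using True by simp
    then have "a - 2 * ((\<bar>a\<bar> + 1) / w) * w \<ge> 0"
      using assms(1)[of "(\<bar>a\<bar> + 1) / w"] True by simp
    then show False using \<open>w > 0\<close> by simp
  qed
next
  case False
  then have b: "b > 0" using assms by simp
  have "0 \<le> a - 2 * (1/b) * w + (1/b)\<^sup>2 * w * b" by (rule assms)
  also have "\<dots> = a - w / b" using b by (simp add: power2_eq_square field_simps)
  finally show ?thesis using b by (simp add: field_simps)
qed

text \<open>\<open>op_positive\<close> speaks only about the diagonal of the form. Its reality at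
  \<open>x + y\<close> gives the imaginary part of the symmetry, its reality at
  \<open>x + i y\<close> the real part.\<close>

lemma positive_form_hermitian:
  assumes T: "T \<in> bounded_operators" "op_positive T"
  shows "form T y x = cnj (form T x y)"
proof -
  let ?q = "\<lambda>x. form T x x"
  have im: "Im (?q x) = 0" for x
    using T(2) by (simp add: op_positive_def complex_ge_0_iff)
  have 1: "Im (form T x y + form T y x) = 0"
    using im[of "x + y"] im[of x] im[of y] by (simp add: blinfun_lin cinner_simps)
  have "?q (x + \<i> *\<^sub>C y) = ?q x + ?q y + \<i> * (form T x y - form T y x)"
    by (simp add: blinfun_lin cinner_simps mem_bounded_operatorsD[OF T(1)] algebra_simps)
  then have 2: "Re (form T x y - form T y x) = 0"
    using im[of "x + \<i> *\<^sub>C y"] im[of x] im[of y] by simp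
  show ?thesis using 1 2 by (simp add: complex_eq_iff)
qed

lemma positive_form_Cauchy_Schwarz:
  assumes T: "T \<in> bounded_operators" "op_positive T"
  shows "(cmod (form T x y))\<^sup>2 \<le> Re (form T x x) * Re (form T y y)"
proof (rule real_quadratic_nonneg_imp)
  fix t :: real
  let ?w = "form T x y"
  \<comment> \<open>The factor \<open>cnj ?w\<close> rotates \<open>c * ?w\<close> to the real
    number \<open>- t |?w|^2\<close> without a division by \<open>?w\<close>, which may be
    0.\<close>
  define c where "c = - of_real t * cnj ?w"
  have "0 \<le> Re (form T (x + c *\<^sub>C y) (x + c *\<^sub>C y))"
    using T(2) by (simp add: op_positive_def complex_ge_0_iff)
  also have "form T (x + c *\<^sub>C y) (x + c *\<^sub>C y)
      = form T x x + (c * ?w + cnj (c * ?w)) + (c * cnj c) * form T y y"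
    by (simp add: blinfun_lin cinner_simps mem_bounded_operatorsD[OF T(1)]
        positive_form_hermitian[OF T, of y x] algebra_simps)
  also have "c * ?w = - of_real (t * (cmod ?w)\<^sup>2)"
    using complex_norm_square[of ?w] by (simp add: c_def mult.commute mult.left_commute)
  also have "c * cnj c = of_real (t\<^sup>2 * (cmod ?w)\<^sup>2)"
    using complex_norm_square[of ?w] by (simp add: c_def power2_eq_square mult.commute mult.left_commute)
  finally show "0 \<le> Re (form T x x) - 2 * t * (cmod ?w)\<^sup>2 + t\<^sup>2 * (cmod ?w)\<^sup>2 * Re (form T y y)"
    by simp
qed (use T(2) in \<open>simp_all add: op_positive_def complex_ge_0_iff\<close>)

lemma op_positive_id: "op_positive id_blinfun"
  by (simp add: op_positive_def cinner_self complex_ge_0_iff del: of_real_power)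

lemma Cauchy_Schwarz: "cmod (cinner x y) \<le> norm x * norm y"
proof -
  have "(cmod (cinner x y))\<^sup>2 \<le> (norm x * norm y)\<^sup>2"
    using positive_form_Cauchy_Schwarz[OF bounded_operators_id op_positive_id, of x y]
    by (simp add: cinner_self power_mult_distrib)
  then show ?thesis by (rule power2_le_imp_le) simp
qed

lemma norm_form_le: "cmod (form T x y) \<le> norm T * norm x * norm y"
proof -
  have "cmod (form T x y) \<le> norm x * norm (T y)" by (rule Cauchy_Schwarz)
  also have "\<dots> \<le> norm x * (norm T * norm y)" by (intro mult_left_mono norm_blinfun) simp
  finally show ?thesis by (simp add: mult_ac)
qed

section \<open>Riesz representation and existence of adjoints\<close>

lemma parallelogram:
  fixes x y :: "'h::complex_hilbert_space"
  shows "(norm (x + y))\<^sup>2 + (norm (x - y))\<^sup>2 = 2 * (norm x)\<^sup>2 + 2 * (norm y)\<^sup>2"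
proof -
  have "cinner (x + y) (x + y) + cinner (x - y) (x - y) = 2 * cinner x x + 2 * cinner y y"
    by (simp add: cinner_simps)
  then have "complex_of_real ((norm (x + y))\<^sup>2 + (norm (x - y))\<^sup>2) = of_real (2 * (norm x)\<^sup>2 + 2 * (norm y)\<^sup>2)"
    unfolding cinner_self by simp
  then show ?thesis by (simp only: of_real_eq_iff)
qed

text \<open>The representing vector minimises \<open>\<parallel>x\<parallel>\<^sup>2 / 2 - g x\<close>; a minimising sequence is Cauchy by the
  parallelogram identity.\<close>

lemma Riesz_real:
  fixes g :: "'h::complex_hilbert_space \<Rightarrow> real"
  assumes g: "bounded_linear g"
  shows "\<exists>z. \<forall>x. g x = Re (cinner z x)"
proof -
  interpret g: bounded_linear g by fact
  obtain K where K: "\<And>x. \<bar>g x\<bar> \<le> norm x * K" "K \<ge> 0"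
    using g.nonneg_bounded by auto
  define J where "J x = (norm x)\<^sup>2 / 2 - g x" for x
  have J_ge: "- K\<^sup>2 / 2 \<le> J x" for x
  proof -
    have "0 \<le> (norm x - K)\<^sup>2" by simp
    then show ?thesis using K(1)[of x] by (simp add: J_def power2_diff mult.commute)
  qed
  define m where "m = Inf (range J)"
  have bdd: "bdd_below (range J)" by (rule bdd_belowI2[where m = "- K\<^sup>2 / 2"]) (rule J_ge)
  have m_le: "m \<le> J x" for x unfolding m_def by (rule cInf_lower[OF _ bdd]) simp
  have "\<exists>x. J x < m + 1 / Suc n" for n
  proof -
    have "Inf (range J) < m + 1 / Suc n" by (simp add: m_def)
    then show ?thesis using bdd by (subst (asm) cInf_less_iff) auto
  qed
  then obtain X where X: "\<And>n. J (X n) < m + 1 / Suc n" by metis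
  \<comment> \<open>The parallelogram identity at the midpoint, where \<open>J\<close> is at least
    \<open>m\<close>: near-minimisers are close to each other.\<close>
  have dist: "(norm (x - y))\<^sup>2 \<le> 4 * (J x + J y - 2 * m)" for x y
  proof -
    have "(norm ((1/2) *\<^sub>R (x + y)))\<^sup>2 = (norm (x + y))\<^sup>2 / 4"
      by (simp add: power_mult_distrib power_divide)
    then have "J ((1/2) *\<^sub>R (x + y)) = (norm (x + y))\<^sup>2 / 8 - (g x + g y) / 2"
      by (simp only: J_def g.scaleR g.add) simp
    then have "m \<le> (norm (x + y))\<^sup>2 / 8 - (g x + g y) / 2"
      using m_le[of "(1/2) *\<^sub>R (x + y)"] by simp
    then show ?thesis using parallelogram[of x y] by (simp add: J_def field_simps)
  qed
  have "Cauchy X"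
  proof (rule metric_CauchyI)
    fix e :: real assume e: "e > 0"
    \<comment> \<open>\<open>J (X k)\<close> and \<open>J (X n)\<close> each exceed \<open>m\<close>
      by less than \<open>1 / Suc N\<close>, and \<open>dist\<close> multiplies the sum of the
      excesses by 4.\<close>
    obtain N where N: "8 / Suc N < e\<^sup>2"
      using reals_Archimedean[of "e\<^sup>2 / 8"] e by (auto simp: field_simps)
    show "\<exists>M. \<forall>m\<ge>M. \<forall>n\<ge>M. dist (X m) (X n) < e"
    proof (intro exI allI impI)
      fix k n assume kn: "k \<ge> N" "n \<ge> N"
      have "1 / Suc k \<le> 1 / Suc N" "1 / Suc n \<le> 1 / Suc N" using kn by (auto simp: frac_le)
      then have "(norm (X k - X n))\<^sup>2 < e\<^sup>2"
        using dist[of "X k" "X n"] X[of k] X[of n] N by argo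
      then show "dist (X k) (X n) < e" using e by (simp add: dist_norm power_less_imp_less_base)
    qed
  qed
  then obtain z where z: "X \<longlonglongrightarrow> z" using Cauchy_convergent convergent_def by blast
  have "(\<lambda>n. J (X n)) \<longlonglongrightarrow> J z"
    unfolding J_def by (intro tendsto_intros z g.tendsto) auto
  moreover have "(\<lambda>n. m + 1 / Suc n) \<longlonglongrightarrow> m + 0"
    by (intro tendsto_intros) (use LIMSEQ_inverse_real_of_nat in \<open>simp add: inverse_eq_divide\<close>)
  ultimately have "J z \<le> m"
    using X by (intro LIMSEQ_le) (auto intro!: exI[of _ 0] less_imp_le)
  then have min: "J z \<le> J x" for x using m_le order_trans by blast
  have "g x = Re (cinner z x)" for x
  proof -
    define w where "w = Re (cinner z x) - g x"
    have "0 \<le> t\<^sup>2 * (norm x)\<^sup>2 / 2 + t * w" for t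
    proof -
      have "complex_of_real ((norm (z + t *\<^sub>R x))\<^sup>2) = cinner (z + of_real t *\<^sub>C x) (z + of_real t *\<^sub>C x)"
        by (simp only: cinner_self scaleC_of_real)
      also have "\<dots> = cinner z z + t * (cinner z x + cnj (cinner z x)) + t\<^sup>2 * cinner x x"
        by (simp add: cinner_simps cinner_commute[of x z] power2_eq_square algebra_simps)
      also have "\<dots> = of_real ((norm z)\<^sup>2 + 2 * t * Re (cinner z x) + t\<^sup>2 * (norm x)\<^sup>2)"
        by (simp add: cinner_self complex_eq_iff)
      finally have "(norm (z + t *\<^sub>R x))\<^sup>2 = (norm z)\<^sup>2 + 2 * t * Re (cinner z x) + t\<^sup>2 * (norm x)\<^sup>2"
        by (simp only: of_real_eq_iff)
      then show ?thesis using min[of "z + t *\<^sub>R x"]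
        by (simp add: J_def g.add g.scaleR w_def field_simps)
    qed
    \<comment> \<open>The first-order condition at the minimum takes the shape of
      \<open>real_quadratic_nonneg_imp\<close>, with \<open>a = 0\<close>, when
      \<open>- 2 * t * w\<close> is inserted for \<open>t\<close>.\<close>
    then have q: "0 \<le> 0 - 2 * t * w\<^sup>2 + t\<^sup>2 * w\<^sup>2 * (2 * (norm x)\<^sup>2)" for t
    proof -
      have "0 \<le> (- 2 * t * w)\<^sup>2 * (norm x)\<^sup>2 / 2 + (- 2 * t * w) * w" by fact
      then show ?thesis by (simp add: power2_eq_square mult_ac)
    qed
    have "w\<^sup>2 \<le> 0 * (2 * (norm x)\<^sup>2)"
      by (rule real_quadratic_nonneg_imp[OF q]) auto
    then show ?thesis by (simp add: w_def)
  qed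
  then show ?thesis by blast
qed

text \<open>A complex-linear functional is recovered from its real part: its imaginary part at
  \<open>x\<close> is its real part at \<open>- i x\<close>. The same holds for
  \<open>cinner z\<close>.\<close>

lemma Riesz:
  fixes f :: "'h::complex_hilbert_space \<Rightarrow> complex"
  assumes f: "bounded_linear f" "\<And>c x. f (c *\<^sub>C x) = c * f x"
  shows "\<exists>z. \<forall>x. f x = cinner z x"
proof -
  obtain z where z: "\<And>x. Re (f x) = Re (cinner z x)"
    using Riesz_real[OF bounded_linear_compose[OF bounded_linear_Re f(1)]] by blast
  have "Im (f x) = Im (cinner z x)" for x
    using z[of "- \<i> *\<^sub>C x"] by (simp add: f(2) cinner_scaleC_right)
  then show ?thesis using z by (auto simp: complex_eq_iff)
qed

text \<open>Riesz is applied in the first argument, after conjugation because \<open>b\<close> is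
  conjugate-linear there. The representing vector \<open>f y\<close> depends linearly on
  \<open>y\<close>, and the bound tested on \<open>f x\<close> and \<open>x\<close> makes
  \<open>f\<close> bounded.\<close>

lemma sesquilinear_form_operator:
  fixes b :: "'h::complex_hilbert_space \<Rightarrow> 'h \<Rightarrow> complex"
  assumes add_left: "\<And>x x' y. b (x + x') y = b x y + b x' y"
    and scale_left: "\<And>c x y. b (c *\<^sub>C x) y = cnj c * b x y"
    and add_right: "\<And>x y y'. b x (y + y') = b x y + b x y'"
    and scale_right: "\<And>c x y. b x (c *\<^sub>C y) = c * b x y"
    and bound: "\<And>x y. cmod (b x y) \<le> K * norm x * norm y"
  shows "\<exists>T\<in>bounded_operators. \<forall>x y. form T x y = b x y"
proof -
  have "\<exists>z. \<forall>x. cnj (b x y) = cinner z x" for y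
  proof (rule Riesz)
    show "bounded_linear (\<lambda>x. cnj (b x y))"
    proof (rule bounded_linear_intro[where K = "K * norm y"])
      fix r x show "cnj (b (r *\<^sub>R x) y) = r *\<^sub>R cnj (b x y)"
        using scale_left[of "of_real r" x y] by (simp add: scaleC_of_real scaleR_conv_of_real)
    next
      fix x show "norm (cnj (b x y)) \<le> norm x * (K * norm y)"
        using bound[of x y] by (simp add: mult_ac)
    qed (simp add: add_left)
  qed (simp add: scale_left)
  then obtain f where f: "\<And>x y. cnj (b x y) = cinner (f y) x" by metis
  then have f': "b x y = cinner x (f y)" for x y by (metis cinner_commute complex_cnj_cnj)
  have f_scale: "f (c *\<^sub>C y) = c *\<^sub>C f y" for c y
    by (rule cinner_eqI_right) (simp add: f'[symmetric] scale_right cinner_scaleC_right)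
  have bl: "bounded_linear f"
  proof (rule bounded_linear_intro[where K = K])
    fix x y show "f (x + y) = f x + f y"
      by (rule cinner_eqI_right) (simp add: f'[symmetric] add_right cinner_add_right)
  next
    fix r x show "f (r *\<^sub>R x) = r *\<^sub>R f x"
      using f_scale[of "of_real r" x] by (simp add: scaleC_of_real)
  next
    fix x
    show "norm (f x) \<le> norm x * K"
    \<comment> \<open>For \<open>f x = 0\<close> it remains to see that \<open>norm x * K\<close> is
      nonnegative: the bound at \<open>x, x\<close> forces this sign of \<open>K\<close> unless
      \<open>norm x = 0\<close>.\<close>
    proof (cases "f x = 0")
      case True
      then show ?thesis
        using order_trans[OF norm_ge_zero bound[of x x]]
        by (cases "norm x = 0") (auto simp: zero_le_mult_iff)
    next
      case False
      have "norm (f x) * norm (f x) = cmod (b (f x) x)"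
        by (simp add: f' cinner_self power2_eq_square norm_mult)
      also have "\<dots> \<le> norm (f x) * (norm x * K)"
        using bound[of "f x" x] by (simp add: mult_ac)
      finally show ?thesis using False by simp
    qed
  qed
  then have "blinfun_apply (Blinfun f) = f" by (rule bounded_linear_Blinfun_apply)
  then show ?thesis
    by (intro bexI[of _ "Blinfun f"]) (simp_all add: f' bounded_operators_def f_scale)
qed

lemma adjoint_exists:
  assumes T: "T \<in> bounded_operators"
  shows "\<exists>S\<in>bounded_operators. \<forall>x y. cinner (blinfun_apply S x) y = form T x y"
proof -
  have "\<exists>S\<in>bounded_operators. \<forall>x y. form S x y = cnj (form T y x)"
  proof (rule sesquilinear_form_operator[where K = "norm T"])
    fix x y show "cmod (cnj (form T y x)) \<le> norm T * norm x * norm y"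
      using norm_form_le[of y T x] by (simp add: mult_ac)
  qed (simp_all add: cinner_simps mem_bounded_operatorsD[OF T] blinfun_lin)
  then show ?thesis by (metis cinner_commute complex_cnj_cnj)
qed

lemma op_adjoint:
  assumes T: "T \<in> bounded_operators"
  shows "op_adjoint T \<in> bounded_operators"
    and "cinner (blinfun_apply (op_adjoint T) x) y = form T x y"
proof -
  let ?P = "\<lambda>S. S \<in> bounded_operators \<and> (\<forall>x y. cinner (blinfun_apply S x) y = form T x y)"
  have "\<exists>!S. ?P S"
  proof (rule ex_ex1I)
    show "\<exists>S. ?P S" using adjoint_exists[OF T] by blast
  next
    fix S S' assume "?P S" "?P S'"
    then show "S = S'" by (intro blinfun_eqI cinner_eqI_left) simp
  qed
  then have "?P (op_adjoint T)" unfolding op_adjoint_def by (rule theI')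
  then show "op_adjoint T \<in> bounded_operators"
    "cinner (blinfun_apply (op_adjoint T) x) y = form T x y" by auto
qed

lemma op_adjoint_eq_iff:
  assumes T: "T \<in> bounded_operators"
  shows "op_adjoint T = T \<longleftrightarrow> (\<forall>x y. form T y x = cnj (form T x y))"
proof
  assume "op_adjoint T = T"
  then show "\<forall>x y. form T y x = cnj (form T x y)"
    using op_adjoint(2)[OF T] by (metis cinner_commute)
next
  assume r: "\<forall>x y. form T y x = cnj (form T x y)"
  show "op_adjoint T = T"
  proof (rule blinfun_eqI, rule cinner_eqI_left)
    fix x y
    have "cinner (op_adjoint T x) y = form T x y" by (rule op_adjoint(2)[OF T])
    also have "\<dots> = cinner (T x) y" using r by (metis cinner_commute)
    finally show "cinner (op_adjoint T x) y = cinner (T x) y" .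
  qed
qed

section \<open>Weak limits of operators\<close>

text \<open>Convergence in the weak operator topology. A general filter covers both nets over
  directed sets (\<open>tail_filter\<close>) and the real parameter \<open>r\<close> tending to 1
  from the left.\<close>

definition wtends :: "('i \<Rightarrow> ('h::complex_hilbert_space \<Rightarrow>\<^sub>L 'h)) \<Rightarrow> ('h \<Rightarrow>\<^sub>L 'h) \<Rightarrow> 'i filter \<Rightarrow> bool" where
  "wtends T A F \<longleftrightarrow> (\<forall>x y. ((\<lambda>i. form (T i) x y) \<longlongrightarrow> form A x y) F)"

lemma wtendsD: "wtends T A F \<Longrightarrow> ((\<lambda>i. form (T i) x y) \<longlongrightarrow> form A x y) F"
  by (simp add: wtends_def)

lemma wtends_const: "wtends (\<lambda>_. A) A F"
  by (simp add: wtends_def)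

lemma wtends_add: "wtends S A F \<Longrightarrow> wtends T B F \<Longrightarrow> wtends (\<lambda>i. S i + T i) (A + B) F"
  by (simp add: wtends_def blinfun_lin cinner_simps tendsto_add)

lemma wtends_diff: "wtends S A F \<Longrightarrow> wtends T B F \<Longrightarrow> wtends (\<lambda>i. S i - T i) (A - B) F"
  by (simp add: wtends_def blinfun_lin cinner_simps tendsto_diff)

lemma wtends_op_scale: "wtends T A F \<Longrightarrow> wtends (\<lambda>i. op_scale c (T i)) (op_scale c A) F"
  by (simp add: wtends_def cinner_simps tendsto_mult)

text \<open>The adjoint of \<open>R\<close> moves the multiplication into the other argument of the
  form; on the right, multiplication merely changes the vector.\<close>

lemma wtends_compose_left:
  assumes "R \<in> bounded_operators" "wtends T A F"
  shows "wtends (\<lambda>i. R o\<^sub>L T i) (R o\<^sub>L A) F"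
  using assms(2) by (simp add: wtends_def op_adjoint(2)[OF assms(1), symmetric])

lemma wtends_compose_right: "wtends T A F \<Longrightarrow> wtends (\<lambda>i. T i o\<^sub>L R) (A o\<^sub>L R) F"
  by (simp add: wtends_def)

lemma wtends_unique: "F \<noteq> bot \<Longrightarrow> wtends T A F \<Longrightarrow> wtends T B F \<Longrightarrow> A = B"
  by (rule blinfun_eqI_form) (metis tendsto_unique wtendsD)

lemma wtends_cong: "eventually (\<lambda>i. S i = T i) F \<Longrightarrow> wtends S A F \<Longrightarrow> wtends T A F"
  unfolding wtends_def
proof (intro allI)
  fix x y assume "eventually (\<lambda>i. S i = T i) F" "\<forall>x y. ((\<lambda>i. form (S i) x y) \<longlongrightarrow> form A x y) F"
  then show "((\<lambda>i. form (T i) x y) \<longlongrightarrow> form A x y) F"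
    by (rule_tac Lim_transform_eventually[of "\<lambda>i. form (S i) x y"]) (auto elim: eventually_mono)
qed

lemma tendsto_complex_nonneg:
  fixes f :: "'i \<Rightarrow> complex"
  assumes "F \<noteq> bot" "(f \<longlongrightarrow> l) F" "eventually (\<lambda>i. 0 \<le> f i) F"
  shows "0 \<le> l"
proof -
  have "0 \<le> Re l"
    by (rule tendsto_lowerbound[OF tendsto_Re[OF assms(2)] _ assms(1)])
      (use assms(3) in \<open>auto simp: complex_ge_0_iff elim: eventually_mono\<close>)
  moreover have "((\<lambda>i. Im (f i)) \<longlongrightarrow> 0) F"
    by (rule tendsto_eventually) (use assms(3) in \<open>auto simp: complex_ge_0_iff elim: eventually_mono\<close>)
  then have "Im l = 0" using tendsto_unique[OF assms(1) tendsto_Im[OF assms(2)]] by blast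
  ultimately show ?thesis by (simp add: complex_ge_0_iff)
qed

lemma wtends_op_positive:
  assumes "F \<noteq> bot" "wtends T A F" "eventually (\<lambda>i. op_positive (T i)) F"
  shows "op_positive A"
  unfolding op_positive_def
proof
  fix x show "0 \<le> form A x x"
    by (rule tendsto_complex_nonneg[OF assms(1) wtendsD[OF assms(2)]])
      (use assms(3) in \<open>auto simp: op_positive_def elim: eventually_mono\<close>)
qed

lemma wtends_bounded_operators:
  assumes "F \<noteq> bot" "wtends T A F" "eventually (\<lambda>i. T i \<in> bounded_operators) F"
  shows "A \<in> bounded_operators"
  unfolding bounded_operators_def
proof (intro CollectI allI)
  fix c x
  show "A (c *\<^sub>C x) = c *\<^sub>C A x"
  proof (rule cinner_eqI_right)
    fix y
    have "((\<lambda>i. form (T i) y (c *\<^sub>C x)) \<longlongrightarrow> c * form A y x) F"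
      by (rule Lim_transform_eventually[OF tendsto_mult_left[OF wtendsD[OF assms(2)]]])
        (use assms(3) in \<open>auto simp: form_scaleC_right elim: eventually_mono\<close>)
    then show "form A y (c *\<^sub>C x) = cinner y (c *\<^sub>C A x)"
      unfolding cinner_scaleC_right by (rule tendsto_unique[OF assms(1) wtendsD[OF assms(2)]])
  qed
qed

lemma von_neumann_algebra_subset: "von_neumann_algebra M \<Longrightarrow> M \<subseteq> bounded_operators"
  by (simp add: von_neumann_algebra_def star_subalgebra_def)

lemma von_neumann_algebra_bounded: "von_neumann_algebra M \<Longrightarrow> x \<in> M \<Longrightarrow> x \<in> bounded_operators"
  using von_neumann_algebra_subset by blast

text \<open>Commuting with a fixed \<open>R\<close> is a weakly closed condition, since
  multiplication by \<open>R\<close> from either side is weakly continuous. Hence a bicommutant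
  contains its weak limits.\<close>

lemma wtends_von_neumann_algebra:
  assumes F: "F \<noteq> bot" and lim: "wtends T A F" and M: "von_neumann_algebra M"
    and ev: "eventually (\<lambda>i. T i \<in> M) F"
  shows "A \<in> M"
proof -
  have Mb: "M \<subseteq> bounded_operators" by (rule von_neumann_algebra_subset[OF M])
  have A: "A \<in> bounded_operators"
    by (rule wtends_bounded_operators[OF F lim]) (use ev Mb in \<open>auto elim: eventually_mono\<close>)
  have "A o\<^sub>L R = R o\<^sub>L A" if R: "R \<in> commutant M" for R
  proof (rule wtends_unique[OF F])
    have Rb: "R \<in> bounded_operators" using R by (simp add: commutant_def)
    show "wtends (\<lambda>i. R o\<^sub>L T i) (R o\<^sub>L A) F" by (rule wtends_compose_left[OF Rb lim])
    show "wtends (\<lambda>i. R o\<^sub>L T i) (A o\<^sub>L R) F"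
      by (rule wtends_cong[OF _ wtends_compose_right[OF lim]])
        (use ev R in \<open>auto simp: commutant_def elim: eventually_mono\<close>)
  qed
  then have "A \<in> commutant (commutant M)" using A by (simp add: commutant_def)
  then show ?thesis using M by (simp add: von_neumann_algebra_def)
qed


section \<open>Elements of von Neumann algebras\<close>

context
  fixes M :: "('h::complex_hilbert_space \<Rightarrow>\<^sub>L 'h) set"
  assumes M: "von_neumann_algebra M"
begin

lemma vn_add: "x \<in> M \<Longrightarrow> y \<in> M \<Longrightarrow> x + y \<in> M"
  using M by (simp add: von_neumann_algebra_def star_subalgebra_def)

lemma vn_scale: "x \<in> M \<Longrightarrow> op_scale c x \<in> M"
  using M by (simp add: von_neumann_algebra_def star_subalgebra_def)

lemma vn_compose: "x \<in> M \<Longrightarrow> y \<in> M \<Longrightarrow> x o\<^sub>L y \<in> M"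
  using M by (simp add: von_neumann_algebra_def star_subalgebra_def)

lemma vn_adjoint: "x \<in> M \<Longrightarrow> op_adjoint x \<in> M"
  using M by (simp add: von_neumann_algebra_def star_subalgebra_def)

lemma vn_zero: "0 \<in> M"
  using M by (simp add: von_neumann_algebra_def star_subalgebra_def)

text \<open>\<open>star_subalgebra\<close> does not mention the unit; it commutes with everything
  and so lies in the bicommutant.\<close>

lemma vn_id: "id_blinfun \<in> M"
proof -
  have "id_blinfun \<in> commutant (commutant M)"
    unfolding commutant_def using bounded_operators_id by (auto intro!: blinfun_eqI)
  then show ?thesis using M by (simp add: von_neumann_algebra_def)
qed

lemma vn_diff:
  assumes "x \<in> M" "y \<in> M" shows "x - y \<in> M"
proof -
  have "x - y = x + op_scale (-1) y"
    by (rule blinfun_eqI) (simp add: blinfun_lin scaleC_minus_one)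
  then show ?thesis using vn_add[OF assms(1) vn_scale[OF assms(2)]] by metis
qed

lemma vn_sum: "(\<And>i. i \<in> I \<Longrightarrow> f i \<in> M) \<Longrightarrow> (\<Sum>i\<in>I. f i) \<in> M"
  by (induct I rule: infinite_finite_induct) (auto simp: vn_zero vn_add)

lemma vn_positive_self_adjoint: "x \<in> M \<Longrightarrow> op_positive x \<Longrightarrow> op_adjoint x = x"
  by (simp add: op_adjoint_eq_iff von_neumann_algebra_bounded[OF M])
    (metis positive_form_hermitian von_neumann_algebra_bounded[OF M])

lemma vn_self_adjoint_Im:
  assumes "x \<in> M" "op_adjoint x = x" shows "Im (form x u u) = 0"
proof -
  have "form x u u = cnj (form x u u)"
    using assms op_adjoint_eq_iff von_neumann_algebra_bounded[OF M] by blast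
  from arg_cong[OF this, of Im] show ?thesis by simp
qed

lemma vn_norm_minus_positive:
  assumes "x \<in> M" "op_adjoint x = x"
  shows "op_positive (op_scale (of_real (norm x)) id_blinfun - x)"
  unfolding op_positive_def
proof
  fix u
  have "Re (form x u u) \<le> norm x * norm u * norm u"
    using norm_form_le[of u x u] complex_Re_le_cmod order_trans by blast
  then show "0 \<le> form (op_scale (of_real (norm x)) id_blinfun - x) u u"
    using vn_self_adjoint_Im[OF assms]
    by (simp add: complex_ge_0_iff blinfun_lin cinner_simps cinner_self power2_eq_square)
qed

lemma op_positive_scale_id: "r \<ge> 0 \<Longrightarrow> op_positive (op_scale (of_real r) id_blinfun)"
  by (simp add: op_positive_def cinner_simps cinner_self complex_ge_0_iff)

text \<open>A self-adjoint \<open>x\<close> is the difference of two positive operators,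
  \<open>norm x\<close> times the identity and that multiple minus \<open>x\<close>; a general
  element is \<open>r + i s\<close> with self-adjoint \<open>r\<close>, \<open>s\<close>. As an
  induction rule this carries statements about linear maps from positive arguments, where monotone
  nets are available, to all of \<open>M\<close>.\<close>

lemma vn_positive_span [consumes 1, case_names positive add scale]:
  assumes x: "x \<in> M"
    and pos: "\<And>p. p \<in> M \<Longrightarrow> op_positive p \<Longrightarrow> P p"
    and add: "\<And>x y. x \<in> M \<Longrightarrow> y \<in> M \<Longrightarrow> P x \<Longrightarrow> P y \<Longrightarrow> P (x + y)"
    and scale: "\<And>c x. x \<in> M \<Longrightarrow> P x \<Longrightarrow> P (op_scale c x)"
  shows "P x"
proof -
  have sa: "P x" if x: "x \<in> M" "op_adjoint x = x" for x
  proof -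
    let ?n = "op_scale (of_real (norm x)) id_blinfun :: 'h \<Rightarrow>\<^sub>L 'h"
    have "P (?n + op_scale (-1) (?n - x))"
      using x by (intro add scale pos vn_scale vn_diff vn_id vn_norm_minus_positive op_positive_scale_id) auto
    also have "?n + op_scale (-1) (?n - x) = x"
      by (rule blinfun_eqI) (simp add: blinfun_lin scaleC_minus_one)
    finally show ?thesis .
  qed
  have xb: "x \<in> bounded_operators" using x M von_neumann_algebra_bounded by blast
  let ?a = "op_adjoint x"
  have aM: "?a \<in> M" by (rule vn_adjoint[OF x])
  note ab = von_neumann_algebra_bounded[OF M aM]
  have form_adj: "form ?a v u = cnj (form x u v)" for u v
    using op_adjoint(2)[OF xb, of u v] by (metis cinner_commute)
  define r where "r = op_scale (1/2) (x + ?a)"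
  define s where "s = op_scale (- \<i>/2) (x - ?a)"
  have mem: "r \<in> M" "s \<in> M" using x aM by (simp_all add: r_def s_def vn_scale vn_add vn_diff)
  have "op_adjoint r = r"
    unfolding op_adjoint_eq_iff[OF von_neumann_algebra_bounded[OF M mem(1)]]
    by (simp add: r_def blinfun_lin cinner_simps form_adj algebra_simps)
  moreover have "op_adjoint s = s"
    unfolding op_adjoint_eq_iff[OF von_neumann_algebra_bounded[OF M mem(2)]]
    by (simp add: s_def blinfun_lin cinner_simps form_adj algebra_simps)
  ultimately have "P (r + op_scale \<i> s)" using mem by (intro add scale sa) (auto simp: vn_scale)
  also have "r + op_scale \<i> s = x"
    by (rule blinfun_eqI_form) (simp add: r_def s_def blinfun_lin cinner_simps algebra_simps)
  finally show ?thesis .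
qed

end

section \<open>Monotone nets\<close>

text \<open>Turns a directed set into a net, so that its limits are limits along a filter;
  directedness makes the tails a filter base.\<close>

definition tail_filter :: "('a, 'm) gorder_scheme \<Rightarrow> 'a set \<Rightarrow> 'a filter" where
  "tail_filter L S = (INF t\<in>S. principal {u\<in>S. t \<sqsubseteq>\<^bsub>L\<^esub> u})"

lemma eventually_tail_filter:
  assumes L: "partial_order L" and S: "directed_in L S"
  shows "eventually P (tail_filter L S) \<longleftrightarrow> (\<exists>t\<in>S. \<forall>u\<in>S. t \<sqsubseteq>\<^bsub>L\<^esub> u \<longrightarrow> P u)"
proof -
  interpret partial_order L by fact
  have sub: "S \<subseteq> carrier L" and ne: "S \<noteq> {}" using S by (auto simp: directed_in_def)
  have "eventually P (tail_filter L S)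
      \<longleftrightarrow> (\<exists>t\<in>S. eventually P (principal {u\<in>S. t \<sqsubseteq>\<^bsub>L\<^esub> u}))"
    unfolding tail_filter_def
  proof (rule eventually_INF_base[OF ne])
    fix a b assume ab: "a \<in> S" "b \<in> S"
    then obtain c where c: "c \<in> S" "a \<sqsubseteq>\<^bsub>L\<^esub> c" "b \<sqsubseteq>\<^bsub>L\<^esub> c"
      using S unfolding directed_in_def by blast
    have "{u\<in>S. c \<sqsubseteq>\<^bsub>L\<^esub> u} \<subseteq> {u\<in>S. a \<sqsubseteq>\<^bsub>L\<^esub> u} \<inter> {u\<in>S. b \<sqsubseteq>\<^bsub>L\<^esub> u}"
    proof (intro Int_greatest subsetI CollectI conjI; elim CollectE conjE)
      fix u assume u: "u \<in> S" "c \<sqsubseteq>\<^bsub>L\<^esub> u"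
      show "a \<sqsubseteq>\<^bsub>L\<^esub> u" using ab c sub u by (intro le_trans[OF c(2) u(2)]) auto
      show "b \<sqsubseteq>\<^bsub>L\<^esub> u" using ab c sub u by (intro le_trans[OF c(3) u(2)]) auto
    qed
    then show "\<exists>x\<in>S. principal {u\<in>S. x \<sqsubseteq>\<^bsub>L\<^esub> u}
        \<le> inf (principal {u\<in>S. a \<sqsubseteq>\<^bsub>L\<^esub> u}) (principal {u\<in>S. b \<sqsubseteq>\<^bsub>L\<^esub> u})"
      using c(1) by (auto intro!: bexI[of _ c])
  qed
  then show ?thesis by (simp add: eventually_principal Ball_def imp_conjL)
qed

lemma tail_filter_not_bot:
  assumes L: "partial_order L" and S: "directed_in L S"
  shows "tail_filter L S \<noteq> bot"
proof -
  interpret partial_order L by fact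
  have "\<not> eventually (\<lambda>_. False) (tail_filter L S)"
    unfolding eventually_tail_filter[OF assms] using S le_refl by (auto simp: directed_in_def)
  then show ?thesis by (simp add: trivial_limit_def)
qed

lemma eventually_tail_filter_above:
  assumes "partial_order L" "directed_in L S" "t \<in> S"
  shows "eventually (\<lambda>u. u \<in> S \<and> t \<sqsubseteq>\<^bsub>L\<^esub> u) (tail_filter L S)"
  unfolding eventually_tail_filter[OF assms(1,2)] using assms(3) by blast

lemma eventually_tail_filter_mem:
  assumes "partial_order L" "directed_in L S"
  shows "eventually (\<lambda>u. u \<in> S) (tail_filter L S)"
  unfolding eventually_tail_filter[OF assms] using assms(2) by (auto simp: directed_in_def)

lemma mono_tail_filter_convergent:
  fixes f :: "'a \<Rightarrow> real"
  assumes L: "partial_order L" and S: "directed_in L S"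
    and mono: "\<And>t u. t \<in> S \<Longrightarrow> u \<in> S \<Longrightarrow> t \<sqsubseteq>\<^bsub>L\<^esub> u \<Longrightarrow> f t \<le> f u"
    and bdd: "\<And>t. t \<in> S \<Longrightarrow> f t \<le> b"
  shows "\<exists>l. (f \<longlongrightarrow> l) (tail_filter L S)"
proof
  have ne: "S \<noteq> {}" using S by (auto simp: directed_in_def)
  have bdd': "bdd_above (f ` S)" using bdd by (rule bdd_aboveI2)
  show "(f \<longlongrightarrow> (SUP t\<in>S. f t)) (tail_filter L S)"
  proof (rule order_tendstoI)
    fix a assume "a < (SUP t\<in>S. f t)"
    then obtain t where t: "t \<in> S" "a < f t" using less_cSUP_iff[OF ne bdd'] by auto
    show "eventually (\<lambda>t. a < f t) (tail_filter L S)"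
      unfolding eventually_tail_filter[OF L S] using t mono less_le_trans by blast
  next
    fix a assume a: "(SUP t\<in>S. f t) < a"
    show "eventually (\<lambda>t. f t < a) (tail_filter L S)"
      using eventually_tail_filter_mem[OF L S]
      by (rule eventually_mono) (use a in \<open>blast intro: le_less_trans cSUP_upper[OF _ bdd']\<close>)
  qed
qed

text \<open>The diagonal of the form vanishes, and Cauchy-Schwarz for this positive form extends
  that to all entries.\<close>

lemma op_positive_antisym:
  assumes "x \<in> bounded_operators" "op_positive x" "op_positive (- x)"
  shows "x = 0"
proof (rule blinfun_eqI_form)
  fix u v
  have "Re (form x u u) = 0" for u
    using assms(2,3) by (auto simp: op_positive_def complex_ge_0_iff blinfun.minus_left cinner_simps intro: antisym)
  then have "(cmod (form x u v))\<^sup>2 \<le> 0"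
    using positive_form_Cauchy_Schwarz[OF assms(1,2), of u v] by simp
  then show "form x u v = form 0 u v" by simp
qed

lemma op_positive_add: "op_positive x \<Longrightarrow> op_positive y \<Longrightarrow> op_positive (x + y)"
  by (simp add: op_positive_def blinfun_lin cinner_simps)

lemma op_positive_zero: "op_positive 0"
  by (simp add: op_positive_def)

lemma op_positive_diff_trans: "op_positive (y - x) \<Longrightarrow> op_positive (z - y) \<Longrightarrow> op_positive (z - x)"
  using op_positive_add[of "y - x" "z - y"] by simp

lemma op_positive_scale: "0 \<le> r \<Longrightarrow> op_positive x \<Longrightarrow> op_positive (op_scale (of_real r) x)"
  by (simp add: op_positive_def cinner_simps complex_ge_0_iff)

section \<open>The Loewner order and weak limits of monotone nets\<close>

lemma partial_order_loewner:
  assumes M: "M \<subseteq> bounded_operators"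
  shows "partial_order (loewner_order M)"
proof (unfold_locales, goal_cases)
  case (5 x y)
  then show ?case
    using op_positive_antisym[of "y - x"] M bounded_operators_diff[of y x]
    by (auto simp: loewner_order_def)
next
  case (6 x y z)
  then show ?case using op_positive_diff_trans[of y x z] by (simp add: loewner_order_def)
qed (auto simp: loewner_order_def op_positive_zero)

lemma loewner_carrier_iff: "x \<in> carrier (loewner_order M) \<longleftrightarrow> x \<in> M \<and> op_adjoint x = x"
  by (simp add: loewner_order_def)

lemma loewner_le_iff: "x \<sqsubseteq>\<^bsub>loewner_order M\<^esub> y \<longleftrightarrow> op_positive (y - x)"
  by (simp add: loewner_order_def)

lemma is_lub_unique:
  assumes "partial_order L" "is_lub L s S" "is_lub L t S"
  shows "s = t"
proof -
  interpret partial_order L by fact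
  have "s \<sqsubseteq>\<^bsub>L\<^esub> t" "t \<sqsubseteq>\<^bsub>L\<^esub> s" "s \<in> carrier L" "t \<in> carrier L"
    using assms(2,3) by (simp_all add: least_def) (simp_all add: Upper_def)
  then show ?thesis by (rule le_antisym)
qed

text \<open>The index set is directed in an arbitrary order \<open>L\<close>, because nets of
  operators are indexed both by operators (projections, directed sets in \<open>M\<close>) and by
  maps in a homset.\<close>

definition mono_net ::
  "('a, 'm) gorder_scheme \<Rightarrow> 'a set \<Rightarrow> ('h::complex_hilbert_space \<Rightarrow>\<^sub>L 'h) set \<Rightarrow> ('a \<Rightarrow> ('h \<Rightarrow>\<^sub>L 'h)) \<Rightarrow> bool" where
  "mono_net L S M T \<longleftrightarrow> partial_order L \<and> directed_in L S \<and>
     (\<forall>t\<in>S. T t \<in> carrier (loewner_order M)) \<and>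
     (\<forall>t\<in>S. \<forall>u\<in>S. t \<sqsubseteq>\<^bsub>L\<^esub> u \<longrightarrow> op_positive (T u - T t))"

lemma polarization:
  assumes "T \<in> bounded_operators"
  shows "form T x y = (form T (x + y) (x + y) - form T (x - y) (x - y)
    - \<i> * form T (x + \<i> *\<^sub>C y) (x + \<i> *\<^sub>C y) + \<i> * form T (x - \<i> *\<^sub>C y) (x - \<i> *\<^sub>C y)) / 4"
  by (simp add: blinfun_lin cinner_simps mem_bounded_operatorsD[OF assms] algebra_simps)

text \<open>By polarization the limits of the diagonals determine limits of all entries. The limit
  form inherits sesquilinearity by uniqueness of limits and keeps the bound \<open>K\<close>, so an
  operator represents it.\<close>

lemma wtends_exists:
  fixes T :: "'i \<Rightarrow> ('h::complex_hilbert_space \<Rightarrow>\<^sub>L 'h)"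
  assumes F: "F \<noteq> bot" and bop: "eventually (\<lambda>i. T i \<in> bounded_operators) F"
    and bound: "\<And>x y. eventually (\<lambda>i. cmod (form (T i) x y) \<le> K * norm x * norm y) F"
    and conv: "\<And>x. \<exists>l. ((\<lambda>i. form (T i) x x) \<longlongrightarrow> l) F"
  shows "\<exists>A\<in>bounded_operators. wtends T A F"
proof -
  obtain q where q: "\<And>x. ((\<lambda>i. form (T i) x x) \<longlongrightarrow> q x) F" using conv by metis
  define b where "b x y = (q (x + y) - q (x - y) - \<i> * q (x + \<i> *\<^sub>C y) + \<i> * q (x - \<i> *\<^sub>C y)) / 4" for x y
  have b: "((\<lambda>i. form (T i) x y) \<longlongrightarrow> b x y) F" for x y
  proof (rule Lim_transform_eventually)
    show "((\<lambda>i. (form (T i) (x + y) (x + y) - form (T i) (x - y) (x - y)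
      - \<i> * form (T i) (x + \<i> *\<^sub>C y) (x + \<i> *\<^sub>C y) + \<i> * form (T i) (x - \<i> *\<^sub>C y) (x - \<i> *\<^sub>C y)) / 4)
      \<longlongrightarrow> b x y) F"
      unfolding b_def by (intro tendsto_intros q) simp
    show "eventually (\<lambda>i. (form (T i) (x + y) (x + y) - form (T i) (x - y) (x - y)
      - \<i> * form (T i) (x + \<i> *\<^sub>C y) (x + \<i> *\<^sub>C y) + \<i> * form (T i) (x - \<i> *\<^sub>C y) (x - \<i> *\<^sub>C y)) / 4
      = form (T i) x y) F"
      using bop by (rule eventually_mono) (rule polarization[symmetric])
  qed
  have "\<exists>A\<in>bounded_operators. \<forall>x y. form A x y = b x y"
  proof (rule sesquilinear_form_operator[where K = K])
    fix x x' y
    have "((\<lambda>i. form (T i) x y + form (T i) x' y) \<longlongrightarrow> b (x + x') y) F"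
      using b[of "x + x'" y] by (simp add: cinner_simps)
    then show "b (x + x') y = b x y + b x' y" by (rule tendsto_unique[OF F]) (intro tendsto_add b)
  next
    fix c x y
    have "((\<lambda>i. cnj c * form (T i) x y) \<longlongrightarrow> b (c *\<^sub>C x) y) F"
      using b[of "c *\<^sub>C x" y] by (simp add: cinner_simps)
    then show "b (c *\<^sub>C x) y = cnj c * b x y" by (rule tendsto_unique[OF F]) (intro tendsto_mult_left b)
  next
    fix x y y'
    have "((\<lambda>i. form (T i) x y + form (T i) x y') \<longlongrightarrow> b x (y + y')) F"
      using b[of x "y + y'"] by (simp add: blinfun_lin cinner_simps)
    then show "b x (y + y') = b x y + b x y'" by (rule tendsto_unique[OF F]) (intro tendsto_add b)
  next
    fix c x y
    have "((\<lambda>i. c * form (T i) x y) \<longlongrightarrow> b x (c *\<^sub>C y)) F"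
      using b[of x "c *\<^sub>C y"]
      by (rule Lim_transform_eventually) (use bop in \<open>auto simp: form_scaleC_right elim: eventually_mono\<close>)
    then show "b x (c *\<^sub>C y) = c * b x y" by (rule tendsto_unique[OF F]) (intro tendsto_mult_left b)
  next
    fix x y show "cmod (b x y) \<le> K * norm x * norm y"
      by (rule tendsto_upperbound[OF tendsto_norm[OF b] bound F])
  qed
  then obtain A where "A \<in> bounded_operators" "\<And>x y. form A x y = b x y" by blast
  then show ?thesis using b by (intro bexI[of _ A]) (simp_all add: wtends_def)
qed

lemma wtends_self_adjoint:
  assumes F: "F \<noteq> bot" and lim: "wtends T A F"
    and ev: "eventually (\<lambda>i. T i \<in> bounded_operators \<and> op_adjoint (T i) = T i) F"
  shows "op_adjoint A = A"
proof -
  have A: "A \<in> bounded_operators"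
    by (rule wtends_bounded_operators[OF F lim]) (use ev in \<open>auto elim: eventually_mono\<close>)
  have "form A y x = cnj (form A x y)" for x y
  proof (rule tendsto_unique[OF F wtendsD[OF lim]])
    have "((\<lambda>i. cnj (form (T i) x y)) \<longlongrightarrow> cnj (form A x y)) F"
      by (intro tendsto_cnj wtendsD[OF lim])
    then show "((\<lambda>i. form (T i) y x) \<longlongrightarrow> cnj (form A x y)) F"
    proof (rule Lim_transform_eventually)
      show "eventually (\<lambda>i. cnj (form (T i) x y) = form (T i) y x) F"
        using ev by (rule eventually_mono) (metis op_adjoint_eq_iff)
    qed
  qed
  then show ?thesis unfolding op_adjoint_eq_iff[OF A] by blast
qed

context
  fixes M :: "('h::complex_hilbert_space \<Rightarrow>\<^sub>L 'h) set"
  assumes M: "von_neumann_algebra M"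
begin

text \<open>The diagonals are bounded increasing real nets, hence converge. The uniform bound on the
  other entries comes from Cauchy-Schwarz for the positive operators \<open>T t - T s\<close>, which
  lie below the fixed operator \<open>R - T s\<close>.\<close>

lemma mono_net_convergent:
  fixes T :: "'a \<Rightarrow> ('h \<Rightarrow>\<^sub>L 'h)"
  assumes T: "mono_net L S M T" and R: "R \<in> carrier (loewner_order M)"
    and le: "\<And>t. t \<in> S \<Longrightarrow> op_positive (R - T t)"
  shows "\<exists>A\<in>carrier (loewner_order M). wtends T A (tail_filter L S)"
proof -
  let ?F = "tail_filter L S"
  note Mb = von_neumann_algebra_bounded[OF M]
  have L: "partial_order L" and S: "directed_in L S"
    and sa: "\<And>t. t \<in> S \<Longrightarrow> T t \<in> M" "\<And>t. t \<in> S \<Longrightarrow> op_adjoint (T t) = T t"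
    and mono: "\<And>t u. t \<in> S \<Longrightarrow> u \<in> S \<Longrightarrow> t \<sqsubseteq>\<^bsub>L\<^esub> u \<Longrightarrow> op_positive (T u - T t)"
    using T by (auto simp: mono_net_def loewner_carrier_iff)
  note ev = eventually_tail_filter_mem[OF L S] and F = tail_filter_not_bot[OF L S]
  \<comment> \<open>The \<open>T t\<close> need not be positive, so a base point is subtracted and
    only the tail above it is estimated.\<close>
  obtain s where s: "s \<in> S" using S by (auto simp: directed_in_def)
  define P where "P = R - T s"
  have "\<exists>A\<in>bounded_operators. wtends T A ?F"
  proof (rule wtends_exists[OF F])
    show "eventually (\<lambda>t. T t \<in> bounded_operators) ?F"
      using ev by (rule eventually_mono) (use sa Mb in auto)
    fix x y
    show "eventually (\<lambda>t. cmod (form (T t) x y) \<le> (norm P + norm (T s)) * norm x * norm y) ?F"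
      using eventually_tail_filter_above[OF L S s]
    proof (rule eventually_mono)
      fix t assume t: "t \<in> S \<and> s \<sqsubseteq>\<^bsub>L\<^esub> t"
      let ?D = "T t - T s"
      have D: "?D \<in> bounded_operators" "op_positive ?D"
        using sa t s Mb mono by (auto intro: bounded_operators_diff)
      have DP: "Re (form ?D x x) \<le> norm P * (norm x)\<^sup>2" for x
      proof -
        have "Re (form ?D x x) \<le> Re (form P x x)"
          using le[of t] t by (auto simp: op_positive_def complex_ge_0_iff P_def blinfun_lin cinner_simps)
        also have "\<dots> \<le> norm P * norm x * norm x"
          using norm_form_le[of x P x] complex_Re_le_cmod order_trans by blast
        finally show ?thesis by (simp add: power2_eq_square)
      qed
      have "0 \<le> Re (form ?D y y)" using D(2) by (simp add: op_positive_def complex_ge_0_iff)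
      then have "(cmod (form ?D x y))\<^sup>2 \<le> (norm P * (norm x)\<^sup>2) * (norm P * (norm y)\<^sup>2)"
        using positive_form_Cauchy_Schwarz[OF D, of x y] mult_mono[OF DP[of x] DP[of y]] by simp
      also have "\<dots> = (norm P * norm x * norm y)\<^sup>2" by (simp add: power2_eq_square)
      finally have "cmod (form ?D x y) \<le> norm P * norm x * norm y"
        by (rule power2_le_imp_le) simp
      moreover have "cmod (form (T s) x y) \<le> norm (T s) * norm x * norm y" by (rule norm_form_le)
      moreover have "cmod (form (T t) x y) \<le> cmod (form ?D x y) + cmod (form (T s) x y)"
        using norm_triangle_ineq[of "form ?D x y" "form (T s) x y"] by (simp add: blinfun_lin cinner_simps)
      ultimately show "cmod (form (T t) x y) \<le> (norm P + norm (T s)) * norm x * norm y"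
        by (simp add: algebra_simps)
    qed
  next
    fix x
    have "\<exists>l. ((\<lambda>t. Re (form (T t) x x)) \<longlongrightarrow> l) ?F"
    proof (rule mono_tail_filter_convergent[OF L S])
      fix t u assume "t \<in> S" "u \<in> S" "t \<sqsubseteq>\<^bsub>L\<^esub> u"
      then show "Re (form (T t) x x) \<le> Re (form (T u) x x)"
        using mono[of t u] by (simp add: op_positive_def complex_ge_0_iff blinfun_lin cinner_simps)
    next
      fix t assume "t \<in> S"
      then show "Re (form (T t) x x) \<le> Re (form R x x)"
        using le[of t] by (simp add: op_positive_def complex_ge_0_iff blinfun_lin cinner_simps)
    qed
    then obtain l where "((\<lambda>t. Re (form (T t) x x)) \<longlongrightarrow> l) ?F" ..
    then have "((\<lambda>t. complex_of_real (Re (form (T t) x x))) \<longlongrightarrow> of_real l) ?F" by (rule tendsto_of_real)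
    then have "((\<lambda>t. form (T t) x x) \<longlongrightarrow> of_real l) ?F"
      by (rule Lim_transform_eventually)
        (use ev in \<open>rule eventually_mono; use sa vn_self_adjoint_Im[OF M] in \<open>auto simp: complex_eq_iff\<close>\<close>)
    then show "\<exists>l. ((\<lambda>t. form (T t) x x) \<longlongrightarrow> l) ?F" ..
  qed
  then obtain A where A: "wtends T A ?F" by blast
  have "A \<in> M"
    by (rule wtends_von_neumann_algebra[OF F A M]) (rule eventually_mono[OF ev]; use sa in auto)
  moreover have "op_adjoint A = A"
    by (rule wtends_self_adjoint[OF F A]) (rule eventually_mono[OF ev]; use sa Mb in auto)
  ultimately show ?thesis using A by (auto simp: loewner_carrier_iff)
qed

lemma mono_net_limit_upper:
  assumes T: "mono_net L S M T" and lim: "wtends T A (tail_filter L S)" and t: "t \<in> S"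
  shows "op_positive (A - T t)"
proof (rule wtends_op_positive)
  have L: "partial_order L" and S: "directed_in L S" using T by (auto simp: mono_net_def)
  show "tail_filter L S \<noteq> bot" by (rule tail_filter_not_bot[OF L S])
  show "wtends (\<lambda>u. T u - T t) (A - T t) (tail_filter L S)" by (intro wtends_diff lim wtends_const)
  show "eventually (\<lambda>u. op_positive (T u - T t)) (tail_filter L S)"
    by (rule eventually_mono[OF eventually_tail_filter_above[OF L S t]]) (use T t in \<open>auto simp: mono_net_def\<close>)
qed

lemma mono_net_limit_carrier:
  assumes T: "mono_net L S M T" and lim: "wtends T A (tail_filter L S)"
  shows "A \<in> carrier (loewner_order M)"
proof -
  have L: "partial_order L" and S: "directed_in L S" using T by (auto simp: mono_net_def)
  note ev = eventually_tail_filter_mem[OF L S] and F = tail_filter_not_bot[OF L S]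
  have sa: "\<And>t. t \<in> S \<Longrightarrow> T t \<in> M" "\<And>t. t \<in> S \<Longrightarrow> op_adjoint (T t) = T t"
    using T by (auto simp: mono_net_def loewner_carrier_iff)
  have "A \<in> M"
    by (rule wtends_von_neumann_algebra[OF F lim M]) (rule eventually_mono[OF ev]; use sa in auto)
  moreover have "op_adjoint A = A"
    by (rule wtends_self_adjoint[OF F lim])
      (rule eventually_mono[OF ev]; use sa von_neumann_algebra_bounded[OF M] in auto)
  ultimately show ?thesis by (simp add: loewner_carrier_iff)
qed

lemma mono_net_limit_is_lub:
  assumes T: "mono_net L S M T" and lim: "wtends T A (tail_filter L S)"
  shows "is_lub (loewner_order M) A (T ` S)"
proof (rule least_UpperI)
  have L: "partial_order L" and S: "directed_in L S" using T by (auto simp: mono_net_def)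
  fix R assume R: "R \<in> Upper (loewner_order M) (T ` S)"
  have "op_positive (R - A)"
  proof (rule wtends_op_positive)
    show "tail_filter L S \<noteq> bot" by (rule tail_filter_not_bot[OF L S])
    show "wtends (\<lambda>t. R - T t) (R - A) (tail_filter L S)" by (intro wtends_diff lim wtends_const)
    show "eventually (\<lambda>t. op_positive (R - T t)) (tail_filter L S)"
      by (rule eventually_mono[OF eventually_tail_filter_mem[OF L S]])
        (use T R in \<open>auto simp: mono_net_def Upper_def loewner_le_iff\<close>)
  qed
  then show "A \<sqsubseteq>\<^bsub>loewner_order M\<^esub> R" by (simp add: loewner_le_iff)
next
  show "T ` S \<subseteq> carrier (loewner_order M)" using T by (auto simp: mono_net_def)
  show "A \<in> carrier (loewner_order M)" by (rule mono_net_limit_carrier[OF assms])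
qed (auto simp: loewner_le_iff intro: mono_net_limit_upper[OF assms])

text \<open>The bounded net has a weak limit, which lies in \<open>M\<close> by weak closedness and
  is itself a supremum; uniqueness of suprema identifies the two. This translates order-theoretic
  hypotheses such as normality into weak convergence.\<close>

lemma mono_net_lub_wtends:
  assumes T: "mono_net L S M T" and lub: "is_lub (loewner_order M) s (T ` S)"
  shows "wtends T s (tail_filter L S)"
proof -
  have s: "s \<in> carrier (loewner_order M)" "\<And>t. t \<in> S \<Longrightarrow> op_positive (s - T t)"
    using lub T by (auto simp: least_def Upper_def mono_net_def loewner_le_iff)
  then obtain A where A: "wtends T A (tail_filter L S)"
    using mono_net_convergent[OF T s] by blast
  have "A = s"
    by (rule is_lub_unique[OF partial_order_loewner mono_net_limit_is_lub[OF T A] lub])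
      (rule von_neumann_algebra_subset[OF M])
  then show ?thesis using A by simp
qed

lemma mono_net_id:
  "directed_in (loewner_order M) D \<Longrightarrow> mono_net (loewner_order M) D M (\<lambda>t. t)"
  using partial_order_loewner[OF von_neumann_algebra_subset[OF M]]
  by (auto simp: mono_net_def directed_in_def loewner_le_iff)

lemma mono_net_directed_image:
  assumes T: "mono_net L S M T"
  shows "directed_in (loewner_order M) (T ` S)"
proof -
  have S: "directed_in L S" and mem: "\<And>t. t \<in> S \<Longrightarrow> T t \<in> carrier (loewner_order M)"
    and mono: "\<And>t u. t \<in> S \<Longrightarrow> u \<in> S \<Longrightarrow> t \<sqsubseteq>\<^bsub>L\<^esub> u \<Longrightarrow> op_positive (T u - T t)"
    using T by (auto simp: mono_net_def)
  have "\<exists>c\<in>S. op_positive (T c - T a) \<and> op_positive (T c - T b)" if "a \<in> S" "b \<in> S" for a b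
    using S that mono unfolding directed_in_def by metis
  then show ?thesis using S mem by (auto simp: directed_in_def loewner_le_iff)
qed

end

section \<open>Completely positive maps\<close>

lemma linear_mapD:
  assumes "linear_map M N \<phi>"
  shows "x \<in> M \<Longrightarrow> \<phi> x \<in> N"
    and "x \<in> M \<Longrightarrow> y \<in> M \<Longrightarrow> \<phi> (x + y) = \<phi> x + \<phi> y"
    and "x \<in> M \<Longrightarrow> \<phi> (op_scale c x) = op_scale c (\<phi> x)"
  using assms by (auto simp: linear_map_def)

lemma op_scale_minus_one: "op_scale (-1) x = - x"
  by (rule blinfun_eqI) (simp add: scaleC_minus_one blinfun.minus_left)

lemma op_scale_add_right: "op_scale c (x + y) = op_scale c x + op_scale c y"
  by (rule blinfun_eqI) (simp add: scaleC_add_right blinfun_lin)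

lemma op_scale_diff_right: "op_scale c (x - y) = op_scale c x - op_scale c y"
  by (rule blinfun_eqI) (simp add: scaleC_diff_right blinfun_lin)

lemma op_scale_scale: "op_scale c (op_scale d x) = op_scale (c * d) x"
  by (rule blinfun_eqI) (simp add: scaleC_scaleC)

lemma op_scale_one [simp]: "op_scale 1 x = x"
  by (rule blinfun_eqI) simp

lemma op_scale_zero [simp]: "op_scale 0 x = 0"
  by (rule blinfun_eqI) simp

lemma op_scale_zero_right [simp]: "op_scale c 0 = 0"
  by (rule blinfun_eqI) simp

lemma compose_op_scale:
  "R \<in> bounded_operators \<Longrightarrow> R o\<^sub>L op_scale c x = op_scale c (R o\<^sub>L x)"
  by (rule blinfun_eqI) (simp add: mem_bounded_operatorsD)

lemma blinfun_compose_add: "R o\<^sub>L (x + y) = (R o\<^sub>L x) + (R o\<^sub>L y)"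
  by (rule blinfun_eqI) (simp add: blinfun_lin)

lemma blinfun_compose_diff: "R o\<^sub>L (x - y) = (R o\<^sub>L x) - (R o\<^sub>L y)"
  by (rule blinfun_eqI) (simp add: blinfun_lin)

lemma blinfun_compose_assoc3: "(R o\<^sub>L S) o\<^sub>L T = R o\<^sub>L (S o\<^sub>L T)"
  by (rule blinfun_eqI) simp

lemma linear_map_diff:
  assumes M: "von_neumann_algebra M" and \<phi>: "linear_map M N \<phi>" and x: "x \<in> M" and y: "y \<in> M"
  shows "\<phi> (x - y) = \<phi> x - \<phi> y"
proof -
  have "\<phi> (x + op_scale (-1) y) = \<phi> x + op_scale (-1) (\<phi> y)"
    using linear_mapD[OF \<phi>] x y vn_scale[OF M] by metis
  then show ?thesis by (simp add: op_scale_minus_one)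
qed

lemma completely_positive_linear: "completely_positive M N \<phi> \<Longrightarrow> linear_map M N \<phi>"
  by (simp add: completely_positive_def)

lemma completely_positive_mem: "completely_positive M N \<phi> \<Longrightarrow> x \<in> M \<Longrightarrow> \<phi> x \<in> N"
  using linear_mapD(1) completely_positive_linear by blast

lemma completely_positiveD:
  "completely_positive M N \<phi> \<Longrightarrow> (\<And>i j. i < n \<Longrightarrow> j < n \<Longrightarrow> X i j \<in> M) \<Longrightarrow> op_matrix_positive n X
    \<Longrightarrow> op_matrix_positive n (\<lambda>i j. \<phi> (X i j))"
  unfolding completely_positive_def by blast

lemma op_matrix_positive_1: "op_matrix_positive 1 (\<lambda>i j. x) \<longleftrightarrow> op_positive x"
  unfolding op_matrix_positive_def op_positive_def
proof (intro iffI allI)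
  fix u assume "\<forall>v::nat \<Rightarrow> 'a. 0 \<le> (\<Sum>i<1. cinner (v i) (\<Sum>j<1. x (v j)))"
  from spec[OF this, of "\<lambda>_. u"] show "0 \<le> form x u u" by simp
qed auto

lemma completely_positive_positive:
  assumes "completely_positive M N \<phi>" "x \<in> M" "op_positive x"
  shows "op_positive (\<phi> x)"
  using completely_positiveD[OF assms(1), of 1 "\<lambda>i j. x"] assms(2,3)
  unfolding op_matrix_positive_1 by blast

lemma completely_positive_cong:
  assumes "completely_positive M N \<phi>" "von_neumann_algebra M" "\<And>x. x \<in> M \<Longrightarrow> \<phi> x = \<psi> x"
  shows "completely_positive M N \<psi>"
proof -
  have "linear_map M N \<psi>"
    using completely_positive_linear[OF assms(1)] assms(3) vn_add[OF assms(2)] vn_scale[OF assms(2)]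
    by (auto simp: linear_map_def Pi_iff)
  moreover have "op_matrix_positive n (\<lambda>i j. \<psi> (X i j))"
    if "\<And>i j. i < n \<Longrightarrow> j < n \<Longrightarrow> X i j \<in> M" "op_matrix_positive n X" for n X
    using completely_positiveD[OF assms(1) that] that(1) assms(3)
    by (simp add: op_matrix_positive_def)
  ultimately show ?thesis by (simp add: completely_positive_def)
qed

lemma op_matrix_positive_add:
  "op_matrix_positive n X \<Longrightarrow> op_matrix_positive n Y \<Longrightarrow> op_matrix_positive n (\<lambda>i j. X i j + Y i j)"
  by (simp add: op_matrix_positive_def blinfun_lin cinner_simps sum.distrib)

lemma op_matrix_positive_scale:
  assumes "0 \<le> r" "op_matrix_positive n X"
  shows "op_matrix_positive n (\<lambda>i j. op_scale (of_real r) (X i j))"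
  unfolding op_matrix_positive_def
proof
  fix v :: "nat \<Rightarrow> 'a"
  have "(\<Sum>i<n. cinner (v i) (\<Sum>j<n. op_scale (of_real r) (X i j) (v j)))
      = of_real r * (\<Sum>i<n. cinner (v i) (\<Sum>j<n. X i j (v j)))"
    by (simp add: cinner_sum_right cinner_simps sum_distrib_left)
  then show "0 \<le> (\<Sum>i<n. cinner (v i) (\<Sum>j<n. op_scale (of_real r) (X i j) (v j)))"
    using assms by (simp add: op_matrix_positive_def complex_ge_0_iff)
qed

lemma completely_positive_add:
  assumes "von_neumann_algebra N" "completely_positive M N \<phi>" "completely_positive M N \<psi>"
  shows "completely_positive M N (\<lambda>x. \<phi> x + \<psi> x)"
  using assms(2,3) vn_add[OF assms(1)]
  by (auto simp: completely_positive_def linear_map_def op_matrix_positive_add op_scale_add_right Pi_iff)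

lemma completely_positive_scale:
  assumes "von_neumann_algebra N" "completely_positive M N \<phi>" "0 \<le> r"
  shows "completely_positive M N (\<lambda>x. op_scale (of_real r) (\<phi> x))"
  using assms(2,3) vn_scale[OF assms(1)]
  by (auto simp: completely_positive_def linear_map_def op_matrix_positive_scale op_scale_add_right
      op_scale_scale Pi_iff mult.commute)

lemma completely_positive_zero:
  assumes "von_neumann_algebra N"
  shows "completely_positive M N (\<lambda>x. 0)"
  using vn_zero[OF assms]
  by (auto simp: completely_positive_def linear_map_def op_matrix_positive_def)

lemma completely_positive_diff_trans:
  assumes "von_neumann_algebra N" "completely_positive M N (\<lambda>x. \<psi> x - \<phi> x)" "completely_positive M N (\<lambda>x. \<omega> x - \<psi> x)"
  shows "completely_positive M N (\<lambda>x. \<omega> x - \<phi> x)"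
  using completely_positive_add[OF assms] by (simp add: algebra_simps)

lemma completely_positive_compose:
  assumes "completely_positive M N \<phi>" "completely_positive N P \<psi>"
  shows "completely_positive M P (\<lambda>x. \<psi> (\<phi> x))"
proof -
  have l: "linear_map M N \<phi>" "linear_map N P \<psi>" using assms by (auto simp: completely_positive_def)
  have "linear_map M P (\<lambda>x. \<psi> (\<phi> x))"
    unfolding linear_map_def using linear_mapD[OF l(1)] linear_mapD[OF l(2)] by simp
  moreover have "op_matrix_positive n (\<lambda>i j. \<psi> (\<phi> (X i j)))"
    if "\<And>i j. i < n \<Longrightarrow> j < n \<Longrightarrow> X i j \<in> M" "op_matrix_positive n X" for n X
    by (rule completely_positiveD[OF assms(2)])
      (auto intro: completely_positive_mem[OF assms(1)] completely_positiveD[OF assms(1)] that)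
  ultimately show ?thesis by (simp add: completely_positive_def)
qed

text \<open>A self-adjoint element is the difference of the positive elements \<open>n\<close> and
  \<open>n - x\<close>, whose images are positive and therefore self-adjoint.\<close>

lemma completely_positive_self_adjoint:
  assumes M: "von_neumann_algebra M" and N: "von_neumann_algebra N"
    and \<phi>: "completely_positive M N \<phi>" and x: "x \<in> carrier (loewner_order M)"
  shows "\<phi> x \<in> carrier (loewner_order N)"
proof -
  have x': "x \<in> M" "op_adjoint x = x" using x by (auto simp: loewner_carrier_iff)
  define n where "n = op_scale (of_real (norm x)) (id_blinfun :: 'a \<Rightarrow>\<^sub>L 'a)"
  have n: "n \<in> M" "op_positive n"
    by (simp_all add: n_def vn_scale[OF M] vn_id[OF M] op_positive_scale_id[OF M])
  have nx: "n - x \<in> M" "op_positive (n - x)"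
    using vn_diff[OF M n(1) x'(1)] vn_norm_minus_positive[OF M x'] by (simp_all add: n_def)
  have eq: "\<phi> x = \<phi> n - \<phi> (n - x)"
    using linear_map_diff[OF M completely_positive_linear[OF \<phi>] n(1) x'(1)] by simp
  have "op_adjoint (\<phi> n) = \<phi> n" "op_adjoint (\<phi> (n - x)) = \<phi> (n - x)"
    by (auto intro!: vn_positive_self_adjoint[OF N] completely_positive_mem[OF \<phi>]
        completely_positive_positive[OF \<phi>] n nx)
  moreover have mem: "\<phi> n \<in> bounded_operators" "\<phi> (n - x) \<in> bounded_operators" "\<phi> x \<in> N"
    using completely_positive_mem[OF \<phi>] n nx x' von_neumann_algebra_bounded[OF N] by auto
  ultimately have h: "form (\<phi> n) v u = cnj (form (\<phi> n) u v)"
    "form (\<phi> (n - x)) v u = cnj (form (\<phi> (n - x)) u v)" for u v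
    using op_adjoint_eq_iff[OF mem(1)] op_adjoint_eq_iff[OF mem(2)] by blast+
  have "form (\<phi> x) v u = cnj (form (\<phi> x) u v)" for u v
    unfolding eq blinfun_lin cinner_simps h[of u v] by simp
  then have "op_adjoint (\<phi> x) = \<phi> x"
    using op_adjoint_eq_iff von_neumann_algebra_bounded[OF N mem(3)] by blast
  then show ?thesis using mem(3) by (simp add: loewner_carrier_iff)
qed

text \<open>At a positive argument the difference of the maps and its negative are both positive, so
  it is 0; the positive elements span.\<close>

lemma completely_positive_antisym:
  assumes M: "von_neumann_algebra M" and N: "von_neumann_algebra N"
    and \<phi>: "linear_map M N \<phi>" and \<psi>: "linear_map M N \<psi>"
    and le: "completely_positive M N (\<lambda>x. \<psi> x - \<phi> x)" and ge: "completely_positive M N (\<lambda>x. \<phi> x - \<psi> x)"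
    and x: "x \<in> M"
  shows "\<phi> x = \<psi> x"
  using x
proof (induct rule: vn_positive_span[OF M, consumes 1, case_names positive add scale])
  case (positive p)
  have "\<psi> p - \<phi> p = 0"
  proof (rule op_positive_antisym)
    show "\<psi> p - \<phi> p \<in> bounded_operators"
      using completely_positive_mem[OF le positive(1)] von_neumann_algebra_bounded[OF N] by blast
    show "op_positive (\<psi> p - \<phi> p)" using completely_positive_positive[OF le positive] .
    show "op_positive (- (\<psi> p - \<phi> p))" using completely_positive_positive[OF ge positive] by simp
  qed
  then show ?case by simp
qed (simp_all add: linear_mapD[OF \<phi>] linear_mapD[OF \<psi>])

text \<open>Linearity is an identity between weak limits, and each instance of
  \<open>op_matrix_positive\<close> is an inequality for a finite sum of entries, so both survive.
  Asking for positivity only eventually lets a net start above a given index.\<close>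

lemma completely_positive_limit:
  assumes F: "F \<noteq> bot" and M: "von_neumann_algebra M" and N: "von_neumann_algebra N"
    and ev: "eventually (\<lambda>i. completely_positive M N (\<theta> i)) F"
    and lim: "\<And>x. x \<in> M \<Longrightarrow> wtends (\<lambda>i. \<theta> i x) (\<omega> x) F"
  shows "completely_positive M N \<omega>"
proof -
  have mem: "\<omega> x \<in> N" if "x \<in> M" for x
    by (rule wtends_von_neumann_algebra[OF F lim[OF that] N])
      (rule eventually_mono[OF ev], rule completely_positive_mem[OF _ that])
  have add: "\<omega> (x + y) = \<omega> x + \<omega> y" if "x \<in> M" "y \<in> M" for x y
  proof (rule wtends_unique[OF F lim[OF vn_add[OF M that]]])
    show "wtends (\<lambda>i. \<theta> i (x + y)) (\<omega> x + \<omega> y) F"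
      by (rule wtends_cong[OF _ wtends_add[OF lim[OF that(1)] lim[OF that(2)]]])
        (rule eventually_mono[OF ev], simp add: linear_mapD[OF completely_positive_linear] that)
  qed
  have scale: "\<omega> (op_scale c x) = op_scale c (\<omega> x)" if "x \<in> M" for x c
  proof (rule wtends_unique[OF F lim[OF vn_scale[OF M that]]])
    show "wtends (\<lambda>i. \<theta> i (op_scale c x)) (op_scale c (\<omega> x)) F"
      by (rule wtends_cong[OF _ wtends_op_scale[OF lim[OF that]]])
        (rule eventually_mono[OF ev], simp add: linear_mapD[OF completely_positive_linear] that)
  qed
  have "op_matrix_positive n (\<lambda>i j. \<omega> (X i j))"
    if X: "\<And>i j. i < n \<Longrightarrow> j < n \<Longrightarrow> X i j \<in> M" "op_matrix_positive n X" for n X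
    unfolding op_matrix_positive_def
  proof
    fix v
    show "0 \<le> (\<Sum>i<n. cinner (v i) (\<Sum>j<n. \<omega> (X i j) (v j)))"
    proof (rule tendsto_complex_nonneg[OF F])
      show "((\<lambda>k. \<Sum>i<n. cinner (v i) (\<Sum>j<n. \<theta> k (X i j) (v j)))
          \<longlongrightarrow> (\<Sum>i<n. cinner (v i) (\<Sum>j<n. \<omega> (X i j) (v j)))) F"
        unfolding cinner_sum_right by (intro tendsto_sum wtendsD lim X) auto
      show "eventually (\<lambda>k. 0 \<le> (\<Sum>i<n. cinner (v i) (\<Sum>j<n. \<theta> k (X i j) (v j)))) F"
        by (rule eventually_mono[OF ev])
          (use completely_positiveD[OF _ X] in \<open>auto simp: op_matrix_positive_def\<close>)
    qed
  qed
  then show ?thesis using mem add scale by (simp add: completely_positive_def linear_map_def)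
qed

lemma mono_net_completely_positive:
  assumes M: "von_neumann_algebra M" and N: "von_neumann_algebra N"
    and \<phi>: "completely_positive M N \<phi>" and T: "mono_net L S M T"
  shows "mono_net L S N (\<lambda>t. \<phi> (T t))"
proof -
  have "op_positive (\<phi> (T u) - \<phi> (T t))" if "t \<in> S" "u \<in> S" "t \<sqsubseteq>\<^bsub>L\<^esub> u" for t u
  proof -
    have tu: "T t \<in> M" "T u \<in> M" "op_positive (T u - T t)"
      using T that by (auto simp: mono_net_def loewner_carrier_iff)
    have "op_positive (\<phi> (T u - T t))"
      by (rule completely_positive_positive[OF \<phi> vn_diff[OF M] ]) (use tu in auto)
    then show ?thesis by (simp add: linear_map_diff[OF M completely_positive_linear[OF \<phi>]] tu)
  qed
  then show ?thesis
    using T completely_positive_self_adjoint[OF M N \<phi>] by (auto simp: mono_net_def)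
qed

text \<open>Normality speaks of directed sets. The range of a monotone net is one, with the weak
  limit as supremum; the image of that supremum is then read back as a weak limit.\<close>

lemma normal_map_wtends:
  assumes M: "von_neumann_algebra M" and N: "von_neumann_algebra N"
    and \<phi>: "completely_positive M N \<phi>" "normal_map M N \<phi>"
    and T: "mono_net L S M T" and lim: "wtends T d (tail_filter L S)"
  shows "wtends (\<lambda>t. \<phi> (T t)) (\<phi> d) (tail_filter L S)"
proof (rule mono_net_lub_wtends[OF N mono_net_completely_positive[OF M N \<phi>(1) T]])
  have "is_lub (loewner_order N) (\<phi> d) (\<phi> ` T ` S)"
    using \<phi>(2) mono_net_directed_image[OF M T] mono_net_limit_is_lub[OF M T lim]
    unfolding normal_map_def preserves_directed_sups_def by blast
  then show "is_lub (loewner_order N) (\<phi> d) ((\<lambda>t. \<phi> (T t)) ` S)" by (simp add: image_image)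
qed

text \<open>The way back: each directed set is viewed as a net indexed by itself, and weak
  convergence of its image yields the supremum.\<close>

lemma normal_mapI:
  assumes M: "von_neumann_algebra M" and N: "von_neumann_algebra N" and \<phi>: "completely_positive M N \<phi>"
    and lim: "\<And>D d. directed_in (loewner_order M) D \<Longrightarrow> d \<in> carrier (loewner_order M) \<Longrightarrow>
      wtends (\<lambda>t. t) d (tail_filter (loewner_order M) D) \<Longrightarrow> wtends \<phi> (\<phi> d) (tail_filter (loewner_order M) D)"
  shows "normal_map M N \<phi>"
  unfolding normal_map_def preserves_directed_sups_def
proof (intro allI impI)
  fix D d assume D: "directed_in (loewner_order M) D" and d: "is_lub (loewner_order M) d D"
  note net = mono_net_id[OF M D]
  have "wtends (\<lambda>t. t) d (tail_filter (loewner_order M) D)"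
    by (rule mono_net_lub_wtends[OF M net]) (use d in simp)
  then have "wtends \<phi> (\<phi> d) (tail_filter (loewner_order M) D)"
    using d by (intro lim[OF D]) (simp_all add: least_def Upper_def)
  then show "is_lub (loewner_order N) (\<phi> d) (\<phi> ` D)"
    using mono_net_limit_is_lub[OF N mono_net_completely_positive[OF M N \<phi> net]] by simp
qed

section \<open>Construction and composition of NCPSU maps\<close>

lemma ncpsuD:
  assumes "\<phi> \<in> ncpsu_maps M N"
  shows "\<phi> \<in> extensional M" "normal_map M N \<phi>" "completely_positive M N \<phi>"
    "op_positive (id_blinfun - \<phi> id_blinfun)" "linear_map M N \<phi>"
  using assms by (auto simp: ncpsu_maps_def)

text \<open>\<open>restrict\<close> supplies the extensionality demanded by
  \<open>ncpsu_maps\<close>, so maps can be given by formulas whose values outside \<open>M\<close>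
  are arbitrary.\<close>

lemma ncpsuI:
  assumes M: "von_neumann_algebra M" and N: "von_neumann_algebra N" and \<phi>: "completely_positive M N \<phi>"
    and "op_positive (id_blinfun - \<phi> id_blinfun)"
    and lim: "\<And>D d. directed_in (loewner_order M) D \<Longrightarrow> d \<in> carrier (loewner_order M) \<Longrightarrow>
      wtends (\<lambda>t. t) d (tail_filter (loewner_order M) D) \<Longrightarrow> wtends \<phi> (\<phi> d) (tail_filter (loewner_order M) D)"
  shows "restrict \<phi> M \<in> ncpsu_maps M N"
proof -
  have cp: "completely_positive M N (restrict \<phi> M)"
    by (rule completely_positive_cong[OF \<phi> M]) simp
  have "normal_map M N (restrict \<phi> M)"
  proof (rule normal_mapI[OF M N cp])
    fix D d assume D: "directed_in (loewner_order M) D" and d: "d \<in> carrier (loewner_order M)"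
      and w: "wtends (\<lambda>t. t) d (tail_filter (loewner_order M) D)"
    have "eventually (\<lambda>t. t \<in> D) (tail_filter (loewner_order M) D)"
      by (rule eventually_tail_filter_mem[OF partial_order_loewner[OF von_neumann_algebra_subset[OF M]] D])
    then have "eventually (\<lambda>t. \<phi> t = restrict \<phi> M t) (tail_filter (loewner_order M) D)"
      by (rule eventually_mono) (use D in \<open>auto simp: directed_in_def loewner_carrier_iff\<close>)
    then show "wtends (restrict \<phi> M) (restrict \<phi> M d) (tail_filter (loewner_order M) D)"
      using wtends_cong[OF _ lim[OF D d w]] d by (simp add: loewner_carrier_iff)
  qed
  then show ?thesis
    using cp assms(4) vn_id[OF M] by (simp add: ncpsu_maps_def completely_positive_linear)
qed

lemma ncpsu_wtends:
  assumes "von_neumann_algebra M" "von_neumann_algebra N" "\<phi> \<in> ncpsu_maps M N"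
    "mono_net L S M T" "wtends T d (tail_filter L S)"
  shows "wtends (\<lambda>t. \<phi> (T t)) (\<phi> d) (tail_filter L S)"
  by (rule normal_map_wtends[OF assms(1,2) ncpsuD(3)[OF assms(3)] ncpsuD(2)[OF assms(3)] assms(4,5)])

lemma ncpsu_compose:
  assumes M: "von_neumann_algebra M" and N: "von_neumann_algebra N" and P: "von_neumann_algebra P"
    and \<phi>: "\<phi> \<in> ncpsu_maps M N" and \<psi>: "\<psi> \<in> ncpsu_maps N P"
  shows "compose M \<psi> \<phi> \<in> ncpsu_maps M P"
  unfolding compose_def
proof (rule ncpsuI[OF M P])
  show "completely_positive M P (\<lambda>x. \<psi> (\<phi> x))"
    by (rule completely_positive_compose[OF ncpsuD(3)[OF \<phi>] ncpsuD(3)[OF \<psi>]])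
  let ?e = "\<phi> id_blinfun"
  have e: "?e \<in> N" by (rule completely_positive_mem[OF ncpsuD(3)[OF \<phi>] vn_id[OF M]])
  \<comment> \<open>Subunitality: \<open>1 - \<psi>(\<phi>(1))\<close> is the sum of
    \<open>1 - \<psi>(1)\<close> and \<open>\<psi>(1 - \<phi>(1))\<close>.\<close>
  have "op_positive (\<psi> (id_blinfun - ?e))"
    by (rule completely_positive_positive[OF ncpsuD(3)[OF \<psi>] vn_diff[OF N vn_id[OF N] e] ncpsuD(4)[OF \<phi>]])
  then show "op_positive (id_blinfun - \<psi> ?e)"
    unfolding linear_map_diff[OF N ncpsuD(5)[OF \<psi>] vn_id[OF N] e]
    by (rule op_positive_diff_trans[OF _ ncpsuD(4)[OF \<psi>]])
next
  fix D d assume D: "directed_in (loewner_order M) D"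
    and w: "wtends (\<lambda>t. t) d (tail_filter (loewner_order M) D)"
  note net = mono_net_id[OF M D]
  show "wtends (\<lambda>x. \<psi> (\<phi> x)) (\<psi> (\<phi> d)) (tail_filter (loewner_order M) D)"
    by (rule ncpsu_wtends[OF N P \<psi> mono_net_completely_positive[OF M N ncpsuD(3)[OF \<phi>] net]])
      (rule ncpsu_wtends[OF M N \<phi> net w])
qed

section \<open>Compressions by central projections\<close>

definition central_projection :: "('h::complex_hilbert_space \<Rightarrow>\<^sub>L 'h) set \<Rightarrow> ('h \<Rightarrow>\<^sub>L 'h) \<Rightarrow> bool" where
  "central_projection M z \<longleftrightarrow> z \<in> M \<and> op_adjoint z = z \<and> z o\<^sub>L z = z \<and> (\<forall>x\<in>M. z o\<^sub>L x = x o\<^sub>L z)"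

lemma central_projection_complement:
  assumes M: "von_neumann_algebra M" and z: "central_projection M z"
  shows "central_projection M (id_blinfun - z)"
proof -
  have zM: "z \<in> M" "op_adjoint z = z" "z o\<^sub>L z = z" and c: "\<And>x. x \<in> M \<Longrightarrow> z o\<^sub>L x = x o\<^sub>L z"
    using z by (auto simp: central_projection_def)
  have m: "id_blinfun - z \<in> M" using zM vn_diff[OF M vn_id[OF M]] by blast
  have zz: "z (z u) = z u" for u
    using arg_cong[OF zM(3), of "\<lambda>f. blinfun_apply f u"] by simp
  have sa: "form z v u = cnj (form z u v)" for u v
    using zM(2) op_adjoint_eq_iff[OF von_neumann_algebra_bounded[OF M zM(1)]] by blast
  have "form (id_blinfun - z) v u = cnj (form (id_blinfun - z) u v)" for u v
    using sa[of v u] by (simp add: blinfun_lin cinner_simps) (metis cinner_commute)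
  then have "op_adjoint (id_blinfun - z) = id_blinfun - z"
    using op_adjoint_eq_iff[OF von_neumann_algebra_bounded[OF M m]] by blast
  moreover have "(id_blinfun - z) o\<^sub>L (id_blinfun - z) = id_blinfun - z"
    by (rule blinfun_eqI) (simp add: blinfun_lin zz)
  moreover have "(id_blinfun - z) o\<^sub>L x = x o\<^sub>L (id_blinfun - z)" if "x \<in> M" for x
  proof (rule blinfun_eqI)
    fix u
    have "z (x u) = x (z u)"
      using arg_cong[OF c[OF that], of "\<lambda>f. blinfun_apply f u"] by simp
    then show "((id_blinfun - z) o\<^sub>L x) u = (x o\<^sub>L (id_blinfun - z)) u"
      by (simp add: blinfun_lin)
  qed
  ultimately show ?thesis using m unfolding central_projection_def by blast
qed

text \<open>A central projection can be distributed to both sides of an entry: the form of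
  \<open>z X\<close> at \<open>v i\<close>, \<open>v j\<close> is that of \<open>X\<close> at
  \<open>z (v i)\<close>, \<open>z (v j)\<close>. So the new matrix form is the old one at another
  vector.\<close>

lemma op_matrix_positive_projection:
  assumes N: "von_neumann_algebra N" and z: "central_projection N z"
    and X: "\<And>i j. i < n \<Longrightarrow> j < n \<Longrightarrow> X i j \<in> N" "op_matrix_positive n X"
  shows "op_matrix_positive n (\<lambda>i j. z o\<^sub>L X i j)"
  unfolding op_matrix_positive_def
proof
  fix v :: "nat \<Rightarrow> 'a"
  have z': "z \<in> N" "op_adjoint z = z" "z o\<^sub>L z = z" and c: "\<And>x. x \<in> N \<Longrightarrow> z o\<^sub>L x = x o\<^sub>L z"
    using z by (auto simp: central_projection_def)
  have eq: "form (z o\<^sub>L X i j) (v i) (v j) = form (X i j) (z (v i)) (z (v j))" if "i < n" "j < n" for i j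
  proof -
    have "z o\<^sub>L X i j = (z o\<^sub>L z) o\<^sub>L X i j" by (simp add: z')
    also have "\<dots> = z o\<^sub>L (X i j o\<^sub>L z)" using c[OF X(1)[OF that]] by (simp add: blinfun_compose_assoc3)
    finally have "form (z o\<^sub>L X i j) (v i) (v j) = form z (v i) (X i j (z (v j)))" by simp
    also have "\<dots> = cinner (z (v i)) (X i j (z (v j)))"
      using op_adjoint(2)[OF von_neumann_algebra_bounded[OF N z'(1)]] z'(2) by metis
    finally show ?thesis .
  qed
  have "(\<Sum>i<n. cinner (v i) (\<Sum>j<n. (z o\<^sub>L X i j) (v j)))
      = (\<Sum>i<n. cinner (z (v i)) (\<Sum>j<n. X i j (z (v j))))"
    unfolding cinner_sum_right by (intro sum.cong refl) (use eq in auto)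
  also have "\<dots> \<ge> 0"
    using X(2) unfolding op_matrix_positive_def by (rule spec[where x = "\<lambda>i. z (v i)"])
  finally show "0 \<le> (\<Sum>i<n. cinner (v i) (\<Sum>j<n. (z o\<^sub>L X i j) (v j)))" .
qed

lemma completely_positive_projection:
  assumes N: "von_neumann_algebra N" and z: "central_projection N z"
  shows "completely_positive N N (\<lambda>x. z o\<^sub>L x)"
proof -
  have "z \<in> N" using z by (simp add: central_projection_def)
  then have "linear_map N N (\<lambda>x. z o\<^sub>L x)"
    using von_neumann_algebra_bounded[OF N]
    by (simp add: linear_map_def vn_compose[OF N] blinfun_compose_add compose_op_scale)
  then show ?thesis
    using op_matrix_positive_projection[OF N z] by (simp add: completely_positive_def)
qed

lemma ncpsu_projection:
  assumes M: "von_neumann_algebra M" and z: "central_projection M z" and r: "0 \<le> r" "r \<le> 1"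
  shows "(\<lambda>x\<in>M. op_scale (of_real r) (z o\<^sub>L x)) \<in> ncpsu_maps M M"
proof (rule ncpsuI[OF M M])
  show "completely_positive M M (\<lambda>x. op_scale (of_real r) (z o\<^sub>L x))"
    by (intro completely_positive_scale M completely_positive_projection z r)
  have zb: "z \<in> bounded_operators" using z von_neumann_algebra_bounded[OF M] by (simp add: central_projection_def)
  \<comment> \<open>Subunitality through \<open>1 - r z = (1 - z) + (1 - r) z\<close>.\<close>
  have "op_positive ((id_blinfun - z) o\<^sub>L id_blinfun)"
    by (rule completely_positive_positive[OF completely_positive_projection[OF M central_projection_complement[OF M z]] vn_id[OF M] op_positive_id])
  moreover have "op_positive (op_scale (of_real (1 - r)) (z o\<^sub>L id_blinfun))"
    by (intro op_positive_scale completely_positive_positive[OF completely_positive_projection[OF M z] vn_id[OF M] op_positive_id])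
      (use r in simp)
  ultimately have "op_positive (((id_blinfun - z) o\<^sub>L id_blinfun) + op_scale (of_real (1 - r)) (z o\<^sub>L id_blinfun))"
    by (rule op_positive_add)
  also have "((id_blinfun - z) o\<^sub>L id_blinfun) + op_scale (of_real (1 - r)) (z o\<^sub>L id_blinfun)
     = id_blinfun - op_scale (of_real r) (z o\<^sub>L id_blinfun)"
    by (rule blinfun_eqI_form) (simp add: blinfun_lin cinner_simps algebra_simps)
  finally show "op_positive (id_blinfun - op_scale (of_real r) (z o\<^sub>L id_blinfun))" .
  show "wtends (\<lambda>x. op_scale (of_real r) (z o\<^sub>L x)) (op_scale (of_real r) (z o\<^sub>L d)) (tail_filter (loewner_order M) D)"
    if "wtends (\<lambda>t. t) d (tail_filter (loewner_order M) D)" for D d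
    by (intro wtends_op_scale wtends_compose_left zb that)
qed

section \<open>Directed suprema of maps\<close>

context
  fixes A :: "('h::complex_hilbert_space \<Rightarrow>\<^sub>L 'h) set" and B :: "('k::complex_hilbert_space \<Rightarrow>\<^sub>L 'k) set"
  assumes A: "von_neumann_algebra A" and B: "von_neumann_algebra B"
begin

lemma Q_hom_carrier: "\<phi> \<in> carrier (Q_hom A B) \<longleftrightarrow> \<phi> \<in> ncpsu_maps B A"
  by (simp add: Q_hom_def)

lemma Q_hom_le: "\<phi> \<sqsubseteq>\<^bsub>Q_hom A B\<^esub> \<psi> \<longleftrightarrow> completely_positive B A (\<lambda>x. \<psi> x - \<phi> x)"
  by (simp add: Q_hom_def)

lemma partial_order_Q_hom: "partial_order (Q_hom A B)"
proof (unfold_locales, goal_cases)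
  case 4
  then show ?case using completely_positive_zero[OF A] by (simp add: Q_hom_le)
next
  case (5 \<phi> \<psi>)
  then have "\<phi> \<in> ncpsu_maps B A" "\<psi> \<in> ncpsu_maps B A" by (simp_all add: Q_hom_carrier)
  note n = ncpsuD[OF this(1)] ncpsuD[OF this(2)]
  have "\<phi> = \<psi>"
    by (rule extensionalityI[OF n(1) n(6)], rule completely_positive_antisym[OF B A n(5) n(10)])
      (use 5 in \<open>simp_all add: Q_hom_le\<close>)
  then show ?case by (simp add: Q_hom_def)
next
  case (6 \<phi> \<psi> \<omega>)
  then show ?case using completely_positive_diff_trans[OF A, of B \<psi> \<phi> \<omega>] by (simp add: Q_hom_le)
qed (auto simp: Q_hom_def)

lemma Q_hom_directed_ncpsu: "directed_in (Q_hom A B) S \<Longrightarrow> \<phi> \<in> S \<Longrightarrow> \<phi> \<in> ncpsu_maps B A"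
  by (auto simp: directed_in_def Q_hom_def)

text \<open>The order on maps yields operator inequalities at positive arguments only; the others
  are reached through \<open>vn_positive_span\<close>.\<close>

lemma Q_hom_mono_net:
  assumes S: "directed_in (Q_hom A B) S" and x: "x \<in> B" "op_positive x"
  shows "mono_net (Q_hom A B) S A (\<lambda>\<phi>. \<phi> x)"
  unfolding mono_net_def
proof (intro conjI ballI impI partial_order_Q_hom S)
  fix \<phi> assume "\<phi> \<in> S"
  then show "\<phi> x \<in> carrier (loewner_order A)"
    using completely_positive_self_adjoint[OF B A ncpsuD(3)[OF Q_hom_directed_ncpsu[OF S]]]
      vn_positive_self_adjoint[OF B x] x(1) by (auto simp: loewner_carrier_iff)
next
  fix \<phi> \<psi> assume "\<phi> \<sqsubseteq>\<^bsub>Q_hom A B\<^esub> \<psi>"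
  then show "op_positive (\<psi> x - \<phi> x)"
    unfolding Q_hom_le using completely_positive_positive[OF _ x] by fast
qed

text \<open>\<open>\<phi> x\<close> is at most \<open>norm x\<close> times \<open>\<phi>(1)\<close>,
  and \<open>\<phi>(1)\<close> is at most 1. The bound is the same for all \<open>\<phi>\<close>, as
  \<open>mono_net_convergent\<close> demands.\<close>

lemma ncpsu_norm_bound:
  assumes \<phi>: "\<phi> \<in> ncpsu_maps B A" and x: "x \<in> B" "op_positive x"
  shows "op_positive (op_scale (of_real (norm x)) id_blinfun - \<phi> x)"
proof -
  let ?n = "op_scale (of_real (norm x)) id_blinfun :: 'k \<Rightarrow>\<^sub>L 'k"
  have n: "?n \<in> B" by (intro vn_scale B vn_id)
  have "op_positive (\<phi> (?n - x))"
    using vn_norm_minus_positive[OF B x(1) vn_positive_self_adjoint[OF B x]]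
    by (rule completely_positive_positive[OF ncpsuD(3)[OF \<phi>] vn_diff[OF B n x(1)]])
  then have "op_positive (op_scale (of_real (norm x)) (\<phi> id_blinfun) - \<phi> x)"
    by (simp add: linear_map_diff[OF B ncpsuD(5)[OF \<phi>] n x(1)] linear_mapD(3)[OF ncpsuD(5)[OF \<phi>] vn_id[OF B]])
  moreover have "op_positive (op_scale (of_real (norm x)) id_blinfun - op_scale (of_real (norm x)) (\<phi> id_blinfun))"
    unfolding op_scale_diff_right[symmetric] by (rule op_positive_scale[OF _ ncpsuD(4)[OF \<phi>]]) simp
  ultimately show ?thesis by (rule op_positive_diff_trans)
qed

lemma Q_hom_pointwise_limit:
  assumes S: "directed_in (Q_hom A B) S" and x: "x \<in> B"
  shows "\<exists>a. wtends (\<lambda>\<phi>. \<phi> x) a (tail_filter (Q_hom A B) S)"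
  using x
proof (induct rule: vn_positive_span[OF B, consumes 1, case_names positive add scale])
  case (positive p)
  let ?R = "op_scale (of_real (norm p)) id_blinfun :: 'h \<Rightarrow>\<^sub>L 'h"
  have "?R \<in> A" "op_positive ?R"
    by (intro vn_scale A vn_id) (rule op_positive_scale_id[OF A], simp)
  then have "?R \<in> carrier (loewner_order A)"
    using vn_positive_self_adjoint[OF A] by (simp add: loewner_carrier_iff)
  then show ?case
    using mono_net_convergent[OF A Q_hom_mono_net[OF S positive]]
      ncpsu_norm_bound[OF Q_hom_directed_ncpsu[OF S] positive] by blast
next
  case (add x y)
  then obtain a b where "wtends (\<lambda>\<phi>. \<phi> x) a (tail_filter (Q_hom A B) S)"
    "wtends (\<lambda>\<phi>. \<phi> y) b (tail_filter (Q_hom A B) S)" by blast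
  from wtends_add[OF this] have "wtends (\<lambda>\<phi>. \<phi> (x + y)) (a + b) (tail_filter (Q_hom A B) S)"
    by (rule wtends_cong[rotated])
      (rule eventually_mono[OF eventually_tail_filter_mem[OF partial_order_Q_hom S]],
        simp add: linear_mapD(2)[OF ncpsuD(5)[OF Q_hom_directed_ncpsu[OF S]]] add)
  then show ?case ..
next
  case (scale c x)
  then obtain a where "wtends (\<lambda>\<phi>. \<phi> x) a (tail_filter (Q_hom A B) S)" by blast
  from wtends_op_scale[OF this] have "wtends (\<lambda>\<phi>. \<phi> (op_scale c x)) (op_scale c a) (tail_filter (Q_hom A B) S)"
    by (rule wtends_cong[rotated])
      (rule eventually_mono[OF eventually_tail_filter_mem[OF partial_order_Q_hom S]],
        simp add: linear_mapD(3)[OF ncpsuD(5)[OF Q_hom_directed_ncpsu[OF S]]] scale)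
  then show ?case ..
qed

lemma Q_hom_limit_upper:
  assumes S: "directed_in (Q_hom A B) S"
    and lim: "\<And>x. x \<in> B \<Longrightarrow> wtends (\<lambda>\<phi>. \<phi> x) (\<Phi> x) (tail_filter (Q_hom A B) S)"
    and \<phi>: "\<phi> \<in> S"
  shows "completely_positive B A (\<lambda>x. \<Phi> x - \<phi> x)"
proof (rule completely_positive_limit[OF tail_filter_not_bot[OF partial_order_Q_hom S] B A])
  show "eventually (\<lambda>\<psi>. completely_positive B A (\<lambda>x. \<psi> x - \<phi> x)) (tail_filter (Q_hom A B) S)"
    by (rule eventually_mono[OF eventually_tail_filter_above[OF partial_order_Q_hom S \<phi>]])
      (simp add: Q_hom_le)
qed (intro wtends_diff lim wtends_const)

lemma Q_hom_limit_least:
  assumes S: "directed_in (Q_hom A B) S"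
    and lim: "\<And>x. x \<in> B \<Longrightarrow> wtends (\<lambda>\<phi>. \<phi> x) (\<Phi> x) (tail_filter (Q_hom A B) S)"
    and ub: "\<And>\<phi>. \<phi> \<in> S \<Longrightarrow> completely_positive B A (\<lambda>x. \<psi> x - \<phi> x)"
  shows "completely_positive B A (\<lambda>x. \<psi> x - \<Phi> x)"
proof (rule completely_positive_limit[OF tail_filter_not_bot[OF partial_order_Q_hom S] B A])
  show "eventually (\<lambda>\<phi>. completely_positive B A (\<lambda>x. \<psi> x - \<phi> x)) (tail_filter (Q_hom A B) S)"
    by (rule eventually_mono[OF eventually_tail_filter_mem[OF partial_order_Q_hom S] ub])
qed (intro wtends_diff lim wtends_const)

text \<open>The point is normality of the limit, an interchange of two monotone limits. Let
  \<open>a\<close> be the weak limit of \<open>\<Phi> t\<close> for \<open>t\<close> in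
  \<open>D\<close>; monotonicity gives \<open>a \<le> \<Phi> d\<close>. Conversely each
  \<open>\<phi>\<close> in \<open>S\<close> is normal and lies below \<open>\<Phi>\<close>, so the
  limit over \<open>t\<close> bounds \<open>\<phi> d\<close> by \<open>a\<close> up to a correction
  at \<open>t0\<close>, and this correction vanishes in the limit over
  \<open>\<phi>\<close>.\<close>

lemma Q_hom_limit_ncpsu:
  assumes S: "directed_in (Q_hom A B) S"
    and lim: "\<And>x. x \<in> B \<Longrightarrow> wtends (\<lambda>\<phi>. \<phi> x) (\<Phi> x) (tail_filter (Q_hom A B) S)"
  shows "restrict \<Phi> B \<in> ncpsu_maps B A"
proof (rule ncpsuI[OF B A])
  note F = tail_filter_not_bot[OF partial_order_Q_hom S]
    and ev = eventually_tail_filter_mem[OF partial_order_Q_hom S]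
  note S_ncpsu = Q_hom_directed_ncpsu[OF S]
  show cp: "completely_positive B A \<Phi>"
    by (rule completely_positive_limit[OF F B A _ lim])
      (rule eventually_mono[OF ev], rule ncpsuD(3)[OF S_ncpsu])
  show "op_positive (id_blinfun - \<Phi> id_blinfun)"
    by (rule wtends_op_positive[OF F wtends_diff[OF wtends_const lim[OF vn_id[OF B]]]])
      (rule eventually_mono[OF ev], rule ncpsuD(4)[OF S_ncpsu])
  fix D d assume D: "directed_in (loewner_order B) D" and d: "d \<in> carrier (loewner_order B)"
    and w: "wtends (\<lambda>t. t) d (tail_filter (loewner_order B) D)"
  let ?L = "loewner_order B" and ?G = "tail_filter (loewner_order B) D"
  note Bp = partial_order_loewner[OF von_neumann_algebra_subset[OF B]]
  have dB: "d \<in> B" using d by (simp add: loewner_carrier_iff)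
  have DB: "t \<in> B" if "t \<in> D" for t using D that by (auto simp: directed_in_def loewner_carrier_iff)
  note net = mono_net_id[OF B D]
  note net\<Phi> = mono_net_completely_positive[OF B A cp net]
  have up: "op_positive (\<Phi> d - \<Phi> t)" if "t \<in> D" for t
    using completely_positive_positive[OF cp vn_diff[OF B dB DB[OF that]] mono_net_limit_upper[OF B net w that]]
    by (simp add: linear_map_diff[OF B completely_positive_linear[OF cp] dB DB[OF that]])
  obtain a where a: "wtends \<Phi> a ?G" "a \<in> carrier (loewner_order A)"
    using mono_net_convergent[OF A net\<Phi> completely_positive_self_adjoint[OF B A cp d] up] by blast
  have F': "?G \<noteq> bot" by (rule tail_filter_not_bot[OF Bp D])
  have le: "op_positive (\<Phi> d - a)"
    by (rule wtends_op_positive[OF F' wtends_diff[OF wtends_const a(1)]])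
      (rule eventually_mono[OF eventually_tail_filter_mem[OF Bp D] up])
  obtain t0 where t0: "t0 \<in> D" using D by (auto simp: directed_in_def)
  \<comment> \<open>\<open>D\<close> need not be positive, so \<open>\<phi> \<le> \<Phi>\<close> is only applied to the differences \<open>t - t0\<close>.\<close>
  have step: "op_positive (a - \<phi> d - (\<Phi> t0 - \<phi> t0))" if \<phi>: "\<phi> \<in> S" for \<phi>
  proof (rule wtends_op_positive[OF F'])
    show "wtends (\<lambda>t. \<Phi> t - \<phi> t - (\<Phi> t0 - \<phi> t0)) (a - \<phi> d - (\<Phi> t0 - \<phi> t0)) ?G"
      by (intro wtends_diff wtends_const a(1)) (rule ncpsu_wtends[OF B A S_ncpsu[OF \<phi>] net w])
    have "op_positive (\<Phi> t - \<phi> t - (\<Phi> t0 - \<phi> t0))" if t: "t \<in> D" "t0 \<sqsubseteq>\<^bsub>?L\<^esub> t" for t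
    proof -
      have "op_positive (\<Phi> (t - t0) - \<phi> (t - t0))"
        using t vn_diff[OF B DB[OF t(1)] DB[OF t0]]
        by (intro completely_positive_positive[OF Q_hom_limit_upper[OF S lim \<phi>]]) (auto simp: loewner_le_iff)
      then show ?thesis
        by (simp add: linear_map_diff[OF B completely_positive_linear[OF cp] DB[OF t(1)] DB[OF t0]]
            linear_map_diff[OF B ncpsuD(5)[OF S_ncpsu[OF \<phi>]] DB[OF t(1)] DB[OF t0]] algebra_simps)
    qed
    then show "eventually (\<lambda>t. op_positive (\<Phi> t - \<phi> t - (\<Phi> t0 - \<phi> t0))) ?G"
      by (intro eventually_mono[OF eventually_tail_filter_above[OF Bp D t0]]) blast
  qed
  have "op_positive (a - \<Phi> d - (\<Phi> t0 - \<Phi> t0))"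
  proof (rule wtends_op_positive[OF F])
    show "wtends (\<lambda>\<phi>. a - \<phi> d - (\<Phi> t0 - \<phi> t0)) (a - \<Phi> d - (\<Phi> t0 - \<Phi> t0)) (tail_filter (Q_hom A B) S)"
      by (intro wtends_diff wtends_const lim dB DB t0)
    show "eventually (\<lambda>\<phi>. op_positive (a - \<phi> d - (\<Phi> t0 - \<phi> t0))) (tail_filter (Q_hom A B) S)"
      by (rule eventually_mono[OF ev step])
  qed
  then have ge: "op_positive (- (\<Phi> d - a))" by simp
  have "\<Phi> d - a = 0"
    by (rule op_positive_antisym[OF bounded_operators_diff le ge])
      (use completely_positive_mem[OF cp dB] a(2) von_neumann_algebra_bounded[OF A] in \<open>auto simp: loewner_carrier_iff\<close>)
  then show "wtends \<Phi> (\<Phi> d) ?G" using a(1) by simp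
qed

lemma Q_hom_limit_is_lub:
  assumes S: "directed_in (Q_hom A B) S" and \<Phi>: "\<Phi> \<in> ncpsu_maps B A"
    and lim: "\<And>x. x \<in> B \<Longrightarrow> wtends (\<lambda>\<phi>. \<phi> x) (\<Phi> x) (tail_filter (Q_hom A B) S)"
  shows "is_lub (Q_hom A B) \<Phi> S"
proof (rule least_UpperI)
  fix \<psi> assume "\<psi> \<in> Upper (Q_hom A B) S"
  then have ub: "completely_positive B A (\<lambda>x. \<psi> x - \<phi> x)" if "\<phi> \<in> S" for \<phi>
    using that Q_hom_directed_ncpsu[OF S that] by (auto simp: Upper_def Q_hom_le Q_hom_carrier)
  show "\<Phi> \<sqsubseteq>\<^bsub>Q_hom A B\<^esub> \<psi>"
    unfolding Q_hom_le by (rule Q_hom_limit_least[OF S lim ub])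
qed (use S \<Phi> Q_hom_limit_upper[OF S lim] in \<open>auto simp: Q_hom_le Q_hom_carrier directed_in_def\<close>)

lemma Q_hom_directed_limit:
  assumes S: "directed_in (Q_hom A B) S"
  obtains \<Phi> where "\<Phi> \<in> ncpsu_maps B A" "is_lub (Q_hom A B) \<Phi> S"
    "\<And>x. x \<in> B \<Longrightarrow> wtends (\<lambda>\<phi>. \<phi> x) (\<Phi> x) (tail_filter (Q_hom A B) S)"
proof -
  obtain \<Phi> where lim: "\<And>x. x \<in> B \<Longrightarrow> wtends (\<lambda>\<phi>. \<phi> x) (\<Phi> x) (tail_filter (Q_hom A B) S)"
    using Q_hom_pointwise_limit[OF S] by metis
  then have lim': "\<And>x. x \<in> B \<Longrightarrow> wtends (\<lambda>\<phi>. \<phi> x) (restrict \<Phi> B x) (tail_filter (Q_hom A B) S)"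
    by simp
  have mem: "restrict \<Phi> B \<in> ncpsu_maps B A" by (rule Q_hom_limit_ncpsu[OF S lim])
  show ?thesis by (rule that[OF mem Q_hom_limit_is_lub[OF S mem lim'] lim'])
qed

lemma Q_hom_lub_wtends:
  assumes S: "directed_in (Q_hom A B) S" and lub: "is_lub (Q_hom A B) \<Phi> S" and x: "x \<in> B"
  shows "wtends (\<lambda>\<phi>. \<phi> x) (\<Phi> x) (tail_filter (Q_hom A B) S)"
proof -
  obtain \<Psi> where \<Psi>: "is_lub (Q_hom A B) \<Psi> S"
    "\<And>x. x \<in> B \<Longrightarrow> wtends (\<lambda>\<phi>. \<phi> x) (\<Psi> x) (tail_filter (Q_hom A B) S)"
    using Q_hom_directed_limit[OF S] by metis
  have "\<Phi> = \<Psi>" by (rule is_lub_unique[OF partial_order_Q_hom lub \<Psi>(1)])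
  then show ?thesis using \<Psi>(2)[OF x] by simp
qed

lemma dcpo_Q_hom: "dcpo (Q_hom A B)"
  unfolding dcpo_def using partial_order_Q_hom Q_hom_directed_limit by metis

end

section \<open>Central projections with finite-dimensional corners\<close>

text \<open>Gives boundedness of finitely supported families: outside the support all norms are 0,
  so only finitely many values occur.\<close>

lemma mat_opnorm_zero [simp]: "mat_opnorm (0\<^sub>m k k) = 0"
proof -
  let ?V = "{v \<in> carrier_vec k. vec_l2norm v \<le> 1} :: complex vec set"
  have "0\<^sub>v k \<in> ?V" by (simp add: vec_l2norm_def L2_set_def)
  moreover have "vec_l2norm (0\<^sub>m k k *\<^sub>v v) = 0" if "v \<in> ?V" for v
    using that by (auto simp: vec_l2norm_def L2_set_def)
  ultimately have "(\<lambda>v. vec_l2norm (0\<^sub>m k k *\<^sub>v v)) ` ?V = {0}" by force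
  then show ?thesis by (simp add: mat_opnorm_def)
qed

lemma mat_adjoint_index:
  fixes X :: "complex mat"
  shows "i < dim_col X \<Longrightarrow> j < dim_row X \<Longrightarrow> mat_adjoint X $$ (i, j) = cnj (X $$ (j, i))"
  by (simp add: mat_adjoint_def mat_of_rows_index)

lemma mat_adjoint_dim [simp]:
  fixes X :: "complex mat"
  shows "dim_row (mat_adjoint X) = dim_col X" "dim_col (mat_adjoint X) = dim_row X"
  by (simp_all add: mat_adjoint_def)

lemma mat_adjoint_one [simp]: "mat_adjoint (1\<^sub>m k :: complex mat) = 1\<^sub>m k"
  by (rule eq_matI) (auto simp: mat_adjoint_index)

lemma mat_adjoint_zero [simp]: "mat_adjoint (0\<^sub>m k k :: complex mat) = 0\<^sub>m k k"
  by (rule eq_matI) (auto simp: mat_adjoint_index)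

text \<open>Finite-dimensionality of the corner as a finite spanning set. The coefficients may
  depend on \<open>x\<close> in any way, since in \<open>cut_finite_span\<close> they become part of
  the spanning functions.\<close>

definition finite_corner :: "('h::complex_hilbert_space \<Rightarrow>\<^sub>L 'h) set \<Rightarrow> ('h \<Rightarrow>\<^sub>L 'h) \<Rightarrow> bool" where
  "finite_corner M z \<longleftrightarrow>
     (\<exists>b. finite b \<and> b \<subseteq> M \<and> (\<forall>x\<in>M. \<exists>c. z o\<^sub>L x = (\<Sum>s\<in>b. op_scale (c s) s)))"

lemma sum_op_scale: "(\<Sum>i\<in>I. op_scale (c i) x) = op_scale (\<Sum>i\<in>I. c i) x"
proof (induct I rule: infinite_finite_induct)
  case (insert i I)
  then show ?case by (intro blinfun_eqI) (simp add: blinfun_lin scaleC_add_left)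
qed auto

text \<open>The generators are an indexed family that may repeat an operator, whereas
  \<open>finite_corner\<close> sums over a set; the coefficients over each fibre of \<open>e\<close>
  are added.\<close>

lemma finite_cornerI:
  assumes "finite S" "\<And>s. s \<in> S \<Longrightarrow> e s \<in> M"
    and "\<And>x. x \<in> M \<Longrightarrow> z o\<^sub>L x = (\<Sum>s\<in>S. op_scale (c x s) (e s))"
  shows "finite_corner M z"
  unfolding finite_corner_def
proof (intro exI[of _ "e ` S"] conjI ballI)
  fix x assume "x \<in> M"
  then have "z o\<^sub>L x = (\<Sum>s\<in>S. op_scale (c x s) (e s))" by (rule assms(3))
  also have "\<dots> = (\<Sum>y\<in>e ` S. \<Sum>s\<in>{s\<in>S. e s = y}. op_scale (c x s) (e s))"
    by (rule sum.image_gen[OF assms(1)])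
  also have "\<dots> = (\<Sum>y\<in>e ` S. op_scale (\<Sum>s\<in>{s\<in>S. e s = y}. c x s) y)"
    unfolding sum_op_scale[symmetric] by (intro sum.cong refl) auto
  finally show "\<exists>d. z o\<^sub>L x = (\<Sum>y\<in>e ` S. op_scale (d y) y)"
    by (rule exI[where x = "\<lambda>y. \<Sum>s\<in>{s\<in>S. e s = y}. c x s"])
qed (use assms in auto)

text \<open>With \<open>e = 1 - w\<close>, compression by \<open>e\<close> preserves positivity, so
  both \<open>e z\<close> and \<open>e (w - z) = - e z\<close> are positive. Hence
  \<open>e z = 0\<close>.\<close>

lemma central_projection_le:
  assumes M: "von_neumann_algebra M" and z: "central_projection M z" and w: "central_projection M w"
    and le: "op_positive (w - z)"
  shows "w o\<^sub>L z = z"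
proof -
  let ?e = "id_blinfun - w"
  have zM: "z \<in> M" "z o\<^sub>L z = z" and wM: "w \<in> M" "w o\<^sub>L w = w"
    using z w by (auto simp: central_projection_def)
  have eM: "?e \<in> M" by (intro vn_diff M vn_id wM)
  note cp = completely_positive_positive[OF completely_positive_projection[OF M central_projection_complement[OF M w]]]
  have "op_positive (z o\<^sub>L id_blinfun)"
    by (rule completely_positive_positive[OF completely_positive_projection[OF M z] vn_id[OF M] op_positive_id])
  moreover have "z o\<^sub>L id_blinfun = z" by (rule blinfun_eqI) simp
  ultimately have "op_positive (?e o\<^sub>L z)" using cp[OF zM(1)] by simp
  moreover have "op_positive (?e o\<^sub>L (w - z))" by (rule cp[OF vn_diff[OF M wM(1) zM(1)] le])
  moreover have "?e o\<^sub>L (w - z) = - (?e o\<^sub>L z)"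
  proof (rule blinfun_eqI)
    fix u have "w (w u) = w u" using arg_cong[OF wM(2), of "\<lambda>f. blinfun_apply f u"] by simp
    then show "(?e o\<^sub>L (w - z)) u = (- (?e o\<^sub>L z)) u" by (simp add: blinfun_lin blinfun.minus_left)
  qed
  ultimately have "?e o\<^sub>L z = 0"
    using op_positive_antisym von_neumann_algebra_bounded[OF M vn_compose[OF M eM zM(1)]] by simp
  moreover have "?e o\<^sub>L z = z - (w o\<^sub>L z)" by (rule blinfun_eqI) (simp add: blinfun_lin)
  ultimately show ?thesis by simp
qed

text \<open>The difference is the compression by \<open>1 - z\<close> followed by the compression by
  \<open>w\<close>.\<close>

lemma central_projection_diff_positive:
  assumes M: "von_neumann_algebra M" and z: "central_projection M z" and w: "central_projection M w"
    and zw: "w o\<^sub>L z = z"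
  shows "completely_positive M M (\<lambda>x. (w o\<^sub>L x) - (z o\<^sub>L x))"
proof (rule completely_positive_cong[OF _ M])
  show "completely_positive M M (\<lambda>x. w o\<^sub>L ((id_blinfun - z) o\<^sub>L x))"
    by (rule completely_positive_compose[OF
        completely_positive_projection[OF M central_projection_complement[OF M z]]
        completely_positive_projection[OF M w]])
  fix x assume "x \<in> M"
  have "w (z u) = z u" for u using arg_cong[OF zw, of "\<lambda>f. blinfun_apply f u"] by simp
  then show "w o\<^sub>L ((id_blinfun - z) o\<^sub>L x) = (w o\<^sub>L x) - (z o\<^sub>L x)"
    by (intro blinfun_eqI) (simp add: blinfun_lin)
qed

definition exhausting_projections :: "('h::complex_hilbert_space \<Rightarrow>\<^sub>L 'h) set \<Rightarrow> ('h \<Rightarrow>\<^sub>L 'h) set \<Rightarrow> bool" where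
  "exhausting_projections M Z \<longleftrightarrow> directed_in (loewner_order M) Z \<and>
     (\<forall>z\<in>Z. central_projection M z \<and> finite_corner M z) \<and>
     wtends (\<lambda>z. z) id_blinfun (tail_filter (loewner_order M) Z)"

lemma product_algebra_finite_support:
  assumes F: "finite F" and y: "\<And>\<alpha>. \<alpha> \<in> F \<Longrightarrow> y \<alpha> \<in> carrier_mat (n \<alpha>) (n \<alpha>)"
  shows "(\<lambda>\<alpha>\<in>I. if \<alpha> \<in> F then y \<alpha> else 0\<^sub>m (n \<alpha>) (n \<alpha>))
    \<in> carrier (product_algebra I (\<lambda>\<alpha>. matrix_algebra (n \<alpha>)))"
proof -
  let ?x = "\<lambda>\<alpha>\<in>I. if \<alpha> \<in> F then y \<alpha> else 0\<^sub>m (n \<alpha>) (n \<alpha>)"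
  have "(\<lambda>\<alpha>. mat_opnorm (?x \<alpha>)) ` I \<subseteq> insert 0 ((\<lambda>\<alpha>. mat_opnorm (y \<alpha>)) ` F)" by auto
  then have "finite ((\<lambda>\<alpha>. mat_opnorm (?x \<alpha>)) ` I)"
    by (rule finite_subset) (use F in simp)
  then have "bdd_above ((\<lambda>\<alpha>. mat_opnorm (?x \<alpha>)) ` I)" by (rule bdd_above_finite)
  then show ?thesis using y by (auto simp: product_algebra_def matrix_algebra_def)
qed

text \<open>The isomorphism \<open>\<pi>\<close> is purely algebraic, and its weak continuity is not
  among the data, so the supremum of the projections is not read off in the product. Instead the
  weak limit \<open>L\<close> is formed in \<open>M\<close>; it satisfies \<open>L z = z\<close> for
  each projection \<open>z\<close>, and these equations make every coordinate of
  \<open>\<pi> L\<close> a unit matrix.\<close>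

lemma hereditarily_atomic_exhausting_projections:
  assumes "hereditarily_atomic TYPE('i) M"
  shows "\<exists>Z. exhausting_projections M Z"
proof -
  have M: "von_neumann_algebra M" using assms by (simp add: hereditarily_atomic_def)
  obtain I :: "'i set" and n \<pi> where
    \<pi>: "\<pi> \<in> star_iso (operator_algebra M) (product_algebra I (\<lambda>\<alpha>. matrix_algebra (n \<alpha>)))"
    using assms by (auto simp: hereditarily_atomic_def)
  let ?C = "carrier (product_algebra I (\<lambda>\<alpha>. matrix_algebra (n \<alpha>)))"
  have bij: "bij_betw \<pi> M ?C"
    and mult: "\<And>x y. x \<in> M \<Longrightarrow> y \<in> M \<Longrightarrow> \<pi> (x o\<^sub>L y) = (\<lambda>\<alpha>\<in>I. \<pi> x \<alpha> * \<pi> y \<alpha>)"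
    and add: "\<And>x y. x \<in> M \<Longrightarrow> y \<in> M \<Longrightarrow> \<pi> (x + y) = (\<lambda>\<alpha>\<in>I. \<pi> x \<alpha> + \<pi> y \<alpha>)"
    and scale: "\<And>c x. x \<in> M \<Longrightarrow> \<pi> (op_scale c x) = (\<lambda>\<alpha>\<in>I. c \<cdot>\<^sub>m \<pi> x \<alpha>)"
    and adj: "\<And>x. x \<in> M \<Longrightarrow> \<pi> (op_adjoint x) = (\<lambda>\<alpha>\<in>I. mat_adjoint (\<pi> x \<alpha>))"
    using \<pi> by (auto simp: star_iso_def ring_iso_def Ring.ring_hom_def operator_algebra_def
        product_algebra_def matrix_algebra_def)
  have inj: "x = y" if "x \<in> M" "y \<in> M" "\<pi> x = \<pi> y" for x y
    using bij that by (auto simp: bij_betw_def inj_on_def)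
  have \<pi>C: "\<pi> x \<in> ?C" if "x \<in> M" for x using bij that by (auto simp: bij_betw_def)
  have dims: "\<pi> x \<alpha> \<in> carrier_mat (n \<alpha>) (n \<alpha>)" if "x \<in> M" "\<alpha> \<in> I" for x \<alpha>
    using \<pi>C[OF that(1)] that(2) by (auto simp: product_algebra_def matrix_algebra_def)
  have ext: "x = y" if "x \<in> M" "y \<in> M" "\<And>\<alpha>. \<alpha> \<in> I \<Longrightarrow> \<pi> x \<alpha> = \<pi> y \<alpha>" for x y
  proof (rule inj[OF that(1,2)], rule PiE_ext)
    show "\<pi> x \<in> (\<Pi>\<^sub>E \<alpha>\<in>I. carrier_mat (n \<alpha>) (n \<alpha>))" "\<pi> y \<in> (\<Pi>\<^sub>E \<alpha>\<in>I. carrier_mat (n \<alpha>) (n \<alpha>))"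
      using \<pi>C[OF that(1)] \<pi>C[OF that(2)] by (auto simp: product_algebra_def matrix_algebra_def)
  qed (rule that(3))
  have surj: "\<exists>x\<in>M. \<forall>\<alpha>\<in>I. \<pi> x \<alpha> = (if \<alpha> \<in> F then y \<alpha> else 0\<^sub>m (n \<alpha>) (n \<alpha>))"
    if "finite F" "\<And>\<alpha>. \<alpha> \<in> F \<Longrightarrow> y \<alpha> \<in> carrier_mat (n \<alpha>) (n \<alpha>)" for F y
  proof -
    have "(\<lambda>\<alpha>\<in>I. if \<alpha> \<in> F then y \<alpha> else 0\<^sub>m (n \<alpha>) (n \<alpha>)) \<in> \<pi> ` M"
      using product_algebra_finite_support[OF that, where I = I] bij by (simp add: bij_betw_def)
    then obtain x where x: "x \<in> M" "\<pi> x = (\<lambda>\<alpha>\<in>I. if \<alpha> \<in> F then y \<alpha> else 0\<^sub>m (n \<alpha>) (n \<alpha>))" by auto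
    then show ?thesis by (intro bexI[of _ x]) simp_all
  qed
  \<comment> \<open>\<open>z F\<close> will be the preimage of the family that is the unit on the
    coordinates in \<open>F\<close> and 0 elsewhere.\<close>
  have "\<exists>x\<in>M. \<forall>\<alpha>\<in>I. \<pi> x \<alpha> = (if \<alpha> \<in> F then 1\<^sub>m (n \<alpha>) else 0\<^sub>m (n \<alpha>) (n \<alpha>))" if "finite F" for F
    by (rule surj[OF that]) simp
  then obtain z where zM: "\<And>F. finite F \<Longrightarrow> z F \<in> M"
    and z: "\<And>F \<alpha>. finite F \<Longrightarrow> \<alpha> \<in> I \<Longrightarrow> \<pi> (z F) \<alpha> = (if \<alpha> \<in> F then 1\<^sub>m (n \<alpha>) else 0\<^sub>m (n \<alpha>) (n \<alpha>))"
    by metis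
  have z_left: "\<pi> (z F o\<^sub>L x) \<alpha> = (if \<alpha> \<in> F then \<pi> x \<alpha> else 0\<^sub>m (n \<alpha>) (n \<alpha>))"
    if "finite F" "x \<in> M" "\<alpha> \<in> I" for F x \<alpha>
    using that dims[OF that(2,3)] by (simp add: mult zM z)
  have z_right: "\<pi> (x o\<^sub>L z F) \<alpha> = (if \<alpha> \<in> F then \<pi> x \<alpha> else 0\<^sub>m (n \<alpha>) (n \<alpha>))"
    if "finite F" "x \<in> M" "\<alpha> \<in> I" for F x \<alpha>
    using that dims[OF that(2,3)] by (simp add: mult zM z)
  have central: "central_projection M (z F)" if F: "finite F" for F
    unfolding central_projection_def
  proof (intro conjI ballI)
    show "op_adjoint (z F) = z F"
      by (rule ext) (simp_all add: vn_adjoint[OF M] zM[OF F] adj z[OF F])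
    show "z F o\<^sub>L z F = z F"
      by (rule ext) (simp_all add: vn_compose[OF M] zM[OF F] z_left[OF F] z[OF F])
    fix x assume "x \<in> M"
    then show "z F o\<^sub>L x = x o\<^sub>L z F"
      by (intro ext) (simp_all add: vn_compose[OF M] zM[OF F] z_left[OF F] z_right[OF F])
  qed (rule zM[OF F])
  have corner: "finite_corner M (z F)" if F: "finite F" "F \<subseteq> I" for F
  proof -
    \<comment> \<open>Preimages of the matrix units: those with index in \<open>F\<close> span the
      corner, with the entries of \<open>\<pi> x\<close> as coefficients.\<close>
    let ?U = "\<lambda>\<alpha> i j. mat (n \<alpha>) (n \<alpha>) (\<lambda>p. if p = (i, j) then 1 else 0) :: complex mat"
    have "\<exists>x\<in>M. \<forall>\<beta>\<in>I. \<pi> x \<beta> = (if \<beta> \<in> {\<alpha>} then ?U \<beta> i j else 0\<^sub>m (n \<beta>) (n \<beta>))" for \<alpha> i j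
      by (rule surj) simp_all
    then obtain e where eM: "\<And>\<alpha> i j. e \<alpha> i j \<in> M"
      and e: "\<And>\<alpha> i j \<beta>. \<beta> \<in> I \<Longrightarrow> \<pi> (e \<alpha> i j) \<beta> = (if \<beta> = \<alpha> then ?U \<beta> i j else 0\<^sub>m (n \<beta>) (n \<beta>))"
      by (metis singleton_iff)
    define S where "S = Sigma F (\<lambda>\<alpha>. {..<n \<alpha>} \<times> {..<n \<alpha>})"
    define E where "E = (\<lambda>(\<alpha>, i, j). e \<alpha> i j)"
    have S: "finite S" using F by (simp add: S_def)
    have EM: "E s \<in> M" for s by (simp add: E_def eM split: prod.split)
    show ?thesis
    proof (rule finite_cornerI[OF S EM, where c = "\<lambda>x (\<alpha>, i, j). \<pi> x \<alpha> $$ (i, j)"])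
      fix x assume x: "x \<in> M"
      define c where "c = (\<lambda>(\<alpha>, i, j). \<pi> x \<alpha> $$ (i, j))"
      have sum: "(\<Sum>s\<in>T. op_scale (c s) (E s)) \<in> M" for T
        by (intro vn_sum M vn_scale EM)
      show "z F o\<^sub>L x = (\<Sum>s\<in>S. op_scale ((\<lambda>(\<alpha>, i, j). \<pi> x \<alpha> $$ (i, j)) s) (E s))"
        unfolding c_def[symmetric]
      proof (rule ext[OF vn_compose[OF M zM[OF F(1)] x] sum])
        fix \<beta> assume \<beta>: "\<beta> \<in> I"
        show "\<pi> (z F o\<^sub>L x) \<beta> = \<pi> (\<Sum>s\<in>S. op_scale (c s) (E s)) \<beta>"
        proof (rule eq_matI)
          fix k l assume "k < dim_row (\<pi> (\<Sum>s\<in>S. op_scale (c s) (E s)) \<beta>)"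
            "l < dim_col (\<pi> (\<Sum>s\<in>S. op_scale (c s) (E s)) \<beta>)"
          then have kl: "k < n \<beta>" "l < n \<beta>" using carrier_matD[OF dims[OF sum[of S] \<beta>]] by simp_all
          have entry_add: "\<pi> (y + y') \<beta> $$ (k, l) = \<pi> y \<beta> $$ (k, l) + \<pi> y' \<beta> $$ (k, l)"
            if "y \<in> M" "y' \<in> M" for y y'
            using add[OF that] \<beta> dims[OF that(1) \<beta>] dims[OF that(2) \<beta>] kl by simp
          have entry_scale: "\<pi> (op_scale c y) \<beta> $$ (k, l) = c * \<pi> y \<beta> $$ (k, l)" if "y \<in> M" for c y
            using scale[OF that] \<beta> dims[OF that \<beta>] kl by simp
          \<comment> \<open>Preservation of 0 is not a clause of \<open>star_iso\<close>; it comes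
            from scaling by 0.\<close>
          have entry_zero: "\<pi> 0 \<beta> $$ (k, l) = 0"
            using entry_scale[OF vn_zero[OF M], of 0] by simp
          have entry_sum: "\<pi> (\<Sum>s\<in>T. op_scale (c s) (E s)) \<beta> $$ (k, l)
              = (\<Sum>s\<in>T. c s * \<pi> (E s) \<beta> $$ (k, l))" if "finite T" for T
            using that
          proof (induct T)
            case (insert s T)
            then show ?case
              using entry_add[OF vn_scale[OF M EM] sum] entry_scale[OF EM] by simp
          qed (simp add: entry_zero)
          have "\<pi> (E s) \<beta> $$ (k, l) = (if s = (\<beta>, k, l) then 1 else 0)" for s
            using kl \<beta> by (cases s) (auto simp: E_def e)
          then have "\<pi> (\<Sum>s\<in>S. op_scale (c s) (E s)) \<beta> $$ (k, l)
              = (\<Sum>s\<in>S. if s = (\<beta>, k, l) then c (\<beta>, k, l) else 0)"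
            unfolding entry_sum[OF S] by (intro sum.cong refl) auto
          also have "\<dots> = (if \<beta> \<in> F then \<pi> x \<beta> $$ (k, l) else 0)"
            using S kl by (simp add: S_def c_def)
          finally show "\<pi> (z F o\<^sub>L x) \<beta> $$ (k, l) = \<pi> (\<Sum>s\<in>S. op_scale (c s) (E s)) \<beta> $$ (k, l)"
            using kl by (simp add: z_left[OF F(1) x \<beta>])
        qed (use dims[OF vn_compose[OF M zM[OF F(1)] x] \<beta>] dims[OF sum[of S] \<beta>] in auto)
      qed
    qed
  qed
  have prod: "z G o\<^sub>L z F = z F" if "finite F" "finite G" "F \<subseteq> G" for F G
  proof (rule ext)
    show "z G o\<^sub>L z F \<in> M" by (intro vn_compose[OF M] zM that)
    show "z F \<in> M" by (intro zM that)
    fix \<alpha> assume "\<alpha> \<in> I"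
    then show "\<pi> (z G o\<^sub>L z F) \<alpha> = \<pi> (z F) \<alpha>"
      using that by (auto simp: z_left[OF that(2) zM[OF that(1)]] z[OF that(1)])
  qed
  have mono: "op_positive (z G - z F)" if "finite F" "finite G" "F \<subseteq> G" for F G
  proof -
    have "op_positive ((z G o\<^sub>L id_blinfun) - (z F o\<^sub>L id_blinfun))"
      by (rule completely_positive_positive[OF central_projection_diff_positive[OF M] vn_id[OF M] op_positive_id])
        (use that central prod in auto)
    also have "(z G o\<^sub>L id_blinfun) - (z F o\<^sub>L id_blinfun) = z G - z F"
      by (rule blinfun_eqI) (simp add: blinfun_lin)
    finally show ?thesis .
  qed
  define Z where "Z = z ` {F. finite F \<and> F \<subseteq> I}"
  have sa: "x \<in> carrier (loewner_order M)" if "x \<in> Z" for x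
    using that central by (auto simp: Z_def central_projection_def loewner_carrier_iff)
  have dir: "directed_in (loewner_order M) Z"
    unfolding directed_in_def loewner_le_iff
  proof (intro conjI ballI)
    show "Z \<subseteq> carrier (loewner_order M)" using sa by blast
    show "Z \<noteq> {}" unfolding Z_def by blast
    fix x y assume "x \<in> Z" "y \<in> Z"
    then obtain F G where FG: "finite F" "F \<subseteq> I" "x = z F" "finite G" "G \<subseteq> I" "y = z G"
      by (auto simp: Z_def)
    then show "\<exists>w\<in>Z. op_positive (w - x) \<and> op_positive (w - y)"
      by (intro bexI[of _ "z (F \<union> G)"]) (auto simp: Z_def intro!: mono)
  qed
  let ?G = "tail_filter (loewner_order M) Z"
  note Mp = partial_order_loewner[OF von_neumann_algebra_subset[OF M]]
  have idM: "id_blinfun \<in> carrier (loewner_order M)"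
    using vn_id[OF M] vn_positive_self_adjoint[OF M _ op_positive_id] by (simp add: loewner_carrier_iff)
  have "op_positive (id_blinfun - x)" if "x \<in> Z" for x
  proof -
    obtain F where F: "finite F" "x = z F" using \<open>x \<in> Z\<close> by (auto simp: Z_def)
    have "op_positive ((id_blinfun - z F) o\<^sub>L id_blinfun)"
      by (rule completely_positive_positive[OF completely_positive_projection[OF M] vn_id[OF M] op_positive_id])
        (rule central_projection_complement[OF M central[OF F(1)]])
    also have "(id_blinfun - z F) o\<^sub>L id_blinfun = id_blinfun - x"
      by (rule blinfun_eqI) (simp add: F)
    finally show ?thesis .
  qed
  then obtain L where L: "wtends (\<lambda>x. x) L ?G" "L \<in> M"
    using mono_net_convergent[OF M mono_net_id[OF M dir] idM] by (auto simp: loewner_carrier_iff)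
  have Lz: "L o\<^sub>L z F = z F" if F: "finite F" "F \<subseteq> I" for F
  proof (rule wtends_unique[OF tail_filter_not_bot[OF Mp dir] wtends_compose_right[OF L(1)]])
    have zF: "z F \<in> Z" using F by (auto simp: Z_def)
    \<comment> \<open>Every projection above \<open>z F\<close> acts on it as a unit, so the net is
      eventually constant.\<close>
    have "eventually (\<lambda>x. z F = x o\<^sub>L z F) ?G"
    proof (rule eventually_mono[OF eventually_tail_filter_above[OF Mp dir zF]])
      fix x assume x: "x \<in> Z \<and> z F \<sqsubseteq>\<^bsub>loewner_order M\<^esub> x"
      then have "central_projection M x" using central by (auto simp: Z_def)
      then show "z F = x o\<^sub>L z F"
        using central_projection_le[OF M central[OF F(1)]] x by (simp add: loewner_le_iff)
    qed
    then show "wtends (\<lambda>x. x o\<^sub>L z F) (z F) ?G" by (rule wtends_cong) (rule wtends_const)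
  qed
  have "L = id_blinfun"
  proof (rule ext[OF L(2) vn_id[OF M]])
    fix \<alpha> assume \<alpha>: "\<alpha> \<in> I"
    \<comment> \<open>Multiplication by \<open>z {\<alpha>}\<close> does not change the coordinate
      \<open>\<alpha>\<close>, and after it \<open>L\<close> and the identity agree.\<close>
    have "\<pi> L \<alpha> = \<pi> (L o\<^sub>L z {\<alpha>}) \<alpha>" using z_right[OF _ L(2) \<alpha>] by simp
    also have "L o\<^sub>L z {\<alpha>} = id_blinfun o\<^sub>L z {\<alpha>}" using \<alpha> by (intro blinfun_eqI) (simp add: Lz)
    also have "\<pi> \<dots> \<alpha> = \<pi> id_blinfun \<alpha>" using z_right[OF _ vn_id[OF M] \<alpha>] by simp
    finally show "\<pi> L \<alpha> = \<pi> id_blinfun \<alpha>" .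
  qed
  then have "wtends (\<lambda>x. x) id_blinfun ?G" using L(1) by simp
  then have "exhausting_projections M Z"
    unfolding exhausting_projections_def using dir central corner by (auto simp: Z_def)
  then show ?thesis ..
qed

section \<open>Approximation from below on finite-dimensional corners\<close>

text \<open>Elimination: take a point \<open>x0\<close> where some member does not vanish, pass to
  the members vanishing at \<open>x0\<close>, and use the nonzero value to remove one spanning
  function. Each member of \<open>W\<close> is thereby expanded with its own values as coefficients,
  so pointwise convergence to 0 becomes convergence of finitely many coefficients. The
  \<open>u j\<close> are taken in \<open>W\<close>, because domination is known only there.\<close>

lemma finite_span_interpolation:
  fixes W :: "('x \<Rightarrow> real) set" and h :: "'i \<Rightarrow> 'x \<Rightarrow> real"
  assumes "finite I"
    and "\<And>f g a b. f \<in> W \<Longrightarrow> g \<in> W \<Longrightarrow> (\<lambda>x. a * f x + b * g x) \<in> W"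
    and "\<And>f. f \<in> W \<Longrightarrow> \<exists>c. \<forall>x. f x = (\<Sum>i\<in>I. c i * h i x)"
  shows "\<exists>k p u. (\<forall>j<k. u j \<in> W) \<and> (\<forall>f\<in>W. \<forall>x. f x = (\<Sum>j<(k::nat). f (p j) * u j x))"
  using assms
proof (induct I arbitrary: W h rule: finite_psubset_induct)
  case (psubset I)
  note lin = psubset.prems(1) and span = psubset.prems(2)
  show ?case
  proof (cases "\<forall>f\<in>W. \<forall>x. f x = 0")
    case True
    then show ?thesis by (intro exI[of _ 0]) simp
  next
    case False
    then obtain f0 x0 where f0: "f0 \<in> W" "f0 x0 \<noteq> 0" by auto
    define f1 where "f1 = (\<lambda>x. (1 / f0 x0) * f0 x + 0 * f0 x)"
    have f1: "f1 \<in> W" "f1 x0 = 1"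
      unfolding f1_def by (rule lin[OF f0(1) f0(1)]) (use f0(2) in simp)
    obtain c0 where "f0 x0 = (\<Sum>i\<in>I. c0 i * h i x0)" using span[OF f0(1)] by blast
    then have "\<exists>n\<in>I. h n x0 \<noteq> 0" using f0(2) by (intro ccontr[of "\<exists>n\<in>I. h n x0 \<noteq> 0"]) simp
    then obtain n where n: "n \<in> I" "h n x0 \<noteq> 0" by blast
    define W' where "W' = {f \<in> W. f x0 = 0}"
    \<comment> \<open>The multiple of \<open>h n\<close> cancels the value at \<open>x0\<close>.
      Thus \<open>h' n = 0\<close>, and members of \<open>W'\<close> keep their coefficients because
      they vanish at \<open>x0\<close>.\<close>
    define h' where "h' i x = h i x - h i x0 / h n x0 * h n x" for i x
    have "\<exists>k p u. (\<forall>j<k. u j \<in> W') \<and> (\<forall>f\<in>W'. \<forall>x. f x = (\<Sum>j<(k::nat). f (p j) * u j x))"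
    proof (rule psubset.hyps(2))
      show "I - {n} \<subset> I" using n by blast
      show "(\<lambda>x. a * f x + b * g x) \<in> W'" if "f \<in> W'" "g \<in> W'" for f g a b
        using that lin by (simp add: W'_def)
      fix f assume f: "f \<in> W'"
      then obtain c where c: "\<And>x. f x = (\<Sum>i\<in>I. c i * h i x)" using span by (auto simp: W'_def)
      have "f x = (\<Sum>i\<in>I - {n}. c i * h' i x)" for x
      proof -
        have "f x = f x - f x0 / h n x0 * h n x" using f by (simp add: W'_def)
        also have "\<dots> = (\<Sum>i\<in>I. c i * h' i x)"
        proof -
          have "(\<Sum>i\<in>I. c i * h' i x) = (\<Sum>i\<in>I. c i * h i x - c i * h i x0 * (h n x / h n x0))"
            by (intro sum.cong refl) (simp add: h'_def algebra_simps)
          also have "\<dots> = f x - f x0 * (h n x / h n x0)"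
            by (simp only: sum_subtractf c sum_distrib_right)
          finally show ?thesis by simp
        qed
        also have "\<dots> = (\<Sum>i\<in>I - {n}. c i * h' i x)"
          using n psubset.hyps(1) by (simp add: sum.remove[of I n] h'_def)
        finally show ?thesis .
      qed
      then show "\<exists>c. \<forall>x. f x = (\<Sum>i\<in>I - {n}. c i * h' i x)" by blast
    qed
    then obtain k p u where u: "\<And>j. j < k \<Longrightarrow> u j \<in> W'"
      and ip: "\<And>f x. f \<in> W' \<Longrightarrow> f x = (\<Sum>j<(k::nat). f (p j) * u j x)" by blast
    have sum_mem: "(\<lambda>x. \<Sum>j<m. a j * u j x) \<in> W" if "m \<le> k" for a m
      using that
    proof (induct m)
      case 0
      show ?case using lin[OF f1(1) f1(1), of 0 0] by simp
    next
      case (Suc m)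
      then show ?case using lin[OF Suc.hyps u[of m, unfolded W'_def, THEN CollectD, THEN conjunct1], of 1 "a m"]
        by simp
    qed
    \<comment> \<open>The part of \<open>f1\<close> missed by the old points, attached to the new
      point \<open>x0\<close>; what remains of \<open>f\<close>, namely
      \<open>f - f x0 * f1\<close>, is covered by the old points.\<close>
    define v where "v x = f1 x - (\<Sum>j<k. f1 (p j) * u j x)" for x
    have vW: "v \<in> W"
      using lin[OF f1(1) sum_mem[OF order_refl], of 1 "-1"] by (simp add: v_def[abs_def])
    let ?p = "\<lambda>j. if j < k then p j else x0" and ?u = "\<lambda>j. if j < k then u j else v"
    have "f x = (\<Sum>j<Suc k. f (?p j) * ?u j x)" if f: "f \<in> W" for f x
    proof -
      have "(\<lambda>x. 1 * f x + (- f x0) * f1 x) \<in> W'"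
        using lin[OF f f1(1), of 1 "- f x0"] f1 by (simp add: W'_def)
      from ip[OF this, of x] have "f x - f x0 * f1 x = (\<Sum>j<k. (f (p j) - f x0 * f1 (p j)) * u j x)"
        by simp
      then show ?thesis
        by (simp add: v_def algebra_simps sum_subtractf sum_distrib_left)
    qed
    moreover have "\<forall>j<Suc k. ?u j \<in> W" using u vW by (simp add: W'_def)
    ultimately show ?thesis by (intro exI[of _ "Suc k"] exI[of _ ?p] exI[of _ ?u]) blast
  qed
qed

lemma linear_map_sum:
  assumes M: "von_neumann_algebra M" and \<phi>: "linear_map M N \<phi>" and b: "\<And>s. s \<in> b \<Longrightarrow> e s \<in> M"
  shows "\<phi> (\<Sum>s\<in>b. op_scale (c s) (e s)) = (\<Sum>s\<in>b. op_scale (c s) (\<phi> (e s)))"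
proof -
  have zero: "\<phi> 0 = 0" using linear_mapD(3)[OF \<phi> vn_zero[OF M], of 0] by simp
  show ?thesis using b
  proof (induct b rule: infinite_finite_induct)
    case (insert s b)
    have "\<phi> (op_scale (c s) (e s) + (\<Sum>s\<in>b. op_scale (c s) (e s)))
        = op_scale (c s) (\<phi> (e s)) + \<phi> (\<Sum>s\<in>b. op_scale (c s) (e s))"
      using insert.prems by (subst linear_mapD(2)[OF \<phi>])
        (simp_all add: vn_scale[OF M] vn_sum[OF M] linear_mapD(3)[OF \<phi>])
    then show ?case using insert by simp
  qed (simp_all add: zero)
qed

lemma form_sum_scale: "form (\<Sum>s\<in>b. op_scale (c s) (e s)) x y = (\<Sum>s\<in>b. c s * form (e s) x y)"
  by (induct b rule: infinite_finite_induct) (simp_all add: blinfun_lin cinner_simps)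

lemma compose_sum_scale:
  assumes "z \<in> bounded_operators"
  shows "z o\<^sub>L (\<Sum>s\<in>b. op_scale (c s) (e s)) = (\<Sum>s\<in>b. op_scale (c s) (z o\<^sub>L e s))"
proof (induct b rule: infinite_finite_induct)
  case (insert s b)
  then show ?case by (simp add: blinfun_compose_add compose_op_scale[OF assms])
qed (auto intro!: blinfun_eqI)

lemma op_scale_add_left: "op_scale (c + d) x = op_scale c x + op_scale d x"
  by (rule blinfun_eqI) (simp add: blinfun_lin scaleC_add_left)

lemma op_scale_minus_left: "op_scale (- c) x = - op_scale c x"
  by (metis mult_minus1 op_scale_minus_one op_scale_scale)

text \<open>The order interval from \<open>- K \<Lambda>\<close> to \<open>K \<Lambda>\<close> for
  complete positivity: \<open>\<theta>\<close> lies in the order ideal generated by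
  \<open>\<Lambda>\<close>, and \<open>K\<close> bounds its order-unit norm.\<close>

definition dominated ::
  "('h::complex_hilbert_space \<Rightarrow>\<^sub>L 'h) set \<Rightarrow> ('k::complex_hilbert_space \<Rightarrow>\<^sub>L 'k) set \<Rightarrow> (('k::complex_hilbert_space \<Rightarrow>\<^sub>L 'k) \<Rightarrow> ('h::complex_hilbert_space \<Rightarrow>\<^sub>L 'h)) \<Rightarrow> (('k::complex_hilbert_space \<Rightarrow>\<^sub>L 'k) \<Rightarrow> ('h::complex_hilbert_space \<Rightarrow>\<^sub>L 'h)) \<Rightarrow> real \<Rightarrow> bool" where
  "dominated A B \<Lambda> \<theta> K \<longleftrightarrow>
     completely_positive B A (\<lambda>x. op_scale (of_real K) (\<Lambda> x) + \<theta> x) \<and>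
     completely_positive B A (\<lambda>x. op_scale (of_real K) (\<Lambda> x) - \<theta> x)"

definition cut ::
  "('h::complex_hilbert_space \<Rightarrow>\<^sub>L 'h) \<Rightarrow> ('k::complex_hilbert_space \<Rightarrow>\<^sub>L 'k) \<Rightarrow> (('k::complex_hilbert_space \<Rightarrow>\<^sub>L 'k) \<Rightarrow> ('h::complex_hilbert_space \<Rightarrow>\<^sub>L 'h)) \<Rightarrow> ('k::complex_hilbert_space \<Rightarrow>\<^sub>L 'k) \<Rightarrow> ('h::complex_hilbert_space \<Rightarrow>\<^sub>L 'h)" where
  "cut z w \<phi> x = z o\<^sub>L \<phi> (w o\<^sub>L x)"

definition scaled_cut ::
  "('k::complex_hilbert_space \<Rightarrow>\<^sub>L 'k) set \<Rightarrow> real \<Rightarrow> ('h::complex_hilbert_space \<Rightarrow>\<^sub>L 'h) \<Rightarrow> ('k::complex_hilbert_space \<Rightarrow>\<^sub>L 'k) \<Rightarrow> (('k::complex_hilbert_space \<Rightarrow>\<^sub>L 'k) \<Rightarrow> ('h::complex_hilbert_space \<Rightarrow>\<^sub>L 'h)) \<Rightarrow> ('k::complex_hilbert_space \<Rightarrow>\<^sub>L 'k) \<Rightarrow> ('h::complex_hilbert_space \<Rightarrow>\<^sub>L 'h)" where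
  "scaled_cut B r z w \<phi> = (\<lambda>x\<in>B. op_scale (of_real r) (cut z w \<phi> x))"

text \<open>A map as a real function on triples, the form to which
  \<open>finite_span_interpolation\<close> applies. Real parts determine an operator by
  \<open>Re_cinner_eqI_right\<close>, and real coefficients are those that domination tolerates;
  outside \<open>B\<close> a dummy value 0 is taken.\<close>

definition matrix_entry :: "('k::complex_hilbert_space \<Rightarrow>\<^sub>L 'k) set \<Rightarrow> (('k::complex_hilbert_space \<Rightarrow>\<^sub>L 'k) \<Rightarrow> ('h::complex_hilbert_space \<Rightarrow>\<^sub>L 'h)) \<Rightarrow> ('k::complex_hilbert_space \<Rightarrow>\<^sub>L 'k) \<times> 'h \<times> 'h \<Rightarrow> real" where
  "matrix_entry B \<theta> = (\<lambda>(x, u, v). if x \<in> B then Re (form (\<theta> x) u v) else 0)"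

context
  fixes A :: "('h::complex_hilbert_space \<Rightarrow>\<^sub>L 'h) set" and B :: "('k::complex_hilbert_space \<Rightarrow>\<^sub>L 'k) set"
  assumes A: "von_neumann_algebra A" and B: "von_neumann_algebra B"
begin

lemma dominated_add:
  assumes "dominated A B \<Lambda> \<theta> K" "dominated A B \<Lambda> \<eta> J"
  shows "dominated A B \<Lambda> (\<lambda>x. \<theta> x + \<eta> x) (K + J)"
proof -
  have 1: "completely_positive B A (\<lambda>x. (op_scale (of_real K) (\<Lambda> x) + \<theta> x) + (op_scale (of_real J) (\<Lambda> x) + \<eta> x))"
    "completely_positive B A (\<lambda>x. (op_scale (of_real K) (\<Lambda> x) - \<theta> x) + (op_scale (of_real J) (\<Lambda> x) - \<eta> x))"
    using assms completely_positive_add[OF A] unfolding dominated_def by blast+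
  then show ?thesis by (simp add: dominated_def op_scale_add_left algebra_simps)
qed

lemma dominated_scale:
  assumes "dominated A B \<Lambda> \<theta> K"
  shows "dominated A B \<Lambda> (\<lambda>x. op_scale (of_real a) (\<theta> x)) (\<bar>a\<bar> * K)"
proof -
  have 1: "completely_positive B A (\<lambda>x. op_scale (of_real \<bar>a\<bar>) (op_scale (of_real K) (\<Lambda> x) + \<theta> x))"
    "completely_positive B A (\<lambda>x. op_scale (of_real \<bar>a\<bar>) (op_scale (of_real K) (\<Lambda> x) - \<theta> x))"
    using assms completely_positive_scale[OF A _ abs_ge_zero] unfolding dominated_def by blast+
  show ?thesis
  proof (cases "a \<ge> 0")
    case True
    then show ?thesis using 1 by (simp add: dominated_def op_scale_add_right op_scale_diff_right op_scale_scale)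
  next
    case False
    then have "\<bar>a\<bar> = - a" by simp
    then show ?thesis using 1
      by (simp add: dominated_def op_scale_add_right op_scale_diff_right op_scale_scale op_scale_minus_left)
  qed
qed

lemma dominated_sum:
  assumes "\<And>j. j < (k::nat) \<Longrightarrow> dominated A B \<Lambda> (\<theta> j) (K j)"
  shows "dominated A B \<Lambda> (\<lambda>x. \<Sum>j<k. op_scale (of_real (a j)) (\<theta> j x)) (\<Sum>j<k. \<bar>a j\<bar> * K j)"
  using assms
proof (induct k)
  case 0
  show ?case using completely_positive_zero[OF A] by (simp add: dominated_def)
next
  case (Suc k)
  then show ?case using dominated_add[OF Suc.hyps dominated_scale[of \<Lambda> "\<theta> k" "K k" "a k"]] by simp
qed

lemma dominated_mono:
  assumes "dominated A B \<Lambda> \<theta> K" "completely_positive B A \<Lambda>" "K \<le> J"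
  shows "dominated A B \<Lambda> \<theta> J"
proof -
  have "completely_positive B A (\<lambda>x. op_scale (of_real (J - K)) (\<Lambda> x))"
    by (rule completely_positive_scale[OF A assms(2)]) (use assms(3) in simp)
  from completely_positive_add[OF A this] have
    "completely_positive B A (\<lambda>x. op_scale (of_real (J - K)) (\<Lambda> x) + (op_scale (of_real K) (\<Lambda> x) + \<theta> x))"
    "completely_positive B A (\<lambda>x. op_scale (of_real (J - K)) (\<Lambda> x) + (op_scale (of_real K) (\<Lambda> x) - \<theta> x))"
    using assms(1) unfolding dominated_def by blast+
  moreover have "op_scale (of_real (J - K)) y + (op_scale (of_real K) y + w) = op_scale (of_real J) y + w"
    "op_scale (of_real (J - K)) y + (op_scale (of_real K) y - w) = op_scale (of_real J) y - w" for y w :: "'h \<Rightarrow>\<^sub>L 'h"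
    using op_scale_add_left[of "of_real (J - K)" "of_real K" y] by (simp_all add: algebra_simps)
  ultimately show ?thesis unfolding dominated_def by (simp only:)
qed

lemma completely_positive_cut:
  assumes "central_projection A z" "central_projection B w" "completely_positive B A \<phi>"
  shows "completely_positive B A (cut z w \<phi>)"
  unfolding cut_def[abs_def]
  by (rule completely_positive_compose[OF completely_positive_compose[OF
        completely_positive_projection[OF B assms(2)] assms(3)] completely_positive_projection[OF A assms(1)]])

text \<open>Expanding \<open>w x\<close> gives scalars that depend on \<open>x\<close> alone, and
  expanding \<open>z \<theta>(s)\<close> for the finitely many generators \<open>s\<close> gives
  scalars that depend on \<open>\<theta>\<close> alone. So the \<open>h i\<close> can be chosen
  before \<open>\<theta>\<close>; the boolean index separates real and imaginary parts.\<close>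

lemma cut_finite_span:
  assumes z: "z \<in> A" "finite_corner A z" and w: "w \<in> B" "finite_corner B w"
  shows "\<exists>(I :: (('k \<Rightarrow>\<^sub>L 'k) \<times> ('h \<Rightarrow>\<^sub>L 'h) \<times> bool) set) h. finite I \<and>
    (\<forall>\<theta>. linear_map B A \<theta> \<longrightarrow> (\<exists>c. \<forall>p. matrix_entry B (cut z w \<theta>) p = (\<Sum>i\<in>I. c i * h i p)))"
proof -
  obtain b where b: "finite b" "b \<subseteq> B" "\<And>x. x \<in> B \<Longrightarrow> \<exists>c. w o\<^sub>L x = (\<Sum>s\<in>b. op_scale (c s) s)"
    using w(2) by (auto simp: finite_corner_def)
  obtain d where d: "finite d" "d \<subseteq> A" "\<And>x. x \<in> A \<Longrightarrow> \<exists>c. z o\<^sub>L x = (\<Sum>t\<in>d. op_scale (c t) t)"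
    using z(2) by (auto simp: finite_corner_def)
  obtain \<beta> where \<beta>: "\<And>x. x \<in> B \<Longrightarrow> w o\<^sub>L x = (\<Sum>s\<in>b. op_scale (\<beta> x s) s)" using b(3) by metis
  \<comment> \<open>The minus sign is that of the product of imaginary parts in the real part of a
    complex product.\<close>
  define h :: "('k \<Rightarrow>\<^sub>L 'k) \<times> ('h \<Rightarrow>\<^sub>L 'h) \<times> bool \<Rightarrow> ('k \<Rightarrow>\<^sub>L 'k) \<times> 'h \<times> 'h \<Rightarrow> real"
    where "h = (\<lambda>(s, t, re) (x, u, v). if x \<in> B then
      (if re then Re (\<beta> x s * form t u v) else - Im (\<beta> x s * form t u v)) else 0)"
  have "\<exists>c. \<forall>p. matrix_entry B (cut z w \<theta>) p = (\<Sum>i\<in>b \<times> d \<times> UNIV. c i * h i p)"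
    if \<theta>: "linear_map B A \<theta>" for \<theta>
  proof -
    have "\<forall>s\<in>b. \<exists>c. z o\<^sub>L \<theta> s = (\<Sum>t\<in>d. op_scale (c t) t)"
      using d(3) linear_mapD(1)[OF \<theta>] b(2) by blast
    then obtain \<gamma> where \<gamma>: "\<And>s. s \<in> b \<Longrightarrow> z o\<^sub>L \<theta> s = (\<Sum>t\<in>d. op_scale (\<gamma> s t) t)" by metis
    define c where "c = (\<lambda>(s, t, re). if re then Re (\<gamma> s t) else Im (\<gamma> s t))"
    have "matrix_entry B (cut z w \<theta>) (x, u, v) = (\<Sum>i\<in>b \<times> d \<times> UNIV. c i * h i (x, u, v))" for x u v
    proof (cases "x \<in> B")
      case x: True
      have "cut z w \<theta> x = (\<Sum>s\<in>b. op_scale (\<beta> x s) (z o\<^sub>L \<theta> s))"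
      proof -
        have "\<theta> (\<Sum>s\<in>b. op_scale (\<beta> x s) s) = (\<Sum>s\<in>b. op_scale (\<beta> x s) (\<theta> s))"
          by (rule linear_map_sum[OF B \<theta>]) (use b(2) in blast)
        then show ?thesis
          by (simp only: cut_def \<beta>[OF x] compose_sum_scale[OF von_neumann_algebra_bounded[OF A z(1)]])
      qed
      then have "form (cut z w \<theta> x) u v = (\<Sum>s\<in>b. \<beta> x s * form (z o\<^sub>L \<theta> s) u v)"
        by (simp only: form_sum_scale)
      also have "\<dots> = (\<Sum>s\<in>b. \<Sum>t\<in>d. \<gamma> s t * (\<beta> x s * form t u v))"
        by (intro sum.cong refl) (simp add: \<gamma> form_sum_scale sum_distrib_left mult_ac)
      finally have "Re (form (cut z w \<theta> x) u v) = (\<Sum>s\<in>b. \<Sum>t\<in>d. Re (\<gamma> s t * (\<beta> x s * form t u v)))"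
        by simp
      also have "\<dots> = (\<Sum>s\<in>b. \<Sum>t\<in>d. \<Sum>re\<in>UNIV. c (s, t, re) * h (s, t, re) (x, u, v))"
        using x by (intro sum.cong refl) (simp add: UNIV_bool c_def h_def algebra_simps)
      also have "\<dots> = (\<Sum>i\<in>b \<times> d \<times> UNIV. c i * h i (x, u, v))"
        by (simp only: sum.cartesian_product) (simp add: split_beta)
      finally show ?thesis using x by (simp add: matrix_entry_def)
    qed (simp add: matrix_entry_def h_def split_beta)
    then show ?thesis by auto
  qed
  then show ?thesis using b(1) d(1) by (intro exI[of _ "b \<times> d \<times> UNIV"] exI[of _ h]) simp
qed

lemma cut_add_scale:
  assumes "z \<in> bounded_operators"
  shows "cut z w (\<lambda>x. op_scale a (\<theta> x) + op_scale b (\<eta> x)) x = op_scale a (cut z w \<theta> x) + op_scale b (cut z w \<eta> x)"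
  by (simp add: cut_def blinfun_compose_add compose_op_scale[OF assms])

lemma cut_diff: "cut z w (\<lambda>x. \<theta> x - \<eta> x) x = cut z w \<theta> x - cut z w \<eta> x"
  by (simp add: cut_def blinfun_compose_diff)

text \<open>Extracts from pointwise weak convergence an inequality in the completely positive order
  at a single \<open>s\<close>. Comparison with only \<open>r\<close> times the cut leaves the
  margin into which the small difference has to fit.\<close>

lemma cut_below_lub:
  assumes z: "central_projection A z" "finite_corner A z" and w: "central_projection B w" "finite_corner B w"
    and S: "directed_in (Q_hom A B) S" and lub: "is_lub (Q_hom A B) \<Phi> S" and r: "r < 1"
  shows "\<exists>s\<in>S. completely_positive B A (\<lambda>x. cut z w s x - op_scale (of_real r) (cut z w \<Phi> x))"
proof -
  have zA: "z \<in> A" and wB: "w \<in> B" using z w by (auto simp: central_projection_def)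
  note zb = von_neumann_algebra_bounded[OF A zA]
  let ?Q = "Q_hom A B" and ?\<Lambda> = "cut z w \<Phi>" and ?e = "matrix_entry B"
  let ?F = "tail_filter ?Q S"
  note Q = partial_order_Q_hom[OF A B]
  note lim = Q_hom_lub_wtends[OF A B S lub]
  have "\<Phi> \<in> ncpsu_maps B A" using lub by (simp add: least_def Upper_def Q_hom_def)
  note \<Phi> = ncpsuD[OF this]
  have cp\<Lambda>: "completely_positive B A ?\<Lambda>" by (rule completely_positive_cut[OF z(1) w(1) \<Phi>(3)])
  define W where "W = {?e (cut z w \<theta>) | \<theta>. linear_map B A \<theta> \<and> (\<exists>K. dominated A B ?\<Lambda> (cut z w \<theta>) K)}"
  have W_lin: "(\<lambda>p. a * f p + b * g p) \<in> W" if f: "f \<in> W" and g: "g \<in> W" for f g a b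
  proof -
    obtain \<theta> K where \<theta>: "f = ?e (cut z w \<theta>)" "linear_map B A \<theta>" "dominated A B ?\<Lambda> (cut z w \<theta>) K"
      using f by (auto simp: W_def)
    obtain \<eta> J where \<eta>: "g = ?e (cut z w \<eta>)" "linear_map B A \<eta>" "dominated A B ?\<Lambda> (cut z w \<eta>) J"
      using g by (auto simp: W_def)
    let ?\<theta> = "\<lambda>x. op_scale (of_real a) (\<theta> x) + op_scale (of_real b) (\<eta> x)"
    have "linear_map B A ?\<theta>"
      using linear_mapD[OF \<theta>(2)] linear_mapD[OF \<eta>(2)]
      by (simp add: linear_map_def vn_add[OF A] vn_scale[OF A] op_scale_add_right op_scale_scale mult.commute)
    moreover have "\<exists>K. dominated A B ?\<Lambda> (cut z w ?\<theta>) K"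
      unfolding cut_add_scale[OF zb, abs_def]
      using dominated_add[OF dominated_scale[OF \<theta>(3)] dominated_scale[OF \<eta>(3)]] by blast
    moreover have "(\<lambda>p. a * f p + b * g p) = ?e (cut z w ?\<theta>)"
      unfolding cut_add_scale[OF zb, abs_def]
      by (auto simp: fun_eq_iff \<theta>(1) \<eta>(1) matrix_entry_def blinfun_lin cinner_simps)
    ultimately show ?thesis unfolding W_def by blast
  qed
  obtain I :: "(('k \<Rightarrow>\<^sub>L 'k) \<times> ('h \<Rightarrow>\<^sub>L 'h) \<times> bool) set" and h where "finite I"
    "\<And>\<theta>. linear_map B A \<theta> \<Longrightarrow> \<exists>c. \<forall>p. ?e (cut z w \<theta>) p = (\<Sum>i\<in>I. c i * h i p)"
    using cut_finite_span[OF zA z(2) wB w(2)] by metis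
  then have "\<exists>k p u. (\<forall>j<k. u j \<in> W) \<and> (\<forall>f\<in>W. \<forall>x. f x = (\<Sum>j<(k::nat). f (p j) * u j x))"
    by (intro finite_span_interpolation[of I W h] W_lin) (auto simp: W_def)
  then obtain k p u where uW: "\<And>j. j < k \<Longrightarrow> u j \<in> W"
    and ip: "\<And>f x. f \<in> W \<Longrightarrow> f x = (\<Sum>j<(k::nat). f (p j) * u j x)" by blast
  have "\<forall>j. \<exists>\<theta> K. j < k \<longrightarrow> u j = ?e (cut z w \<theta>) \<and> dominated A B ?\<Lambda> (cut z w \<theta>) K"
    using uW unfolding W_def by blast
  then obtain \<theta> K where u: "\<And>j. j < k \<Longrightarrow> u j = ?e (cut z w (\<theta> j))"
    and dom: "\<And>j. j < k \<Longrightarrow> dominated A B ?\<Lambda> (cut z w (\<theta> j)) (K j)" by metis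
  define \<delta> where "\<delta> s = cut z w (\<lambda>x. \<Phi> x - s x)" for s
  define a where "a s j = ?e (\<delta> s) (p j)" for s j
  have \<delta>: "\<delta> s x = ?\<Lambda> x - cut z w s x" for s x by (simp add: \<delta>_def cut_diff)
  have expand: "\<delta> s x = (\<Sum>j<k. op_scale (of_real (a s j)) (cut z w (\<theta> j) x))"
    if s: "s \<in> S" and x: "x \<in> B" for s x
  proof -
    note s' = ncpsuD[OF Q_hom_directed_ncpsu[OF A B S s]]
    have cp: "completely_positive B A (\<lambda>x. \<Phi> x - s x)"
      by (rule Q_hom_limit_upper[OF A B S lim s])
    \<comment> \<open>Membership of the difference in the ideal, with bound 1: it is positive, and
      \<open>\<Lambda>\<close> minus it is the cut of \<open>s\<close>.\<close>
    have "completely_positive B A (\<lambda>x. ?\<Lambda> x + \<delta> s x)"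
      unfolding \<delta>_def by (rule completely_positive_add[OF A cp\<Lambda> completely_positive_cut[OF z(1) w(1) cp]])
    moreover have "completely_positive B A (\<lambda>x. ?\<Lambda> x - \<delta> s x)"
      unfolding \<delta> using completely_positive_cut[OF z(1) w(1) s'(3)] by simp
    ultimately have "dominated A B ?\<Lambda> (\<delta> s) 1" by (simp add: dominated_def)
    then have "?e (\<delta> s) \<in> W"
      unfolding W_def \<delta>_def using completely_positive_linear[OF cp] by blast
    then have ex: "?e (\<delta> s) q = (\<Sum>j<k. a s j * ?e (cut z w (\<theta> j)) q)" for q
      unfolding a_def by (subst ip) (simp_all add: u)
    show ?thesis
    proof (rule blinfun_eqI, rule Re_cinner_eqI_right)
      fix v v'
      have "Re (form (\<delta> s x) v' v) = (\<Sum>j<k. a s j * Re (form (cut z w (\<theta> j) x) v' v))"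
        using ex[of "(x, v', v)"] x by (simp add: matrix_entry_def)
      then show "Re (form (\<delta> s x) v' v) = Re (form (\<Sum>j<k. op_scale (of_real (a s j)) (cut z w (\<theta> j) x)) v' v)"
        by (simp add: form_sum_scale)
    qed
  qed
  have a0: "((\<lambda>s. a s j) \<longlongrightarrow> 0) ?F" for j
  proof -
    obtain x v v' where p: "p j = (x, v, v')" by (metis prod_cases3)
    show ?thesis
    proof (cases "x \<in> B")
      case True
      have "wtends (\<lambda>s. \<delta> s x) (z o\<^sub>L (\<Phi> (w o\<^sub>L x) - \<Phi> (w o\<^sub>L x))) ?F"
        unfolding \<delta>_def cut_def
        by (intro wtends_compose_left zb wtends_diff wtends_const lim vn_compose B wB True)
      then have "((\<lambda>s. form (\<delta> s x) v v') \<longlongrightarrow> 0) ?F"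
        using wtendsD[of _ "z o\<^sub>L (\<Phi> (w o\<^sub>L x) - \<Phi> (w o\<^sub>L x))" ?F v v'] by simp
      from tendsto_Re[OF this] show ?thesis using True by (simp add: a_def p matrix_entry_def)
    qed (simp add: a_def p matrix_entry_def)
  qed
  \<comment> \<open>By \<open>dominated_sum\<close> this number is a bound for
    \<open>\<delta> s\<close>; the \<open>K j\<close> do not depend on \<open>s\<close>, so it tends
    to 0 with the coefficients.\<close>
  have "((\<lambda>s. \<Sum>j<k. \<bar>a s j\<bar> * K j) \<longlongrightarrow> (\<Sum>j<k. \<bar>0\<bar> * K j)) ?F"
    by (intro tendsto_sum tendsto_mult tendsto_rabs a0 tendsto_const)
  then have "eventually (\<lambda>s. (\<Sum>j<k. \<bar>a s j\<bar> * K j) < 1 - r) ?F"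
    by (rule order_tendstoD(2)) (use r in simp)
  then have "eventually (\<lambda>s. s \<in> S \<and> (\<Sum>j<k. \<bar>a s j\<bar> * K j) < 1 - r) ?F"
    using eventually_tail_filter_mem[OF Q S] by eventually_elim simp
  then obtain s where s: "s \<in> S" "(\<Sum>j<k. \<bar>a s j\<bar> * K j) < 1 - r"
    using eventually_happens'[OF tail_filter_not_bot[OF Q S]] by blast
  have "dominated A B ?\<Lambda> (\<lambda>x. \<Sum>j<k. op_scale (of_real (a s j)) (cut z w (\<theta> j) x)) (1 - r)"
    by (rule dominated_mono[OF dominated_sum[OF dom] cp\<Lambda>]) (use s in simp_all)
  then have "completely_positive B A (\<lambda>x. op_scale (of_real (1 - r)) (?\<Lambda> x)
      - (\<Sum>j<k. op_scale (of_real (a s j)) (cut z w (\<theta> j) x)))"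
    by (simp only: dominated_def)
  then have "completely_positive B A (\<lambda>x. cut z w s x - op_scale (of_real r) (?\<Lambda> x))"
  proof (rule completely_positive_cong[OF _ B])
    fix x assume x: "x \<in> B"
    have "op_scale (of_real (1 - r)) (?\<Lambda> x) = ?\<Lambda> x - op_scale (of_real r) (?\<Lambda> x)"
      by (rule blinfun_eqI_form) (simp add: blinfun_lin cinner_simps algebra_simps)
    then show "op_scale (of_real (1 - r)) (?\<Lambda> x) - (\<Sum>j<k. op_scale (of_real (a s j)) (cut z w (\<theta> j) x))
        = cut z w s x - op_scale (of_real r) (?\<Lambda> x)"
      unfolding expand[OF s(1) x, symmetric] \<delta> by simp
  qed
  then show ?thesis using s(1) by blast
qed

text \<open>What the cut loses is the part of the value outside \<open>z\<close> and, inside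
  \<open>z\<close>, the contribution of the part of the argument outside \<open>w\<close>; both are
  composites of \<open>\<phi>\<close> with compressions.\<close>

lemma cut_le:
  assumes z: "central_projection A z" and w: "central_projection B w" and \<phi>: "completely_positive B A \<phi>"
  shows "completely_positive B A (\<lambda>x. \<phi> x - cut z w \<phi> x)"
proof (rule completely_positive_cong[OF _ B])
  note zc = central_projection_complement[OF A z] and wc = central_projection_complement[OF B w]
  show "completely_positive B A (\<lambda>x. ((id_blinfun - z) o\<^sub>L \<phi> x) + (z o\<^sub>L \<phi> ((id_blinfun - w) o\<^sub>L x)))"
    by (rule completely_positive_add[OF A
        completely_positive_compose[OF \<phi> completely_positive_projection[OF A zc]]
        completely_positive_compose[OF completely_positive_compose[OF completely_positive_projection[OF B wc] \<phi>]
          completely_positive_projection[OF A z]]])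
  fix x assume x: "x \<in> B"
  have "w o\<^sub>L x \<in> B" using w x by (intro vn_compose B) (simp add: central_projection_def)
  moreover have "(id_blinfun - w) o\<^sub>L x = x - (w o\<^sub>L x)" by (rule blinfun_eqI) (simp add: blinfun_lin)
  ultimately show "((id_blinfun - z) o\<^sub>L \<phi> x) + (z o\<^sub>L \<phi> ((id_blinfun - w) o\<^sub>L x)) = \<phi> x - cut z w \<phi> x"
    using linear_map_diff[OF B completely_positive_linear[OF \<phi>] x]
    by (intro blinfun_eqI) (simp add: cut_def blinfun_lin)
qed

text \<open>Normality and subunitality are inherited by writing the map as a composite with two
  instances of \<open>ncpsu_projection\<close>; the scalar \<open>of_real 1\<close> makes the inner
  one match.\<close>

lemma scaled_cut_ncpsu:
  assumes z: "central_projection A z" and w: "central_projection B w" and \<phi>: "\<phi> \<in> ncpsu_maps B A"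
    and r: "0 \<le> r" "r \<le> 1"
  shows "scaled_cut B r z w \<phi> \<in> ncpsu_maps B A"
proof -
  have wB: "w \<in> B" using w by (simp add: central_projection_def)
  have "compose B (\<lambda>y\<in>A. op_scale (of_real r) (z o\<^sub>L y)) (compose B \<phi> (\<lambda>x\<in>B. op_scale (of_real 1) (w o\<^sub>L x)))
      \<in> ncpsu_maps B A"
    by (rule ncpsu_compose[OF B A A ncpsu_compose[OF B B A ncpsu_projection[OF B w] \<phi>] ncpsu_projection[OF A z r]]) simp_all
  also have "compose B (\<lambda>y\<in>A. op_scale (of_real r) (z o\<^sub>L y)) (compose B \<phi> (\<lambda>x\<in>B. op_scale (of_real 1) (w o\<^sub>L x)))
      = scaled_cut B r z w \<phi>"
    using completely_positive_mem[OF ncpsuD(3)[OF \<phi>]] vn_compose[OF B wB]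
    by (auto simp: scaled_cut_def compose_def cut_def fun_eq_iff)
  finally show ?thesis .
qed

text \<open>The chain is \<open>r cut \<phi> \<le> r cut \<Phi> \<le> cut s \<le> s\<close>: first
  from \<open>\<phi> \<le> \<Phi>\<close>, then \<open>cut_below_lub\<close>, then
  \<open>cut_le\<close>.\<close>

lemma way_below_scaled_cut:
  assumes z: "central_projection A z" "finite_corner A z" and w: "central_projection B w" "finite_corner B w"
    and \<phi>: "\<phi> \<in> ncpsu_maps B A" and r: "0 \<le> r" "r < 1"
  shows "way_below (Q_hom A B) (scaled_cut B r z w \<phi>) \<phi>"
  unfolding way_below_def
proof (intro conjI allI impI)
  show "scaled_cut B r z w \<phi> \<in> carrier (Q_hom A B)" "\<phi> \<in> carrier (Q_hom A B)"
    using scaled_cut_ncpsu[OF z(1) w(1) \<phi> r(1)] r(2) \<phi> by (simp_all add: Q_hom_carrier[OF A B])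
  fix S \<Phi> assume S: "directed_in (Q_hom A B) S" and lub: "is_lub (Q_hom A B) \<Phi> S"
    and le: "\<phi> \<sqsubseteq>\<^bsub>Q_hom A B\<^esub> \<Phi>"
  obtain s where s: "s \<in> S"
    and below: "completely_positive B A (\<lambda>x. cut z w s x - op_scale (of_real r) (cut z w \<Phi> x))"
    using cut_below_lub[OF z w S lub r(2)] by blast
  have "completely_positive B A (\<lambda>x. op_scale (of_real r) (cut z w (\<lambda>x. \<Phi> x - \<phi> x) x))"
    using le completely_positive_scale[OF A completely_positive_cut[OF z(1) w(1)] r(1)]
    unfolding Q_hom_le[OF A B] by blast
  then have "completely_positive B A (\<lambda>x. op_scale (of_real r) (cut z w \<Phi> x) - op_scale (of_real r) (cut z w \<phi> x))"
    by (simp only: cut_diff op_scale_diff_right)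
  from completely_positive_diff_trans[OF A this below]
  have "completely_positive B A (\<lambda>x. s x - op_scale (of_real r) (cut z w \<phi> x))"
    by (rule completely_positive_diff_trans[OF A _ cut_le[OF z(1) w(1) ncpsuD(3)[OF Q_hom_directed_ncpsu[OF A B S s]]]])
  then have "completely_positive B A (\<lambda>x. s x - scaled_cut B r z w \<phi> x)"
    by (rule completely_positive_cong[OF _ B]) (simp add: scaled_cut_def)
  then show "\<exists>s\<in>S. scaled_cut B r z w \<phi> \<sqsubseteq>\<^bsub>Q_hom A B\<^esub> s"
    using s by (auto simp: Q_hom_le[OF A B])
qed

end

section \<open>Continuity of the homsets\<close>

text \<open>Such a \<open>D\<close> is cofinal among the elements way below \<open>y\<close>:
  applying \<open>way_below\<close> to \<open>D\<close> itself puts each of them under a member of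
  \<open>D\<close>. Directedness and the supremum transfer along this.\<close>

lemma continuous_dcpoI:
  assumes L: "dcpo L"
    and D: "\<And>y. y \<in> carrier L \<Longrightarrow> \<exists>D. directed_in L D \<and> is_lub L y D \<and> (\<forall>x\<in>D. way_below L x y)"
  shows "continuous_dcpo L"
  unfolding continuous_dcpo_def
proof (intro conjI ballI L)
  interpret partial_order L using L by (simp add: dcpo_def)
  fix y assume y: "y \<in> carrier L"
  obtain D where D: "directed_in L D" "is_lub L y D" "\<And>x. x \<in> D \<Longrightarrow> way_below L x y"
    using D[OF y] by blast
  let ?W = "{x. way_below L x y}"
  have carr: "D \<subseteq> carrier L" "?W \<subseteq> carrier L" using D(1) by (auto simp: directed_in_def way_below_def)
  have D_le: "d \<sqsubseteq>\<^bsub>L\<^esub> y" if "d \<in> D" for d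
    using D(2) that carr by (auto simp: least_def Upper_def)
  have below: "\<exists>d\<in>D. x \<sqsubseteq>\<^bsub>L\<^esub> d" if "way_below L x y" for x
    using that D(1,2) le_refl[OF y] unfolding way_below_def by blast
  show "directed_in L ?W"
    unfolding directed_in_def
  proof (intro conjI ballI)
    show "?W \<noteq> {}" using D(1,3) by (auto simp: directed_in_def)
    fix a b assume ab: "a \<in> ?W" "b \<in> ?W"
    then obtain c d where cd: "c \<in> D" "a \<sqsubseteq>\<^bsub>L\<^esub> c" "d \<in> D" "b \<sqsubseteq>\<^bsub>L\<^esub> d" using below by blast
    then obtain e where e: "e \<in> D" "c \<sqsubseteq>\<^bsub>L\<^esub> e" "d \<sqsubseteq>\<^bsub>L\<^esub> e" using D(1) unfolding directed_in_def by blast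
    have mem: "a \<in> carrier L" "b \<in> carrier L" "c \<in> carrier L" "d \<in> carrier L" "e \<in> carrier L"
      using ab cd e carr by auto
    have "a \<sqsubseteq>\<^bsub>L\<^esub> e" "b \<sqsubseteq>\<^bsub>L\<^esub> e"
      using le_trans[OF cd(2) e(2)] le_trans[OF cd(4) e(3)] mem by simp_all
    then show "\<exists>z\<in>?W. a \<sqsubseteq>\<^bsub>L\<^esub> z \<and> b \<sqsubseteq>\<^bsub>L\<^esub> z" using D(3)[OF e(1)] by blast
  qed (rule carr)
  show "is_lub L y ?W"
  proof (rule least_UpperI)
    fix x assume "x \<in> ?W"
    then obtain d where d: "d \<in> D" "x \<sqsubseteq>\<^bsub>L\<^esub> d" using below by blast
    show "x \<sqsubseteq>\<^bsub>L\<^esub> y"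
      using le_trans[OF d(2) D_le[OF d(1)]] d(1) carr \<open>x \<in> ?W\<close> y by blast
  next
    fix u assume "u \<in> Upper L ?W"
    then have "u \<in> Upper L D" using D(3) carr by (auto simp: Upper_def)
    then show "y \<sqsubseteq>\<^bsub>L\<^esub> u" using D(2) by (simp add: least_def)
  qed (use carr y in auto)
qed

text \<open>Monotone nets give convergence at positive arguments only; linearity of the maps does
  the rest.\<close>

lemma wtends_extend:
  assumes M: "von_neumann_algebra M" and x: "x \<in> M"
    and pos: "\<And>p. p \<in> M \<Longrightarrow> op_positive p \<Longrightarrow> wtends (\<lambda>i. \<theta> i p) (\<omega> p) F"
    and \<theta>: "eventually (\<lambda>i. linear_map M N (\<theta> i)) F" and \<omega>: "linear_map M N \<omega>"
  shows "wtends (\<lambda>i. \<theta> i x) (\<omega> x) F"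
  using x
proof (induct rule: vn_positive_span[OF M, consumes 1, case_names positive add scale])
  case (positive p)
  then show ?case by (rule pos)
next
  case (add x y)
  from wtends_add[OF add(3,4)] have "wtends (\<lambda>i. \<theta> i (x + y)) (\<omega> x + \<omega> y) F"
    by (rule wtends_cong[rotated]) (rule eventually_mono[OF \<theta>], simp add: linear_mapD(2) add)
  then show ?case by (simp add: linear_mapD(2)[OF \<omega>] add)
next
  case (scale c x)
  from wtends_op_scale[OF scale(2)] have "wtends (\<lambda>i. \<theta> i (op_scale c x)) (op_scale c (\<omega> x)) F"
    by (rule wtends_cong[rotated]) (rule eventually_mono[OF \<theta>], simp add: linear_mapD(3) scale)
  then show ?case by (simp add: linear_mapD(3)[OF \<omega>] scale)
qed

lemma linear_map_compose:
  "linear_map M N \<phi> \<Longrightarrow> linear_map N P \<psi> \<Longrightarrow> linear_map M P (\<lambda>x. \<psi> (\<phi> x))"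
  by (auto simp: linear_map_def Pi_iff)

context
  fixes A :: "('h::complex_hilbert_space \<Rightarrow>\<^sub>L 'h) set" and B :: "('k::complex_hilbert_space \<Rightarrow>\<^sub>L 'k) set"
  assumes A: "von_neumann_algebra A" and B: "von_neumann_algebra B"
begin

text \<open>For positive \<open>p\<close> the net \<open>w p\<close> increases weakly to
  \<open>p\<close>, so normality of \<open>\<phi>\<close> applies. For general \<open>x\<close> the
  net has no monotonicity, hence the passage through positive elements.\<close>

lemma ncpsu_exhaustion_wtends:
  assumes Z: "exhausting_projections B Z" and \<phi>: "\<phi> \<in> ncpsu_maps B A" and x: "x \<in> B"
  shows "wtends (\<lambda>w. \<phi> (w o\<^sub>L x)) (\<phi> x) (tail_filter (loewner_order B) Z)"
proof (rule wtends_extend[OF B x _ _ ncpsuD(5)[OF \<phi>]])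
  let ?L = "loewner_order B"
  have dir: "directed_in ?L Z" and cent: "\<And>z. z \<in> Z \<Longrightarrow> central_projection B z"
    and lim: "wtends (\<lambda>z. z) id_blinfun (tail_filter ?L Z)"
    using Z by (auto simp: exhausting_projections_def)
  note Lp = partial_order_loewner[OF von_neumann_algebra_subset[OF B]]
  show "eventually (\<lambda>w. linear_map B A (\<lambda>x. \<phi> (w o\<^sub>L x))) (tail_filter ?L Z)"
    by (rule eventually_mono[OF eventually_tail_filter_mem[OF Lp dir]])
      (rule linear_map_compose[OF completely_positive_linear[OF completely_positive_projection[OF B cent]] ncpsuD(5)[OF \<phi>]])
  fix p assume p: "p \<in> B" "op_positive p"
  have p_sa: "p \<in> carrier ?L" using vn_positive_self_adjoint[OF B p] p by (simp add: loewner_carrier_iff)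
  have "mono_net ?L Z B (\<lambda>w. w o\<^sub>L p)"
    unfolding mono_net_def
  proof (intro conjI ballI impI Lp dir)
    fix z assume z: "z \<in> Z"
    show "z o\<^sub>L p \<in> carrier ?L"
      by (rule completely_positive_self_adjoint[OF B B completely_positive_projection[OF B cent[OF z]] p_sa])
    fix w assume w: "w \<in> Z" and le: "z \<sqsubseteq>\<^bsub>?L\<^esub> w"
    have "w o\<^sub>L z = z"
      using central_projection_le[OF B cent[OF z] cent[OF w]] le by (simp add: loewner_le_iff)
    then show "op_positive ((w o\<^sub>L p) - (z o\<^sub>L p))"
      by (rule completely_positive_positive[OF central_projection_diff_positive[OF B cent[OF z] cent[OF w]] p])
  qed
  moreover have "wtends (\<lambda>w. w o\<^sub>L p) p (tail_filter ?L Z)"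
    using wtends_compose_right[OF lim, of p] by (simp add: wtends_def)
  ultimately show "wtends (\<lambda>w. \<phi> (w o\<^sub>L p)) (\<phi> p) (tail_filter ?L Z)"
    by (rule ncpsu_wtends[OF B A \<phi>])
qed

lemma exhausting_projections_directed:
  assumes M: "von_neumann_algebra M" and Z: "exhausting_projections M Z" and z: "z \<in> Z" "w \<in> Z"
  shows "\<exists>y\<in>Z. y o\<^sub>L z = z \<and> y o\<^sub>L w = w"
proof -
  have cent: "\<And>z. z \<in> Z \<Longrightarrow> central_projection M z" using Z by (auto simp: exhausting_projections_def)
  obtain y where y: "y \<in> Z" "op_positive (y - z)" "op_positive (y - w)"
    using Z z unfolding exhausting_projections_def directed_in_def loewner_le_iff by blast
  then show ?thesis using central_projection_le[OF M] cent z by blast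
qed

lemma scaled_cut_mono:
  assumes z: "central_projection A z" "central_projection A z'" "z' o\<^sub>L z = z"
    and w: "central_projection B w" "central_projection B w'" "w' o\<^sub>L w = w"
    and \<phi>: "\<phi> \<in> ncpsu_maps B A" and r: "0 \<le> r" "r \<le> r'"
  shows "completely_positive B A (\<lambda>x. scaled_cut B r' z' w' \<phi> x - scaled_cut B r z w \<phi> x)"
proof (rule completely_positive_cong[OF _ B])
  note cp = ncpsuD(3)[OF \<phi>]
  \<comment> \<open>First \<open>z\<close> changes at fixed \<open>w'\<close>, then \<open>w\<close>
    at fixed \<open>z\<close>; the change of scalar is accounted for by the later term with
    \<open>r' - r\<close>.\<close>
  let ?d = "\<lambda>x. ((z' o\<^sub>L \<phi> (w' o\<^sub>L x)) - (z o\<^sub>L \<phi> (w' o\<^sub>L x))) + (z o\<^sub>L \<phi> ((w' o\<^sub>L x) - (w o\<^sub>L x)))"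
  have d: "completely_positive B A ?d"
    by (rule completely_positive_add[OF A completely_positive_compose[OF completely_positive_compose[OF
          completely_positive_projection[OF B w(2)] cp] central_projection_diff_positive[OF A z]]
        completely_positive_compose[OF completely_positive_compose[OF
          central_projection_diff_positive[OF B w] cp] completely_positive_projection[OF A z(1)]]])
  have 1: "completely_positive B A (\<lambda>x. op_scale (of_real r') (?d x))"
    by (rule completely_positive_scale[OF A d]) (use r in simp)
  have 2: "completely_positive B A (\<lambda>x. op_scale (of_real (r' - r)) (cut z w \<phi> x))"
    by (rule completely_positive_scale[OF A completely_positive_cut[OF A B z(1) w(1) cp]]) (use r in simp)
  show "completely_positive B A (\<lambda>x. op_scale (of_real r') (?d x) + op_scale (of_real (r' - r)) (cut z w \<phi> x))"
    by (rule completely_positive_add[OF A 1 2])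
  fix x assume x: "x \<in> B"
  have mem: "w o\<^sub>L x \<in> B" "w' o\<^sub>L x \<in> B"
    using w x vn_compose[OF B] unfolding central_projection_def by blast+
  show "op_scale (of_real r') (?d x) + op_scale (of_real (r' - r)) (cut z w \<phi> x)
      = scaled_cut B r' z' w' \<phi> x - scaled_cut B r z w \<phi> x"
    using x by (intro blinfun_eqI_form) (simp add: scaled_cut_def cut_def linear_map_diff[OF B ncpsuD(5)[OF \<phi>] mem(2,1)]
        blinfun_lin cinner_simps algebra_simps)
qed

text \<open>The parameters go to their limits one at a time: \<open>r\<close> to 1, then
  \<open>w\<close>, then \<open>z\<close>, with \<open>completely_positive_limit\<close> keeping the
  inequality. The limit in \<open>w\<close> acts inside \<open>\<phi>\<close> and is where its
  normality is used.\<close>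

lemma scaled_cut_lub:
  assumes ZA: "exhausting_projections A ZA" and ZB: "exhausting_projections B ZB"
    and \<phi>: "\<phi> \<in> ncpsu_maps B A" and \<psi>: "linear_map B A \<psi>"
    and ub: "\<And>r z w. 0 \<le> r \<Longrightarrow> r < 1 \<Longrightarrow> z \<in> ZA \<Longrightarrow> w \<in> ZB \<Longrightarrow>
      completely_positive B A (\<lambda>x. \<psi> x - scaled_cut B r z w \<phi> x)"
  shows "completely_positive B A (\<lambda>x. \<psi> x - \<phi> x)"
proof -
  let ?FA = "tail_filter (loewner_order A) ZA" and ?FB = "tail_filter (loewner_order B) ZB"
  have dA: "directed_in (loewner_order A) ZA" and limA: "wtends (\<lambda>z. z) id_blinfun ?FA"
    and cA: "\<And>z. z \<in> ZA \<Longrightarrow> z \<in> bounded_operators"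
    using ZA von_neumann_algebra_bounded[OF A] by (auto simp: exhausting_projections_def central_projection_def)
  have dB: "directed_in (loewner_order B) ZB" using ZB by (simp add: exhausting_projections_def)
  note pA = partial_order_loewner[OF von_neumann_algebra_subset[OF A]]
    and pB = partial_order_loewner[OF von_neumann_algebra_subset[OF B]]
  have 1: "completely_positive B A (\<lambda>x. \<psi> x - cut z w \<phi> x)" if zw: "z \<in> ZA" "w \<in> ZB" for z w
  proof (rule completely_positive_limit[where F = "at_left (1::real)", OF _ B A])
    have "eventually (\<lambda>r. r \<in> {0<..<1}) (at_left (1::real))"
      by (rule eventually_at_leftI[of 0]) auto
    then show "eventually (\<lambda>r. completely_positive B A (\<lambda>x. \<psi> x - scaled_cut B r z w \<phi> x)) (at_left (1::real))"
      by (rule eventually_mono) (rule ub, auto simp: zw)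
    fix x assume x: "x \<in> B"
    have "wtends (\<lambda>r. op_scale (of_real r) (cut z w \<phi> x)) (op_scale (of_real 1) (cut z w \<phi> x)) (at_left 1)"
      unfolding wtends_def op_scale_apply cinner_scaleC_right by (intro allI tendsto_intros)
    then show "wtends (\<lambda>r. \<psi> x - scaled_cut B r z w \<phi> x) (\<psi> x - cut z w \<phi> x) (at_left 1)"
      using x by (intro wtends_diff wtends_const) (simp add: scaled_cut_def)
  qed simp
  have 2: "completely_positive B A (\<lambda>x. \<psi> x - (z o\<^sub>L \<phi> x))" if z: "z \<in> ZA" for z
  proof (rule completely_positive_limit[OF tail_filter_not_bot[OF pB dB] B A])
    show "eventually (\<lambda>w. completely_positive B A (\<lambda>x. \<psi> x - cut z w \<phi> x)) ?FB"
      by (rule eventually_mono[OF eventually_tail_filter_mem[OF pB dB]]) (rule 1[OF z])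
    show "wtends (\<lambda>w. \<psi> x - cut z w \<phi> x) (\<psi> x - (z o\<^sub>L \<phi> x)) ?FB" if "x \<in> B" for x
      unfolding cut_def
      by (intro wtends_diff wtends_const wtends_compose_left cA z ncpsu_exhaustion_wtends ZB \<phi> that)
  qed
  show ?thesis
  proof (rule completely_positive_limit[OF tail_filter_not_bot[OF pA dA] B A])
    show "eventually (\<lambda>z. completely_positive B A (\<lambda>x. \<psi> x - (z o\<^sub>L \<phi> x))) ?FA"
      by (rule eventually_mono[OF eventually_tail_filter_mem[OF pA dA]]) (rule 2)
    have "id_blinfun o\<^sub>L y = y" for y :: "'h \<Rightarrow>\<^sub>L 'h" by (rule blinfun_eqI) simp
    then show "wtends (\<lambda>z. \<psi> x - (z o\<^sub>L \<phi> x)) (\<psi> x - \<phi> x) ?FA" for x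
      using wtends_diff[OF wtends_const wtends_compose_right[OF limA, of "\<phi> x"], of "\<psi> x"] by simp
  qed
qed

lemma continuous_dcpo_Q_hom:
  assumes ZA: "exhausting_projections A ZA" and ZB: "exhausting_projections B ZB"
  shows "continuous_dcpo (Q_hom A B)"
proof (rule continuous_dcpoI[OF dcpo_Q_hom[OF A B]])
  fix \<phi> assume "\<phi> \<in> carrier (Q_hom A B)"
  then have \<phi>: "\<phi> \<in> ncpsu_maps B A" by (simp add: Q_hom_carrier[OF A B])
  have pA: "\<And>z. z \<in> ZA \<Longrightarrow> central_projection A z" "\<And>z. z \<in> ZA \<Longrightarrow> finite_corner A z"
    and pB: "\<And>w. w \<in> ZB \<Longrightarrow> central_projection B w" "\<And>w. w \<in> ZB \<Longrightarrow> finite_corner B w"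
    and ne: "ZA \<noteq> {}" "ZB \<noteq> {}"
    using ZA ZB by (auto simp: exhausting_projections_def directed_in_def)
  define D where "D = {scaled_cut B r z w \<phi> | r z w. 0 \<le> r \<and> r < 1 \<and> z \<in> ZA \<and> w \<in> ZB}"
  have D_ncpsu: "d \<in> ncpsu_maps B A" if "d \<in> D" for d
    using that pA pB scaled_cut_ncpsu[OF A B _ _ \<phi>] by (auto simp: D_def)
  have dir: "directed_in (Q_hom A B) D"
    unfolding directed_in_def
  proof (intro conjI ballI)
    show "D \<subseteq> carrier (Q_hom A B)" using D_ncpsu by (auto simp: Q_hom_carrier[OF A B])
    obtain z w where "z \<in> ZA" "w \<in> ZB" using ne by blast
    then have "scaled_cut B 0 z w \<phi> \<in> D" unfolding D_def by force
    then show "D \<noteq> {}" by blast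
    fix c d assume "c \<in> D" "d \<in> D"
    then obtain r z w r' z' w' where
      c: "c = scaled_cut B r z w \<phi>" "0 \<le> r" "r < 1" "z \<in> ZA" "w \<in> ZB" and
      d: "d = scaled_cut B r' z' w' \<phi>" "0 \<le> r'" "r' < 1" "z' \<in> ZA" "w' \<in> ZB"
      unfolding D_def by blast
    obtain y where y: "y \<in> ZA" "y o\<^sub>L z = z" "y o\<^sub>L z' = z'"
      using exhausting_projections_directed[OF A ZA c(4) d(4)] by blast
    obtain v where v: "v \<in> ZB" "v o\<^sub>L w = w" "v o\<^sub>L w' = w'"
      using exhausting_projections_directed[OF B ZB c(5) d(5)] by blast
    let ?e = "scaled_cut B (max r r') y v \<phi>"
    have "?e \<in> D" unfolding D_def using c d y v by (auto simp: max_def)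
    moreover have "c \<sqsubseteq>\<^bsub>Q_hom A B\<^esub> ?e" "d \<sqsubseteq>\<^bsub>Q_hom A B\<^esub> ?e"
      unfolding Q_hom_le[OF A B] c(1) d(1)
      by (rule scaled_cut_mono; use c d y v pA pB \<phi> in simp)+
    ultimately show "\<exists>e\<in>D. c \<sqsubseteq>\<^bsub>Q_hom A B\<^esub> e \<and> d \<sqsubseteq>\<^bsub>Q_hom A B\<^esub> e" by blast
  qed
  have below: "way_below (Q_hom A B) d \<phi>" if "d \<in> D" for d
    using that way_below_scaled_cut[OF A B _ _ _ _ \<phi>] pA pB by (auto simp: D_def)
  have "is_lub (Q_hom A B) \<phi> D"
  proof (rule least_UpperI)
    fix d assume "d \<in> D"
    then obtain r z w where d: "d = scaled_cut B r z w \<phi>" "0 \<le> r" "r < 1" "z \<in> ZA" "w \<in> ZB"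
      by (auto simp: D_def)
    note cp = ncpsuD(3)[OF \<phi>] and zw = pA(1)[OF d(4)] pB(1)[OF d(5)]
    \<comment> \<open>\<open>\<phi> - d\<close> is \<open>\<phi>\<close> minus its cut, plus the
      remaining fraction \<open>1 - r\<close> of the cut.\<close>
    have "completely_positive B A (\<lambda>x. op_scale (of_real (1 - r)) (cut z w \<phi> x))"
      by (rule completely_positive_scale[OF A completely_positive_cut[OF A B zw cp]]) (use d in simp)
    from completely_positive_add[OF A cut_le[OF A B zw cp] this]
    have "completely_positive B A (\<lambda>x. \<phi> x - d x)"
    proof (rule completely_positive_cong[OF _ B])
      fix x assume x: "x \<in> B"
      show "\<phi> x - cut z w \<phi> x + op_scale (of_real (1 - r)) (cut z w \<phi> x) = \<phi> x - d x"
        using x by (intro blinfun_eqI_form) (simp add: d scaled_cut_def blinfun_lin cinner_simps algebra_simps)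
    qed
    then show "d \<sqsubseteq>\<^bsub>Q_hom A B\<^esub> \<phi>" by (simp add: Q_hom_le[OF A B])
  next
    fix \<psi> assume \<psi>: "\<psi> \<in> Upper (Q_hom A B) D"
    then have ub: "completely_positive B A (\<lambda>x. \<psi> x - d x)" if "d \<in> D" for d
      using that D_ncpsu[OF that] by (auto simp: Upper_def Q_hom_def)
    have "\<psi> \<in> ncpsu_maps B A" using \<psi> by (simp add: Upper_def Q_hom_def)
    then have "completely_positive B A (\<lambda>x. \<psi> x - \<phi> x)"
      by (intro scaled_cut_lub[OF ZA ZB \<phi>] ncpsuD(5) ub) (auto simp: D_def)
    then show "\<phi> \<sqsubseteq>\<^bsub>Q_hom A B\<^esub> \<psi>" by (simp add: Q_hom_le[OF A B])
  qed (use dir \<phi> in \<open>simp_all add: directed_in_def Q_hom_def\<close>)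
  then show "\<exists>D. directed_in (Q_hom A B) D \<and> is_lub (Q_hom A B) \<phi> D \<and> (\<forall>x\<in>D. way_below (Q_hom A B) x \<phi>)"
    using dir below by blast
qed

end


section \<open>Composition\<close>

lemma prod_order_simps:
  "carrier (prod_order L K) = carrier L \<times> carrier K"
  "p \<sqsubseteq>\<^bsub>prod_order L K\<^esub> q \<longleftrightarrow> fst p \<sqsubseteq>\<^bsub>L\<^esub> fst q \<and> snd p \<sqsubseteq>\<^bsub>K\<^esub> snd q"
  by (simp_all add: prod_order_def)

lemma prod_order_directed:
  assumes "directed_in (prod_order L K) S"
  shows "directed_in L (fst ` S)" "directed_in K (snd ` S)"
proof -
  have S: "S \<subseteq> carrier L \<times> carrier K" "S \<noteq> {}"
    and dir: "\<And>p q. p \<in> S \<Longrightarrow> q \<in> S \<Longrightarrow> \<exists>r\<in>S. (fst p \<sqsubseteq>\<^bsub>L\<^esub> fst r \<and> snd p \<sqsubseteq>\<^bsub>K\<^esub> snd r)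
      \<and> (fst q \<sqsubseteq>\<^bsub>L\<^esub> fst r \<and> snd q \<sqsubseteq>\<^bsub>K\<^esub> snd r)"
    using assms unfolding directed_in_def prod_order_simps by blast+
  show "directed_in L (fst ` S)"
    unfolding directed_in_def
  proof (intro conjI ballI)
    fix x y assume "x \<in> fst ` S" "y \<in> fst ` S"
    then obtain p q where "p \<in> S" "q \<in> S" "x = fst p" "y = fst q" by blast
    then show "\<exists>z\<in>fst ` S. x \<sqsubseteq>\<^bsub>L\<^esub> z \<and> y \<sqsubseteq>\<^bsub>L\<^esub> z" using dir by blast
  qed (use S in auto)
  show "directed_in K (snd ` S)"
    unfolding directed_in_def
  proof (intro conjI ballI)
    fix x y assume "x \<in> snd ` S" "y \<in> snd ` S"
    then obtain p q where "p \<in> S" "q \<in> S" "x = snd p" "y = snd q" by blast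
    then show "\<exists>z\<in>snd ` S. x \<sqsubseteq>\<^bsub>K\<^esub> z \<and> y \<sqsubseteq>\<^bsub>K\<^esub> z" using dir by blast
  qed (use S in auto)
qed

text \<open>To compare one coordinate with an upper bound, that bound is paired with the other
  coordinate of \<open>s\<close> itself.\<close>

lemma prod_order_lub:
  assumes "directed_in (prod_order L K) S" and lub: "is_lub (prod_order L K) s S"
  shows "is_lub L (fst s) (fst ` S)" "is_lub K (snd s) (snd ` S)"
proof -
  have S: "S \<subseteq> carrier L \<times> carrier K" using assms(1) by (simp add: directed_in_def prod_order_simps)
  have s: "fst s \<in> carrier L" "snd s \<in> carrier K"
    and ub: "\<And>p. p \<in> S \<Longrightarrow> fst p \<sqsubseteq>\<^bsub>L\<^esub> fst s \<and> snd p \<sqsubseteq>\<^bsub>K\<^esub> snd s"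
    using lub S by (auto simp: least_def Upper_def prod_order_simps)
  have least: "fst s \<sqsubseteq>\<^bsub>L\<^esub> a \<and> snd s \<sqsubseteq>\<^bsub>K\<^esub> b"
    if "a \<in> carrier L" "b \<in> carrier K" "\<And>p. p \<in> S \<Longrightarrow> fst p \<sqsubseteq>\<^bsub>L\<^esub> a \<and> snd p \<sqsubseteq>\<^bsub>K\<^esub> b" for a b
  proof -
    have "(a, b) \<in> Upper (prod_order L K) S" using that by (auto simp: Upper_def prod_order_simps)
    then have "s \<sqsubseteq>\<^bsub>prod_order L K\<^esub> (a, b)" using lub unfolding least_def by blast
    then show ?thesis by (simp add: prod_order_simps)
  qed
  show "is_lub L (fst s) (fst ` S)"
  proof (rule least_UpperI)
    fix a assume "a \<in> Upper L (fst ` S)"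
    then have a: "a \<in> carrier L" "\<And>x. x \<in> fst ` S \<Longrightarrow> x \<in> carrier L \<Longrightarrow> x \<sqsubseteq>\<^bsub>L\<^esub> a"
      unfolding Upper_def by blast+
    have "fst p \<sqsubseteq>\<^bsub>L\<^esub> a" if "p \<in> S" for p
      by (rule a(2)[OF imageI[OF that]]) (use S that in auto)
    then show "fst s \<sqsubseteq>\<^bsub>L\<^esub> a" using least[OF a(1) s(2)] ub by blast
  qed (use s ub S in auto)
  show "is_lub K (snd s) (snd ` S)"
  proof (rule least_UpperI)
    fix b assume "b \<in> Upper K (snd ` S)"
    then have b: "b \<in> carrier K" "\<And>x. x \<in> snd ` S \<Longrightarrow> x \<in> carrier K \<Longrightarrow> x \<sqsubseteq>\<^bsub>K\<^esub> b"
      unfolding Upper_def by blast+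
    have "snd p \<sqsubseteq>\<^bsub>K\<^esub> b" if "p \<in> S" for p
      by (rule b(2)[OF imageI[OF that]]) (use S that in auto)
    then show "snd s \<sqsubseteq>\<^bsub>K\<^esub> b" using least[OF s(1) b(1)] ub by blast
  qed (use s ub S in auto)
qed

text \<open>Telescoping through \<open>\<phi>(\<psi>'(x))\<close>: the increase of
  \<open>\<phi>\<close> is composed with \<open>\<psi>'\<close>, and \<open>\<phi>\<close> is
  applied to the increase of \<open>\<psi>\<close>.\<close>

lemma completely_positive_compose_diff:
  assumes A: "von_neumann_algebra A" and B: "von_neumann_algebra B" and C: "von_neumann_algebra C"
    and \<phi>: "completely_positive B A (\<lambda>x. \<phi>' x - \<phi> x)" "linear_map B A \<phi>'" "completely_positive B A \<phi>"
    and \<psi>: "completely_positive C B (\<lambda>x. \<psi>' x - \<psi> x)" "completely_positive C B \<psi>'" "linear_map C B \<psi>"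
  shows "completely_positive C A (\<lambda>x. \<phi>' (\<psi>' x) - \<phi> (\<psi> x))"
proof (rule completely_positive_cong[OF _ C])
  show "completely_positive C A (\<lambda>x. (\<phi>' (\<psi>' x) - \<phi> (\<psi>' x)) + \<phi> (\<psi>' x - \<psi> x))"
    by (rule completely_positive_add[OF A completely_positive_compose[OF \<psi>(2) \<phi>(1)] completely_positive_compose[OF \<psi>(1) \<phi>(3)]])
  fix x assume x: "x \<in> C"
  show "(\<phi>' (\<psi>' x) - \<phi> (\<psi>' x)) + \<phi> (\<psi>' x - \<psi> x) = \<phi>' (\<psi>' x) - \<phi> (\<psi> x)"
    using linear_map_diff[OF B completely_positive_linear[OF \<phi>(3)] completely_positive_mem[OF \<psi>(2) x] linear_mapD(1)[OF \<psi>(3) x]]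
    by simp
qed

text \<open>Joint continuity is reduced to separate continuity: a bound for the composites of the
  pairs in \<open>S\<close> bounds the composites of all combinations of components, and two
  successive limits then reach the composite of the suprema.\<close>

lemma scott_continuous_Q_comp:
  fixes A :: "('h::complex_hilbert_space \<Rightarrow>\<^sub>L 'h) set"
    and B :: "('k::complex_hilbert_space \<Rightarrow>\<^sub>L 'k) set"
    and C :: "('l::complex_hilbert_space \<Rightarrow>\<^sub>L 'l) set"
  assumes A: "von_neumann_algebra A" and B: "von_neumann_algebra B" and C: "von_neumann_algebra C"
  shows "scott_continuous (prod_order (Q_hom A B) (Q_hom B C)) (Q_hom A C) (Q_comp C)"
  unfolding scott_continuous_def preserves_directed_sups_def
proof (intro conjI allI impI)
  have comp: "Q_comp C (\<phi>, \<psi>) \<in> ncpsu_maps C A" if "\<phi> \<in> ncpsu_maps B A" "\<psi> \<in> ncpsu_maps C B" for \<phi> \<psi>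
    unfolding Q_comp_def using ncpsu_compose[OF C B A that(2,1)] by simp
  then show "Q_comp C \<in> carrier (prod_order (Q_hom A B) (Q_hom B C)) \<rightarrow> carrier (Q_hom A C)"
    by (auto simp: prod_order_simps Q_hom_carrier[OF A B] Q_hom_carrier[OF B C] Q_hom_carrier[OF A C])
  fix S s assume S: "directed_in (prod_order (Q_hom A B) (Q_hom B C)) S"
    and lub: "is_lub (prod_order (Q_hom A B) (Q_hom B C)) s S"
  obtain \<phi> \<psi> where s: "s = (\<phi>, \<psi>)" by (cases s)
  note dir1 = prod_order_directed(1)[OF S] and dir2 = prod_order_directed(2)[OF S]
  have lub1: "is_lub (Q_hom A B) \<phi> (fst ` S)" and lub2: "is_lub (Q_hom B C) \<psi> (snd ` S)"
    using prod_order_lub[OF S lub] by (simp_all add: s)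
  have \<phi>: "\<phi> \<in> ncpsu_maps B A" and \<psi>: "\<psi> \<in> ncpsu_maps C B"
    using lub1 lub2 by (simp_all add: least_def Upper_def Q_hom_def)
  have mem: "f \<in> ncpsu_maps B A" "g \<in> ncpsu_maps C B" if "(f, g) \<in> S" for f g
    using S that by (auto simp: directed_in_def prod_order_simps Q_hom_def)
  have comp_apply: "Q_comp C (f, g) x = f (g x)" if "x \<in> C"
    for f :: "('k \<Rightarrow>\<^sub>L 'k) \<Rightarrow> ('h \<Rightarrow>\<^sub>L 'h)" and g :: "('l \<Rightarrow>\<^sub>L 'l) \<Rightarrow> ('k \<Rightarrow>\<^sub>L 'k)" and x
    using that by (simp add: Q_comp_def compose_def)
  have le: "Q_comp C (f, g) \<sqsubseteq>\<^bsub>Q_hom A C\<^esub> \<omega> \<longleftrightarrow> completely_positive C A (\<lambda>x. \<omega> x - f (g x))"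
    for f :: "('k \<Rightarrow>\<^sub>L 'k) \<Rightarrow> ('h \<Rightarrow>\<^sub>L 'h)" and g :: "('l \<Rightarrow>\<^sub>L 'l) \<Rightarrow> ('k \<Rightarrow>\<^sub>L 'k)" and \<omega>
    unfolding Q_hom_le[OF A C]
    by (rule iffI; erule completely_positive_cong[OF _ C]; simp add: comp_apply)
  note lim1 = Q_hom_lub_wtends[OF A B dir1 lub1] and lim2 = Q_hom_lub_wtends[OF B C dir2 lub2]
  note p1 = partial_order_Q_hom[OF A B] and p2 = partial_order_Q_hom[OF B C]
  show "is_lub (Q_hom A C) (Q_comp C s) (Q_comp C ` S)"
  proof (rule least_UpperI)
    fix h assume "h \<in> Q_comp C ` S"
    then obtain f g where fg: "(f, g) \<in> S" "h = Q_comp C (f, g)" by auto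
    have fgS: "f \<in> fst ` S" "g \<in> snd ` S"
      using imageI[OF fg(1), of fst] imageI[OF fg(1), of snd] by simp_all
    have "completely_positive B A (\<lambda>x. \<phi> x - f x)"
      by (rule Q_hom_limit_upper[OF A B dir1 lim1 fgS(1)])
    moreover have "completely_positive C B (\<lambda>x. \<psi> x - g x)"
      by (rule Q_hom_limit_upper[OF B C dir2 lim2 fgS(2)])
    ultimately have "completely_positive C A (\<lambda>x. \<phi> (\<psi> x) - f (g x))"
      using completely_positive_compose_diff[OF A B C] ncpsuD(3,5)[OF \<phi>] ncpsuD(3,5)[OF \<psi>]
        ncpsuD(3,5)[OF mem(1)[OF fg(1)]] ncpsuD(3,5)[OF mem(2)[OF fg(1)]] by blast
    then show "h \<sqsubseteq>\<^bsub>Q_hom A C\<^esub> Q_comp C s"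
      unfolding fg(2) le by (rule completely_positive_cong[OF _ C]) (simp add: s comp_apply)
  next
    fix \<omega> assume "\<omega> \<in> Upper (Q_hom A C) (Q_comp C ` S)"
    then have ub: "completely_positive C A (\<lambda>x. \<omega> x - f (g x))" if "(f, g) \<in> S" for f g
      using that comp[OF mem[OF that]] unfolding le[symmetric] by (auto simp: Upper_def Q_hom_carrier[OF A C])
    \<comment> \<open>A pair containing \<open>f\<close> and a pair containing \<open>g\<close> have
      a common upper pair in \<open>S\<close>, whose composite lies above that of \<open>f\<close>
      and \<open>g\<close>.\<close>
    have 1: "completely_positive C A (\<lambda>x. \<omega> x - f (g x))" if f: "f \<in> fst ` S" and g: "g \<in> snd ` S" for f g
    proof -
      obtain g0 f0 where fg: "(f, g0) \<in> S" "(f0, g) \<in> S" using f g by auto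
      then have "\<exists>q\<in>S. (f \<sqsubseteq>\<^bsub>Q_hom A B\<^esub> fst q \<and> g0 \<sqsubseteq>\<^bsub>Q_hom B C\<^esub> snd q)
          \<and> (f0 \<sqsubseteq>\<^bsub>Q_hom A B\<^esub> fst q \<and> g \<sqsubseteq>\<^bsub>Q_hom B C\<^esub> snd q)"
        using S unfolding directed_in_def prod_order_simps by fastforce
      then obtain f' g' where fg': "(f', g') \<in> S"
        "f \<sqsubseteq>\<^bsub>Q_hom A B\<^esub> f'" "g \<sqsubseteq>\<^bsub>Q_hom B C\<^esub> g'"
        by auto
      have "completely_positive C A (\<lambda>x. f' (g' x) - f (g x))"
        by (rule completely_positive_compose_diff[OF A B C])
          (use fg'(2,3) ncpsuD(5)[OF mem(1)[OF fg'(1)]] ncpsuD(3)[OF mem(1)[OF fg(1)]]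
            ncpsuD(3)[OF mem(2)[OF fg'(1)]] ncpsuD(5)[OF mem(2)[OF fg(2)]]
            in \<open>simp_all add: Q_hom_le[OF A B] Q_hom_le[OF B C]\<close>)
      then show ?thesis by (rule completely_positive_diff_trans[OF A _ ub[OF fg'(1)]])
    qed
    \<comment> \<open>The limit over \<open>g\<close> is taken inside \<open>f\<close>, so it needs
      normality of \<open>f\<close>.\<close>
    have 2: "completely_positive C A (\<lambda>x. \<omega> x - f (\<psi> x))" if f: "f \<in> fst ` S" for f
    proof (rule completely_positive_limit[OF tail_filter_not_bot[OF p2 dir2] C A])
      show "eventually (\<lambda>g. completely_positive C A (\<lambda>x. \<omega> x - f (g x))) (tail_filter (Q_hom B C) (snd ` S))"
        by (rule eventually_mono[OF eventually_tail_filter_mem[OF p2 dir2]]) (rule 1[OF f])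
      have fn: "f \<in> ncpsu_maps B A" by (rule Q_hom_directed_ncpsu[OF A B dir1 f])
      have "wtends (\<lambda>g. f (g x)) (f (\<psi> x)) (tail_filter (Q_hom B C) (snd ` S))" if x: "x \<in> C" for x
      proof (rule wtends_extend[OF C x])
        fix p assume p: "p \<in> C" "op_positive p"
        show "wtends (\<lambda>g. f (g p)) (f (\<psi> p)) (tail_filter (Q_hom B C) (snd ` S))"
          by (rule ncpsu_wtends[OF B A fn Q_hom_mono_net[OF B C dir2 p] lim2[OF p(1)]])
      next
        show "eventually (\<lambda>g. linear_map C A (\<lambda>x. f (g x))) (tail_filter (Q_hom B C) (snd ` S))"
          by (rule eventually_mono[OF eventually_tail_filter_mem[OF p2 dir2]])
            (rule linear_map_compose[OF ncpsuD(5)[OF Q_hom_directed_ncpsu[OF B C dir2]] ncpsuD(5)[OF fn]])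
        show "linear_map C A (\<lambda>x. f (\<psi> x))" by (rule linear_map_compose[OF ncpsuD(5)[OF \<psi>] ncpsuD(5)[OF fn]])
      qed
      then show "wtends (\<lambda>g. \<omega> x - f (g x)) (\<omega> x - f (\<psi> x)) (tail_filter (Q_hom B C) (snd ` S))"
        if "x \<in> C" for x using that by (intro wtends_diff wtends_const)
    qed
    \<comment> \<open>The limit over \<open>f\<close> is taken at the fixed arguments
      \<open>\<psi> x\<close>, where pointwise convergence is enough.\<close>
    have "completely_positive C A (\<lambda>x. \<omega> x - \<phi> (\<psi> x))"
    proof (rule completely_positive_limit[OF tail_filter_not_bot[OF p1 dir1] C A])
      show "eventually (\<lambda>f. completely_positive C A (\<lambda>x. \<omega> x - f (\<psi> x))) (tail_filter (Q_hom A B) (fst ` S))"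
        by (rule eventually_mono[OF eventually_tail_filter_mem[OF p1 dir1]]) (rule 2)
      show "wtends (\<lambda>f. \<omega> x - f (\<psi> x)) (\<omega> x - \<phi> (\<psi> x)) (tail_filter (Q_hom A B) (fst ` S))" if "x \<in> C" for x
        by (intro wtends_diff wtends_const lim1 completely_positive_mem[OF ncpsuD(3)[OF \<psi>] that])
    qed
    then show "Q_comp C s \<sqsubseteq>\<^bsub>Q_hom A C\<^esub> \<omega>" unfolding s le .
  qed (use comp mem \<phi> \<psi> in \<open>auto simp: s Q_hom_carrier[OF A C]\<close>)
qed

theorem mainTheorem1:
  fixes A :: "('h::complex_hilbert_space \<Rightarrow>\<^sub>L 'h) set"
    and B :: "('k::complex_hilbert_space \<Rightarrow>\<^sub>L 'k) set"
    and C :: "('l::complex_hilbert_space \<Rightarrow>\<^sub>L 'l) set"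
  assumes "hereditarily_atomic TYPE('i) A"
    and "hereditarily_atomic TYPE('j) B"
    and "hereditarily_atomic TYPE('m) C"
  shows "continuous_dcpo (Q_hom A B) \<and>
    scott_continuous (prod_order (Q_hom A B) (Q_hom B C)) (Q_hom A C) (Q_comp C)"
proof -
  have vn: "von_neumann_algebra A" "von_neumann_algebra B" "von_neumann_algebra C"
    using assms by (simp_all add: hereditarily_atomic_def)
  obtain ZA ZB where "exhausting_projections A ZA" "exhausting_projections B ZB"
    using hereditarily_atomic_exhausting_projections[OF assms(1)]
      hereditarily_atomic_exhausting_projections[OF assms(2)] by blast
  then show ?thesis
    using continuous_dcpo_Q_hom[OF vn(1,2)] scott_continuous_Q_comp[OF vn] by blast
qed

end
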